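(* Let $\Gamma$ be a tropical curve and $D$ a divisor on $\Gamma$. Let $\mathcal S$ be the set of rational functions $f\in R(D)$ such that the support of $D+(f)$ does not contain a smooth cut set of $\Gamma$. Then: (a) $\mathcal S$ contains all the extremals of $R(D)$; (b) $\mathcal S$ is finite modulo tropical scaling (i.e. modulo adding real constants); (c) $\mathcal S$ generates $R(D)$ as a tropical semi-module, i.e. every element of $R(D)$ is a finite tropical linear combination $(a_1\odot f_1)\oplus\cdots\oplus(a_n\odot f_n)$ with $a_i\in\mathbb R$, $f_i\in\mathcal S$.
   Context: A metric graph is a compact connected metric space in which every point $x$ has a neighborhood isometric to a star-shaped set of some valence $\mathrm{val}(x)\ge 1$ with the path metric. A tropical curve $\Gamma$ is a metric graph in which leaf edges may have length $\infty$ (a one-valent "point at infinity" is included for each unbounded edge). A divisor is a finite formal sum $D=\sum_{x\in\Gamma}D(x)\cdot x$ with $D(x)\in\mathbb Z$; it is effective if all $D(x)\ge 0$; $\mathrm{supp}(D)=\{x: D(x)\ne 0\}$. A (tropical) rational function on $\Gamma$ is a continuous function $f$ on $\Gamma$ that is piecewise linear on each edge with finitely many pieces and integer slopes; it is real-valued, except that it may take values $\pm\infty$ at points at infinity. $\mathrm{ord}_x(f)$ is the sum of the outgoing slopes of $f$ at $x$, and $(f)=\sum_x \mathrm{ord}_x(f)\cdot x$. $R(D)$ is the set of rational functions $f$ with $D+(f)$ effective. Tropical operations (pointwise on functions): $f\oplus g=\max(f,g)$, and for $a\in\mathbb R$, $a\odot f=a+f$. An element $f\in R(D)$ is extremal if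 for all $g_1,g_2\in R(D)$, $f=g_1\oplus g_2$ implies $f=g_1$ or $f=g_2$. A cut set of $\Gamma$ is a set of points $A\subset\Gamma$ such that $\Gamma\setminus A$ is not connected. A smooth cut set is a cut set consisting of points of valence 2. *)

theory Defs
  imports "HOL-Analysis.Analysis"
begin

(* The tropical curve is the whole type 'a :: t2_space; I is its set of points at infinity, and d is
   the metric on the finite part -I (the values of d at points of I are irrelevant).

   star_chart d I x n r \<gamma>: the n arms \<gamma> 0, ..., \<gamma> (n - 1), each parametrized by arc length over [0,r),
   form a neighbourhood of x isometric to the star of valence n and radius r with centre x, that is,
   to n copies of [0,r) glued at 0, with the path metric. *)
definition star_chart ::
    "('a::t2_space \<Rightarrow> 'a \<Rightarrow> real) \<Rightarrow> 'a set \<Rightarrow> 'a \<Rightarrow> nat \<Rightarrow> real \<Rightarrow> (nat \<Rightarrow> real \<Rightarrow> 'a) \<Rightarrow> bool" where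
  "star_chart d I x n r \<gamma> \<longleftrightarrow>
     1 \<le> n \<and> 0 < r \<and>
     (\<forall>i<n. \<gamma> i 0 = x) \<and>
     (\<forall>i<n. \<forall>t\<in>{0..<r}. \<gamma> i t \<notin> I) \<and>
     (\<forall>i<n. \<forall>j<n. \<forall>s\<in>{0..<r}. \<forall>t\<in>{0..<r}.
        d (\<gamma> i s) (\<gamma> j t) = (if i = j then \<bar>s - t\<bar> else s + t)) \<and>
     x \<in> interior (\<Union>i<n. \<gamma> i ` {0..<r})"

(* A neighbourhood of the point at infinity p is an unbounded leaf edge [0,\<infinity>], with p at \<infinity>. *)
definition end_chart ::
    "('a::t2_space \<Rightarrow> 'a \<Rightarrow> real) \<Rightarrow> 'a set \<Rightarrow> 'a \<Rightarrow> (real \<Rightarrow> 'a) \<Rightarrow> bool" where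
  "end_chart d I p \<phi> \<longleftrightarrow>
     (\<forall>t\<ge>0. \<phi> t \<notin> I) \<and>
     (\<forall>s\<ge>0. \<forall>t\<ge>0. d (\<phi> s) (\<phi> t) = \<bar>s - t\<bar>) \<and>
     (\<phi> \<longlongrightarrow> p) at_top \<and>
     p \<in> interior (insert p (\<phi> ` {0..}))"

(* For I = {} this says that d makes 'a a compact connected metric space that is locally isometric
   to stars, i.e. a metric graph. *)
definition tropical_curve :: "('a::t2_space \<Rightarrow> 'a \<Rightarrow> real) \<Rightarrow> 'a set \<Rightarrow> bool" where
  "tropical_curve d I \<longleftrightarrow>
     Metric_space (- I) d \<and>
     top_of_set (- I) = Metric_space.mtopology (- I) d \<and>
     compact (UNIV :: 'a set) \<and> connected (UNIV :: 'a set) \<and>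
     finite I \<and>
     (\<forall>x. x \<notin> I \<longrightarrow> (\<exists>n r \<gamma>. star_chart d I x n r \<gamma>)) \<and>
     (\<forall>p\<in>I. \<exists>\<phi>. end_chart d I p \<phi>)"

definition valence :: "('a::t2_space \<Rightarrow> 'a \<Rightarrow> real) \<Rightarrow> 'a set \<Rightarrow> 'a \<Rightarrow> nat" where
  "valence d I x = (if x \<in> I then 1 else (THE n. \<exists>r \<gamma>. star_chart d I x n r \<gamma>))"

definition cut_set :: "'a::t2_space set \<Rightarrow> bool" where
  "cut_set A \<longleftrightarrow> \<not> connected (UNIV - A)"

definition smooth_cut_set :: "('a::t2_space \<Rightarrow> 'a \<Rightarrow> real) \<Rightarrow> 'a set \<Rightarrow> 'a set \<Rightarrow> bool" where
  "smooth_cut_set d I A \<longleftrightarrow> cut_set A \<and> (\<forall>x\<in>A. valence d I x = 2)"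

definition supp :: "('a \<Rightarrow> int) \<Rightarrow> 'a set" where
  "supp D = {x. D x \<noteq> 0}"

definition divisor :: "('a \<Rightarrow> int) \<Rightarrow> bool" where
  "divisor D \<longleftrightarrow> finite (supp D)"

definition effective :: "('a \<Rightarrow> int) \<Rightarrow> bool" where
  "effective D \<longleftrightarrow> (\<forall>x. D x \<ge> 0)"

(* B subdivides the curve into finitely many open edges, on each of which f is affine with integer
   slope. B has to contain I, all points of valence other than 2, and the breakpoints of f. *)
definition pw_linear :: "('a::t2_space \<Rightarrow> 'a \<Rightarrow> real) \<Rightarrow> 'a set \<Rightarrow> ('a \<Rightarrow> ereal) \<Rightarrow> bool" where
  "pw_linear d I f \<longleftrightarrow>
     (\<exists>B. finite B \<and> I \<subseteq> B \<and>
        (\<forall>x. x \<notin> B \<longrightarrow>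
           (\<exists>r \<gamma>. \<exists>m::int. star_chart d I x 2 r \<gamma> \<and>
              (\<forall>t\<in>{0..<r}. f (\<gamma> 0 t) = f x + ereal (of_int m * t) \<and>
                            f (\<gamma> 1 t) = f x - ereal (of_int m * t)))))"

definition rational_function :: "('a::t2_space \<Rightarrow> 'a \<Rightarrow> real) \<Rightarrow> 'a set \<Rightarrow> ('a \<Rightarrow> ereal) \<Rightarrow> bool" where
  "rational_function d I f \<longleftrightarrow>
     continuous_on UNIV f \<and> (\<forall>x. x \<notin> I \<longrightarrow> \<bar>f x\<bar> \<noteq> \<infinity>) \<and> pw_linear d I f"

(* Away from I: the sum of the slopes s i of f along the n arms leaving x.
   At a point at infinity: the slope of f along the edge, traversed from infinity inwards (against
   the parameter t of the end chart). *)
definition ord_at ::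
    "('a::t2_space \<Rightarrow> 'a \<Rightarrow> real) \<Rightarrow> 'a set \<Rightarrow> 'a \<Rightarrow> ('a \<Rightarrow> ereal) \<Rightarrow> int" where
  "ord_at d I x f =
     (if x \<in> I
      then THE m. \<exists>\<phi> c. end_chart d I x \<phi> \<and>
                    eventually (\<lambda>t. f (\<phi> t) = ereal (c - of_int m * t)) at_top
      else THE m. \<exists>n r \<gamma> s. star_chart d I x n r \<gamma> \<and>
                    (\<forall>i<n. eventually (\<lambda>t. f (\<gamma> i t) = f x + ereal (of_int (s i) * t)) (at_right 0)) \<and>
                    m = (\<Sum>i<n. s i))"

definition princ_div ::
    "('a::t2_space \<Rightarrow> 'a \<Rightarrow> real) \<Rightarrow> 'a set \<Rightarrow> ('a \<Rightarrow> ereal) \<Rightarrow> 'a \<Rightarrow> int" where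
  "princ_div d I f = (\<lambda>x. ord_at d I x f)"

definition div_add :: "('a \<Rightarrow> int) \<Rightarrow> ('a \<Rightarrow> int) \<Rightarrow> 'a \<Rightarrow> int" where
  "div_add D E = (\<lambda>x. D x + E x)"

definition Rset ::
    "('a::t2_space \<Rightarrow> 'a \<Rightarrow> real) \<Rightarrow> 'a set \<Rightarrow> ('a \<Rightarrow> int) \<Rightarrow> ('a \<Rightarrow> ereal) set" where
  "Rset d I D = {f. rational_function d I f \<and> effective (div_add D (princ_div d I f))}"

definition trop_add :: "('a \<Rightarrow> ereal) \<Rightarrow> ('a \<Rightarrow> ereal) \<Rightarrow> 'a \<Rightarrow> ereal" where
  "trop_add f g = (\<lambda>x. max (f x) (g x))"

definition trop_scale :: "real \<Rightarrow> ('a \<Rightarrow> ereal) \<Rightarrow> 'a \<Rightarrow> ereal" where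
  "trop_scale a f = (\<lambda>x. ereal a + f x)"

definition trop_sum :: "nat \<Rightarrow> (nat \<Rightarrow> 'a \<Rightarrow> ereal) \<Rightarrow> 'a \<Rightarrow> ereal" where
  "trop_sum n h = (\<lambda>x. Max ((\<lambda>i. h i x) ` {1..n}))"

definition extremal ::
    "('a::t2_space \<Rightarrow> 'a \<Rightarrow> real) \<Rightarrow> 'a set \<Rightarrow> ('a \<Rightarrow> int) \<Rightarrow> ('a \<Rightarrow> ereal) \<Rightarrow> bool" where
  "extremal d I D f \<longleftrightarrow> f \<in> Rset d I D \<and>
     (\<forall>g1\<in>Rset d I D. \<forall>g2\<in>Rset d I D. f = trop_add g1 g2 \<longrightarrow> f = g1 \<or> f = g2)"

definition scaling_rel :: "('a \<Rightarrow> ereal) set \<Rightarrow> (('a \<Rightarrow> ereal) \<times> ('a \<Rightarrow> ereal)) set" where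
  "scaling_rel S = {(f, g). f \<in> S \<and> g \<in> S \<and> (\<exists>a. g = trop_scale a f)}"

definition smooth_cut_free ::
    "('a::t2_space \<Rightarrow> 'a \<Rightarrow> real) \<Rightarrow> 'a set \<Rightarrow> ('a \<Rightarrow> int) \<Rightarrow> ('a \<Rightarrow> ereal) set" where
  "smooth_cut_free d I D =
     {f \<in> Rset d I D. \<not> (\<exists>A. smooth_cut_set d I A \<and> A \<subseteq> supp (div_add D (princ_div d I f)))}"

end

theory Submission
  imports Defs
begin

text \<open>
  Outside a finite set \<open>B\<close> of points the curve is a disjoint union of open edges. Each edge is recorded
  by its directed versions (darts): a dart starts at an arm of a point of \<open>B\<close> and is the maximal
  unit-speed geodesic outside \<open>B\<close> that continues this arm.

  For (b), counting the slopes that leave a superlevel set of \<open>f\<close> bounds all slopes of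
  \<open>f \<in> R(D)\<close> by the degree of \<open>\<bar>D\<bar>\<close>. If \<open>D + (f)\<close> supports no smooth cut set, every edge carries at
  most one break point, and the edges without break point connect all of \<open>B\<close>. So the integer
  slopes of \<open>f\<close> at the starts of the darts determine \<open>f\<close> up to a constant.

  For (a) and (c), let \<open>A\<close> be a minimal smooth cut set in the support of \<open>D + (f)\<close>, with sides \<open>U1\<close>
  and \<open>U2\<close>. Firing the closure of either side moves all chips on \<open>A\<close> into the other side; a cluster
  of \<open>s\<close> chips moves at speed \<open>1 / s\<close>, so that it never splits, until a cluster is absorbed.
  The two resulting functions have maximum \<open>f\<close>, and both have fewer points of valence 2 in
  the support of their divisor. So \<open>f\<close> is not extremal, and (c) follows by induction.
\<close>

section \<open>Stars and lines\<close>

text \<open>No combinatorial graph is given: the curve is a compact space with a metric on its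
  finite part, and only local charts are known. Edges have to be produced by continuing geodesics
  and are compared by the way they meet. The locale \<open>model\<close> is used with three vertex
  sets. For the slope bound \<open>B\<close> contains every point where the given \<open>f\<close>
  has nonzero order, so that \<open>f\<close> is affine on each dart. For (b) it depends only on
  \<open>D\<close>, so that all members of \<open>S\<close> are described on the same darts. For
  firing it contains the support of \<open>D + (f)\<close>, so that chips start at vertices. A
  finite point is added each time, since a circle has no branch points. Rational functions are
  handled through one-sided germs; their continuity and the finite set of break points are recovered
  from the germs. The splitting for (a) and (c) uses corrections that are at most 0 and vanish off
  one side of the cut. The number of chip-carrying points of valence 2 serves as measure, because a
  moved cluster may stop anywhere inside an edge: the degree does not change and the positions are
  not discrete.\<close>

locale trop_curve =
  fixes d :: "'a::t2_space \<Rightarrow> 'a \<Rightarrow> real" and I :: "'a set"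
  assumes curve: "tropical_curve d I"
begin

lemma metric: "Metric_space (- I) d"
  using curve by (simp add: tropical_curve_def)

lemma finite_I: "finite I" and compact_UNIV: "compact (UNIV :: 'a set)"
  and connected_UNIV: "connected (UNIV :: 'a set)"
  using curve by (auto simp: tropical_curve_def)

lemma closed_I: "closed I"
  using finite_I by (rule finite_imp_closed)

text \<open>The hypotheses describe by the metric only the subspace topology of \<open>- I\<close>.
  As \<open>I\<close> is finite, hence closed, a subset of \<open>- I\<close> is open there exactly
  when it is open in the whole space.\<close>

lemma open_iff:
  assumes "U \<subseteq> - I"
  shows "open U \<longleftrightarrow> (\<forall>x\<in>U. \<exists>r>0. \<forall>y. y \<notin> I \<longrightarrow> d x y < r \<longrightarrow> y \<in> U)"
proof -
  have "open U \<longleftrightarrow> openin (top_of_set (- I)) U"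
    using assms closed_I by (simp add: openin_open_eq open_Compl)
  also have "\<dots> \<longleftrightarrow> openin (Metric_space.mtopology (- I) d) U"
    using curve by (simp add: tropical_curve_def)
  also have "... \<longleftrightarrow> (\<forall>x\<in>U. \<exists>r>0. Metric_space.mball (- I) d x r \<subseteq> U)"
    using assms unfolding Metric_space.openin_mtopology[OF metric] by blast
  also have "... \<longleftrightarrow> (\<forall>x\<in>U. \<exists>r>0. \<forall>y. y \<notin> I \<longrightarrow> d x y < r \<longrightarrow> y \<in> U)"
  proof (rule ball_cong[OF refl])
    fix x assume "x \<in> U"
    then have "Metric_space.mball (- I) d x r \<subseteq> U \<longleftrightarrow> (\<forall>y. y \<notin> I \<longrightarrow> d x y < r \<longrightarrow> y \<in> U)" for r
      using assms by (auto simp: subset_iff Metric_space.in_mball[OF metric])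
    then show "(\<exists>r>0. Metric_space.mball (- I) d x r \<subseteq> U) \<longleftrightarrow> (\<exists>r>0. \<forall>y. y \<notin> I \<longrightarrow> d x y < r \<longrightarrow> y \<in> U)"
      by simp
  qed
  finally show ?thesis .
qed

lemma d_nonneg [simp]: "0 \<le> d x y"
  by (rule Metric_space.nonneg[OF metric])

lemma d_commute: "d x y = d y x"
  by (rule Metric_space.commute[OF metric])

lemma d_pos: "x \<notin> I \<Longrightarrow> y \<notin> I \<Longrightarrow> d x y = 0 \<longleftrightarrow> x = y"
  using Metric_space.zero[OF metric] by simp

lemma d_self: "x \<notin> I \<Longrightarrow> d x x = 0"
  using d_pos by simp

lemma d_tri: "x \<notin> I \<Longrightarrow> y \<notin> I \<Longrightarrow> z \<notin> I \<Longrightarrow> d x z \<le> d x y + d y z"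
  using Metric_space.triangle[OF metric] by simp

lemma open_ball: "x \<notin> I \<Longrightarrow> open {y. y \<notin> I \<and> d x y < r}"
proof (subst open_iff)
  assume x: "x \<notin> I"
  show "\<forall>y\<in>{y. y \<notin> I \<and> d x y < r}. \<exists>e>0. \<forall>z. z \<notin> I \<longrightarrow> d y z < e \<longrightarrow> z \<in> {y. y \<notin> I \<and> d x y < r}"
  proof
    fix y assume y: "y \<in> {y. y \<notin> I \<and> d x y < r}"
    show "\<exists>e>0. \<forall>z. z \<notin> I \<longrightarrow> d y z < e \<longrightarrow> z \<in> {y. y \<notin> I \<and> d x y < r}"
    proof (intro exI[of _ "r - d x y"] conjI allI impI)
      fix z assume "z \<notin> I" "d y z < r - d x y"
      then show "z \<in> {y. y \<notin> I \<and> d x y < r}"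
        using x y d_tri[of x y z] by auto
    qed (use y in auto)
  qed
qed auto

lemma ball_in_open:
  assumes "open U" "x \<in> U" "x \<notin> I"
  obtains r where "0 < r" "\<forall>y. y \<notin> I \<longrightarrow> d x y < r \<longrightarrow> y \<in> U"
proof -
  have "open (U - I)" using assms closed_I by auto
  then have "\<forall>x\<in>U - I. \<exists>r>0. \<forall>y. y \<notin> I \<longrightarrow> d x y < r \<longrightarrow> y \<in> U - I"
    by (subst (asm) open_iff) auto
  then show ?thesis using assms that by blast
qed

text \<open>A metric form of \<open>star_chart\<close>: that the arms form a neighbourhood is
  strengthened to covering the whole ball of the same radius \<open>r\<close>. Arguments about stars
  can then work with distances alone.\<close>

definition mstar :: "'a \<Rightarrow> nat \<Rightarrow> real \<Rightarrow> (nat \<Rightarrow> real \<Rightarrow> 'a) \<Rightarrow> bool" where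
  "mstar x n r \<gamma> \<longleftrightarrow>
     1 \<le> n \<and> 0 < r \<and> x \<notin> I \<and>
     (\<forall>i<n. \<gamma> i 0 = x) \<and>
     (\<forall>i<n. \<forall>t. 0 \<le> t \<longrightarrow> t < r \<longrightarrow> \<gamma> i t \<notin> I) \<and>
     (\<forall>i<n. \<forall>j<n. \<forall>s t. 0 \<le> s \<longrightarrow> s < r \<longrightarrow> 0 \<le> t \<longrightarrow> t < r \<longrightarrow>
        d (\<gamma> i s) (\<gamma> j t) = (if i = j then \<bar>s - t\<bar> else s + t)) \<and>
     (\<forall>y. y \<notin> I \<longrightarrow> d x y < r \<longrightarrow> (\<exists>i<n. \<exists>t. 0 \<le> t \<and> t < r \<and> y = \<gamma> i t))"

lemma mstarD:
  assumes "mstar x n r \<gamma>"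
  shows "1 \<le> n" "0 < r" "x \<notin> I" "i < n \<Longrightarrow> \<gamma> i 0 = x"
    "i < n \<Longrightarrow> 0 \<le> t \<Longrightarrow> t < r \<Longrightarrow> \<gamma> i t \<notin> I"
    "i < n \<Longrightarrow> j < n \<Longrightarrow> 0 \<le> s \<Longrightarrow> s < r \<Longrightarrow> 0 \<le> t \<Longrightarrow> t < r \<Longrightarrow>
       d (\<gamma> i s) (\<gamma> j t) = (if i = j then \<bar>s - t\<bar> else s + t)"
    "y \<notin> I \<Longrightarrow> d x y < r \<Longrightarrow> \<exists>i<n. \<exists>t. 0 \<le> t \<and> t < r \<and> y = \<gamma> i t"
  using assms by (simp_all add: mstar_def)

lemma mstar_dist0:
  assumes "mstar x n r \<gamma>" "i < n" "0 \<le> t" "t < r"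
  shows "d x (\<gamma> i t) = t"
  using mstarD(6)[OF assms(1,2,2), of 0 t] mstarD(2,4)[OF assms(1)] assms by auto

text \<open>A chart may fail to fill the ball of its own radius, so the radius is cut down to a ball
  inside the interior. Distance to \<open>x\<close> is the arm parameter, so the shortened arms fill
  this ball.\<close>

lemma star_chart_imp_mstar:
  assumes "star_chart d I x n r \<gamma>"
  obtains r' where "0 < r'" "r' \<le> r" "mstar x n r' \<gamma>"
proof -
  have sc: "1 \<le> n" "0 < r" "\<And>i. i < n \<Longrightarrow> \<gamma> i 0 = x" "\<And>i t. i < n \<Longrightarrow> 0 \<le> t \<Longrightarrow> t < r \<Longrightarrow> \<gamma> i t \<notin> I"
    "\<And>i j s t. i < n \<Longrightarrow> j < n \<Longrightarrow> 0 \<le> s \<Longrightarrow> s < r \<Longrightarrow> 0 \<le> t \<Longrightarrow> t < r \<Longrightarrow>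
        d (\<gamma> i s) (\<gamma> j t) = (if i = j then \<bar>s - t\<bar> else s + t)"
    "x \<in> interior (\<Union>i<n. \<gamma> i ` {0..<r})"
    using assms unfolding star_chart_def by auto
  have x: "x \<notin> I" using sc(1-3) sc(4)[of 0 0] by auto
  obtain e where e: "0 < e" "\<forall>y. y \<notin> I \<longrightarrow> d x y < e \<longrightarrow> y \<in> interior (\<Union>i<n. \<gamma> i ` {0..<r})"
    using ball_in_open[OF open_interior sc(6) x] by blast
  have d0: "d x (\<gamma> i t) = t" if "i < n" "0 \<le> t" "t < r" for i t
    using sc(5)[OF that(1,1), of 0 t] sc(2,3) that by auto
  have "mstar x n (min e r) \<gamma>"
    unfolding mstar_def
  proof (intro conjI allI impI)
    fix y assume y: "y \<notin> I" "d x y < min e r"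
    then have "y \<in> (\<Union>i<n. \<gamma> i ` {0..<r})" using e interior_subset by fastforce
    then obtain i t where it: "i < n" "0 \<le> t" "t < r" "y = \<gamma> i t" by auto
    then have "d x y = t" using d0 by simp
    then show "\<exists>i<n. \<exists>t\<ge>0. t < min e r \<and> y = \<gamma> i t" using it y by auto
  qed (use sc x e in auto)
  then show ?thesis using that[of "min e r"] e sc by auto
qed

lemma mstar_imp_star_chart:
  assumes "mstar x n r \<gamma>"
  shows "star_chart d I x n r \<gamma>"
proof -
  have "{y. y \<notin> I \<and> d x y < r} \<subseteq> (\<Union>i<n. \<gamma> i ` {0..<r})"
    using mstarD(7)[OF assms] by fastforce
  moreover have "x \<in> {y. y \<notin> I \<and> d x y < r}"
    using mstarD(2,3)[OF assms] d_self by auto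
  ultimately have "x \<in> interior (\<Union>i<n. \<gamma> i ` {0..<r})"
    using open_ball[OF mstarD(3)[OF assms]] by (meson interior_maximal subsetD)
  then show ?thesis unfolding star_chart_def using mstarD[OF assms] by auto
qed

text \<open>Distance to the centre reads off the arm parameter, so a point of one star reappears at
  the same parameter on some arm of the other. The arm cannot change along the way, because points
  on distinct arms are \<open>s + t\<close> apart. This makes valence and order independent of the
  chart.\<close>

lemma mstar_compare:
  assumes S: "mstar x n r \<gamma>" and S': "mstar x n' r' \<gamma>'"
  obtains \<pi> where "bij_betw \<pi> {..<n} {..<n'}"
    "\<forall>i<n. \<forall>t. 0 \<le> t \<longrightarrow> t < min r r' \<longrightarrow> \<gamma> i t = \<gamma>' (\<pi> i) t"
proof -
  have *: "\<exists>\<pi>. inj_on \<pi> {..<n} \<and> \<pi> ` {..<n} \<subseteq> {..<n'} \<and>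
      (\<forall>i<n. \<forall>t. 0 \<le> t \<longrightarrow> t < min r r' \<longrightarrow> \<gamma> i t = \<gamma>' (\<pi> i) t)"
    if S: "mstar x n r \<gamma>" and S': "mstar x n' r' \<gamma>'" for n n' r r' \<gamma> \<gamma>'
  proof -
    \<comment> \<open>The matching of the arms is read off at one common positive parameter;
      parameter 0 would not distinguish the arms.\<close>
    define t0 where "t0 = min r r' / 2"
    have t0: "0 < t0" "t0 < r" "t0 < r'" using mstarD(2)[OF S] mstarD(2)[OF S'] by (auto simp: t0_def)
    have ex: "\<exists>j<n'. \<gamma> i t = \<gamma>' j t" if it: "i < n" "0 \<le> t" "t < min r r'" for i t
    proof -
      have dt: "d x (\<gamma> i t) = t" using mstar_dist0[OF S] it by auto
      then obtain j s where j: "j < n'" "0 \<le> s" "s < r'" "\<gamma> i t = \<gamma>' j s"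
        using mstarD(7)[OF S', of "\<gamma> i t"] mstarD(5)[OF S, of i t] it dt by (metis min_less_iff_conj)
      then have "s = t" using mstar_dist0[OF S' j(1-3)] dt by simp
      then show ?thesis using j by auto
    qed
    have "\<forall>i. \<exists>j. i < n \<longrightarrow> j < n' \<and> \<gamma> i t0 = \<gamma>' j t0" using ex[of _ t0] t0 by auto
    then obtain \<pi> where \<pi>: "\<And>i. i < n \<Longrightarrow> \<pi> i < n' \<and> \<gamma> i t0 = \<gamma>' (\<pi> i) t0" by metis
    have eq: "\<gamma> i t = \<gamma>' (\<pi> i) t" if i: "i < n" and t: "0 \<le> t" "t < min r r'" for i t
    proof -
      obtain k where k: "k < n'" "\<gamma> i t = \<gamma>' k t" using ex[OF i t] by blast
      show ?thesis
      proof (cases "k = \<pi> i")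
        case False
        have "d (\<gamma> i t) (\<gamma> i t0) = \<bar>t - t0\<bar>" using mstarD(6)[OF S i i] t t0 by auto
        moreover have "d (\<gamma>' k t) (\<gamma>' (\<pi> i) t0) = t + t0"
          using mstarD(6)[OF S', of k "\<pi> i" t t0] False k \<pi>[OF i] t t0 by auto
        ultimately have "t = 0" using k \<pi>[OF i] t t0 by auto
        then show ?thesis using mstarD(4)[OF S] mstarD(4)[OF S'] i \<pi>[OF i] by auto
      qed (use k in simp)
    qed
    have "inj_on \<pi> {..<n}"
    proof (rule inj_onI)
      fix i j assume ij: "i \<in> {..<n}" "j \<in> {..<n}" "\<pi> i = \<pi> j"
      then have "\<gamma> i t0 = \<gamma> j t0" using \<pi> by auto
      then have "d (\<gamma> i t0) (\<gamma> j t0) = 0" using mstarD(5)[OF S, of j t0] ij t0 d_pos by auto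
      then show "i = j" using mstarD(6)[OF S, of i j t0 t0] ij t0 by (auto split: if_splits)
    qed
    then show ?thesis using \<pi> eq by (intro exI[of _ \<pi>]) auto
  qed
  obtain \<pi> where \<pi>: "inj_on \<pi> {..<n}" "\<pi> ` {..<n} \<subseteq> {..<n'}"
      "\<forall>i<n. \<forall>t. 0 \<le> t \<longrightarrow> t < min r r' \<longrightarrow> \<gamma> i t = \<gamma>' (\<pi> i) t"
    using *[OF S S'] by blast
  obtain \<pi>' where \<pi>': "inj_on \<pi>' {..<n'}" "\<pi>' ` {..<n'} \<subseteq> {..<n}"
    using *[OF S' S] by blast
  \<comment> \<open>Injections in both directions make the two valences equal, so
    \<open>\<pi>\<close> is onto.\<close>
  have "n' \<le> n" using card_inj_on_le[OF \<pi>'] by simp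
  then have "\<pi> ` {..<n} = {..<n'}"
    using \<pi> card_image[OF \<pi>(1)] card_inj_on_le[OF \<pi>(1,2)] by (intro card_subset_eq) auto
  then show ?thesis using that[of \<pi>] \<pi> by (auto simp: bij_betw_def)
qed

lemma star_chart_valence:
  assumes "star_chart d I x n r \<gamma>"
  shows "valence d I x = n"
proof -
  obtain r1 where m: "mstar x n r1 \<gamma>" by (rule star_chart_imp_mstar[OF assms])
  have *: "n' = n" if sc: "star_chart d I x n' r' \<gamma>'" for n' r' \<gamma>'
  proof -
    obtain r2 where m': "mstar x n' r2 \<gamma>'" by (rule star_chart_imp_mstar[OF sc])
    obtain \<pi> where \<pi>: "bij_betw \<pi> {..<n} {..<n'}"
        "\<forall>i<n. \<forall>t. 0 \<le> t \<longrightarrow> t < min r1 r2 \<longrightarrow> \<gamma> i t = \<gamma>' (\<pi> i) t"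
      by (rule mstar_compare[OF m m'])
    show ?thesis using \<pi>(1) bij_betw_same_card[of \<pi> "{..<n}" "{..<n'}"] by simp
  qed
  have "(THE n. \<exists>r \<gamma>. star_chart d I x n r \<gamma>) = n"
  proof (rule the_equality)
    show "\<exists>r \<gamma>. star_chart d I x n r \<gamma>" using assms by (intro exI)
    show "n' = n" if "\<exists>r \<gamma>. star_chart d I x n' r \<gamma>" for n'
      using that by (elim exE) (rule *)
  qed
  then show ?thesis using mstarD(3)[OF m] by (simp add: valence_def)
qed

text \<open>A two-armed star unfolded to a signed parameter: the local picture at a point of valence
  2. Its orientation is arbitrary, hence the sign in \<open>mline_compare\<close>.\<close>

definition mline :: "'a \<Rightarrow> real \<Rightarrow> (real \<Rightarrow> 'a) \<Rightarrow> bool" where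
  "mline x \<rho> l \<longleftrightarrow> 0 < \<rho> \<and> l 0 = x \<and> (\<forall>s. \<bar>s\<bar> < \<rho> \<longrightarrow> l s \<notin> I) \<and>
     (\<forall>s s'. \<bar>s\<bar> < \<rho> \<longrightarrow> \<bar>s'\<bar> < \<rho> \<longrightarrow> d (l s) (l s') = \<bar>s - s'\<bar>) \<and>
     (\<forall>y. y \<notin> I \<longrightarrow> d x y < \<rho> \<longrightarrow> (\<exists>s. \<bar>s\<bar> < \<rho> \<and> y = l s))"

lemma mlineD:
  assumes "mline x \<rho> l"
  shows "0 < \<rho>" "l 0 = x" "\<bar>s\<bar> < \<rho> \<Longrightarrow> l s \<notin> I" "\<bar>s\<bar> < \<rho> \<Longrightarrow> \<bar>s'\<bar> < \<rho> \<Longrightarrow> d (l s) (l s') = \<bar>s - s'\<bar>"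
    "y \<notin> I \<Longrightarrow> d x y < \<rho> \<Longrightarrow> \<exists>s. \<bar>s\<bar> < \<rho> \<and> y = l s"
  using assms by (simp_all add: mline_def)

lemma mline_center: "mline x \<rho> l \<Longrightarrow> x \<notin> I"
  using mlineD(1,2)[of x \<rho> l] mlineD(3)[of x \<rho> l 0] by auto

lemma mline_dist0: "mline x \<rho> l \<Longrightarrow> \<bar>s\<bar> < \<rho> \<Longrightarrow> d x (l s) = \<bar>s\<bar>"
  using mlineD(4)[of x \<rho> l 0 s] mlineD(1,2)[of x \<rho> l] by auto

lemma mline_mono:
  assumes "mline x \<rho> l" "0 < \<rho>'" "\<rho>' \<le> \<rho>"
  shows "mline x \<rho>' l"
  unfolding mline_def
proof (intro conjI allI impI)
  fix y assume y: "y \<notin> I" "d x y < \<rho>'"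
  then obtain s where "\<bar>s\<bar> < \<rho>" "y = l s" using mlineD(5)[OF assms(1)] assms(3) by fastforce
  then show "\<exists>s. \<bar>s\<bar> < \<rho>' \<and> y = l s" using mline_dist0[OF assms(1), of s] y by auto
qed (use mlineD[OF assms(1)] assms in auto)

lemma mline_of_mstar:
  assumes "mstar x 2 r \<gamma>"
  shows "mline x r (\<lambda>s. if 0 \<le> s then \<gamma> 0 s else \<gamma> 1 (- s))"
  unfolding mline_def
proof (intro conjI allI impI)
  fix y assume "y \<notin> I" "d x y < r"
  then obtain i t where it: "i < 2" "0 \<le> t" "t < r" "y = \<gamma> i t" using mstarD(7)[OF assms] by blast
  then have "i = 0 \<or> i = 1" by auto
  then show "\<exists>s. \<bar>s\<bar> < r \<and> y = (if 0 \<le> s then \<gamma> 0 s else \<gamma> 1 (- s))"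
  proof
    assume "i = 0" then show ?thesis using it by (intro exI[of _ t]) auto
  next
    assume "i = 1" then show ?thesis using it mstarD(4)[OF assms]
      by (intro exI[of _ "-t"]) auto
  qed
qed (use mstarD[OF assms] in \<open>auto simp: less_2_cases_iff\<close>)

lemma mstar_of_mline:
  assumes "mline x \<rho> l"
  shows "mstar x 2 \<rho> (\<lambda>i s. if i = 0 then l s else l (- s))"
  unfolding mstar_def
proof (intro conjI allI impI)
  fix y assume "y \<notin> I" "d x y < \<rho>"
  then obtain s where s: "\<bar>s\<bar> < \<rho>" "y = l s" using mlineD(5)[OF assms] by blast
  show "\<exists>i<2::nat. \<exists>t\<ge>0. t < \<rho> \<and> y = (if i = 0 then l t else l (- t))"
  proof (cases "0 \<le> s")
    case True then show ?thesis using s by (intro exI[of _ 0]) auto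
  next
    case False then show ?thesis using s by (intro exI[of _ 1] conjI exI[of _ "-s"]) auto
  qed
next
  fix i j :: nat and s t assume "i < 2" "j < 2" "0 \<le> s" "s < \<rho>" "0 \<le> t" "t < \<rho>"
  then show "d (if i = 0 then l s else l (- s)) (if j = 0 then l t else l (- t)) =
    (if i = j then \<bar>s - t\<bar> else s + t)"
    using mlineD(4)[OF assms] by (auto simp: less_2_cases_iff)
qed (use mlineD[OF assms] in auto)

text \<open>Distance to \<open>x\<close> fixes the parameter of each point up to sign. A change of
  sign between \<open>s\<close> and \<open>s0\<close> would turn the distance
  \<open>|s - s0|\<close> into \<open>|s + s0|\<close>.\<close>

lemma mline_compare:
  assumes L: "mline x \<rho> l" and L': "mline x \<rho>' l'"
  obtains \<kappa> :: real where "\<kappa> = 1 \<or> \<kappa> = -1" "\<forall>s. \<bar>s\<bar> < min \<rho> \<rho>' \<longrightarrow> l' s = l (\<kappa> * s)"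
proof -
  have ex: "l' s = l s \<or> l' s = l (- s)" if s: "\<bar>s\<bar> < min \<rho> \<rho>'" for s
  proof -
    have ds: "d x (l' s) = \<bar>s\<bar>" using mline_dist0[OF L'] s by auto
    then obtain u where u: "\<bar>u\<bar> < \<rho>" "l' s = l u"
      using mlineD(5)[OF L, of "l' s"] mlineD(3)[OF L', of s] s ds by (metis min_less_iff_conj)
    then have "\<bar>u\<bar> = \<bar>s\<bar>" using mline_dist0[OF L] ds by auto
    then show ?thesis using u by (auto simp: abs_if split: if_splits)
  qed
  define s0 where "s0 = min \<rho> \<rho>' / 2"
  have s0: "0 < s0" "s0 < min \<rho> \<rho>'" using mlineD(1)[OF L] mlineD(1)[OF L'] by (auto simp: s0_def)
  obtain \<kappa> :: real where \<kappa>: "\<kappa> = 1 \<or> \<kappa> = -1" "l' s0 = l (\<kappa> * s0)" using ex[of s0] s0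
    by (metis abs_of_pos mult_1 mult_minus1)
  have "l' s = l (\<kappa> * s)" if s: "\<bar>s\<bar> < min \<rho> \<rho>'" for s
  proof (rule ccontr)
    assume ne: "l' s \<noteq> l (\<kappa> * s)"
    then have "l' s = l (- \<kappa> * s)" using ex[OF s] \<kappa> by auto
    then have "d (l' s) (l' s0) = \<bar>- \<kappa> * s - \<kappa> * s0\<bar>"
      using mlineD(4)[OF L, of "-\<kappa> * s" "\<kappa> * s0"] s s0 \<kappa> by auto
    moreover have "d (l' s) (l' s0) = \<bar>s - s0\<bar>" using mlineD(4)[OF L', of s s0] s s0 by auto
    ultimately have "s = 0" using \<kappa> s0 by (auto simp: abs_if split: if_splits)
    then show False using ne mlineD(2)[OF L] mlineD(2)[OF L'] by auto
  qed
  then show ?thesis using that \<kappa> by blast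
qed

section \<open>Local geodesics\<close>

text \<open>Points of \<open>N\<close> cannot accumulate, so compactness leaves finitely many. It is
  applied to branch points and to break points.\<close>

lemma compact_finite_by_local:
  assumes "\<And>y::'a. \<exists>U. open U \<and> y \<in> U \<and> finite (U \<inter> N)"
  shows "finite N"
proof -
  obtain U where U: "\<And>y::'a. open (U y) \<and> y \<in> U y \<and> finite (U y \<inter> N)" using assms by metis
  have "UNIV \<subseteq> (\<Union>y. U y)" using U by auto
  then obtain C where "finite C" "UNIV \<subseteq> (\<Union>y\<in>C. U y)"
    using compactE_image[OF compact_UNIV, of UNIV U] U by (metis UNIV_I)
  then have "N = (\<Union>y\<in>C. U y \<inter> N)" by auto
  then show ?thesis using \<open>finite C\<close> U by (metis finite_UN)
qed

lemma iso_continuous: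
  assumes "\<And>s. s \<in> S \<Longrightarrow> \<sigma> s \<notin> I"
    and "\<And>t. t \<in> S \<Longrightarrow> \<exists>e>0. \<forall>s\<in>S. \<bar>s - t\<bar> < e \<longrightarrow> d (\<sigma> t) (\<sigma> s) \<le> \<bar>s - t\<bar>"
  shows "continuous_on S (\<sigma> :: real \<Rightarrow> 'a)"
  unfolding continuous_on_def
proof (intro ballI topological_tendstoI)
  fix t U assume t: "t \<in> S" and U: "open U" "\<sigma> t \<in> U"
  obtain r where r: "0 < r" "\<forall>y. y \<notin> I \<longrightarrow> d (\<sigma> t) y < r \<longrightarrow> y \<in> U"
    using ball_in_open[OF U] assms(1)[OF t] by blast
  obtain e where e: "e > 0" "\<forall>s\<in>S. \<bar>s - t\<bar> < e \<longrightarrow> d (\<sigma> t) (\<sigma> s) \<le> \<bar>s - t\<bar>"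
    using assms(2)[OF t] by blast
  show "\<forall>\<^sub>F s in at t within S. \<sigma> s \<in> U"
    unfolding eventually_at
  proof (intro exI[of _ "min r e"] conjI ballI impI)
    fix s assume "s \<in> S" "s \<noteq> t \<and> dist s t < min r e"
    then show "\<sigma> s \<in> U" using r e assms(1)[of s] by (fastforce simp: dist_real_def)
  qed (use r e in auto)
qed

lemma mline_cong:
  assumes "mline x \<rho> l" "\<And>s. \<bar>s\<bar> < \<rho> \<Longrightarrow> l' s = l s"
  shows "mline x \<rho> l'"
  using assms mlineD(1)[OF assms(1)] unfolding mline_def by (metis abs_zero)

lemma mline_reflect: "mline x \<rho> l \<Longrightarrow> mline x \<rho> (\<lambda>s. l (- s))"
  unfolding mline_def
proof (elim conjE, intro conjI allI impI)
  fix y assume "\<forall>y. y \<notin> I \<longrightarrow> d x y < \<rho> \<longrightarrow> (\<exists>s. \<bar>s\<bar> < \<rho> \<and> y = l s)" "y \<notin> I" "d x y < \<rho>"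
  then obtain s where "\<bar>s\<bar> < \<rho> \<and> y = l s" by blast
  then show "\<exists>s. \<bar>s\<bar> < \<rho> \<and> y = l (- s)" by (intro exI[of _ "-s"]) auto
qed auto

lemma mline_shift:
  assumes "mline x \<rho> l" "\<bar>s\<bar> < \<rho>"
  shows "mline (l s) (\<rho> - \<bar>s\<bar>) (\<lambda>u. l (s + u))"
  unfolding mline_def
proof (intro conjI allI impI)
  fix y assume y: "y \<notin> I" "d (l s) y < \<rho> - \<bar>s\<bar>"
  have "d x y \<le> d x (l s) + d (l s) y"
    using d_tri mline_center[OF assms(1)] mlineD(3)[OF assms] y by blast
  then have "d x y < \<rho>" using mline_dist0[OF assms] y by auto
  then obtain v where v: "\<bar>v\<bar> < \<rho>" "y = l v" using mlineD(5)[OF assms(1)] y by blast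
  then show "\<exists>u. \<bar>u\<bar> < \<rho> - \<bar>s\<bar> \<and> y = l (s + u)"
    using y mlineD(4)[OF assms(1,2) v(1)] by (intro exI[of _ "v - s"]) auto
next
  fix u u' assume "\<bar>u\<bar> < \<rho> - \<bar>s\<bar>" "\<bar>u'\<bar> < \<rho> - \<bar>s\<bar>"
  then show "d (l (s + u)) (l (s + u')) = \<bar>u - u'\<bar>"
    using mlineD(4)[OF assms(1), of "s + u" "s + u'"] by auto
qed (use mlineD[OF assms(1)] assms(2) in auto)

text \<open>Arc length is required only locally, since a path along a loop or a long edge need not
  realize the distance of its end points. Each local line also fills a ball of the curve, so a
  geodesic avoids branch points and has open image.\<close>

definition geo :: "real set \<Rightarrow> (real \<Rightarrow> 'a) \<Rightarrow> bool" where
  "geo J \<sigma> \<longleftrightarrow> (\<forall>t\<in>J. \<exists>e>0. {t-e<..<t+e} \<subseteq> J \<and> mline (\<sigma> t) e (\<lambda>s. \<sigma> (t + s)))"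

lemma geoE:
  assumes "geo J \<sigma>" "t \<in> J"
  obtains e where "0 < e" "{t-e<..<t+e} \<subseteq> J" "mline (\<sigma> t) e (\<lambda>s. \<sigma> (t + s))"
  using assms unfolding geo_def by blast

lemma geo_notin_I: "geo J \<sigma> \<Longrightarrow> t \<in> J \<Longrightarrow> \<sigma> t \<notin> I"
  unfolding geo_def using mline_center by blast

lemma geo_open: "geo J \<sigma> \<Longrightarrow> open J"
proof (subst open_dist, intro ballI)
  fix t assume "geo J \<sigma>" "t \<in> J"
  then obtain e where "0 < e" "{t-e<..<t+e} \<subseteq> J" by (rule geoE)
  then show "\<exists>e>0. \<forall>y. dist y t < e \<longrightarrow> y \<in> J"
    by (intro exI[of _ e]) (auto simp: dist_real_def abs_less_iff subset_iff)
qed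

lemma geo_local:
  assumes "open K" "\<And>t. t \<in> K \<Longrightarrow> \<exists>J \<sigma>'. t \<in> J \<and> geo J \<sigma>' \<and> (\<forall>\<^sub>F s in nhds t. \<sigma> s = \<sigma>' s)"
  shows "geo K \<sigma>"
  unfolding geo_def
proof
  fix t assume t: "t \<in> K"
  obtain J \<sigma>' where J: "t \<in> J" "geo J \<sigma>'" "\<forall>\<^sub>F s in nhds t. \<sigma> s = \<sigma>' s" using assms(2)[OF t] by blast
  obtain e1 where e1: "0 < e1" "mline (\<sigma>' t) e1 (\<lambda>s. \<sigma>' (t + s))" using geoE[OF J(2,1)] by blast
  obtain e2 where e2: "0 < e2" "\<forall>s. \<bar>s - t\<bar> < e2 \<longrightarrow> \<sigma> s = \<sigma>' s"
    using J(3) unfolding eventually_nhds_metric by (auto simp: dist_real_def)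
  obtain e3 where e3: "0 < e3" "\<forall>s. \<bar>s - t\<bar> < e3 \<longrightarrow> s \<in> K"
    using assms(1) t unfolding open_dist by (auto simp: dist_real_def)
  define e where "e = min e1 (min e2 e3)"
  have e: "0 < e" "e \<le> e1" "e \<le> e2" "e \<le> e3" using e1 e2 e3 by (auto simp: e_def)
  have "mline (\<sigma>' t) e (\<lambda>s. \<sigma> (t + s))"
    using mline_cong[OF mline_mono[OF e1(2) e(1,2)], of "\<lambda>s. \<sigma> (t + s)"] e2 e by auto
  moreover have "\<sigma> t = \<sigma>' t" using e2 by auto
  moreover have "{t-e<..<t+e} \<subseteq> K" using e3 e by (auto simp: abs_less_iff)
  ultimately show "\<exists>e>0. {t-e<..<t+e} \<subseteq> K \<and> mline (\<sigma> t) e (\<lambda>s. \<sigma> (t + s))" using e by auto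
qed

lemma geo_subset: "geo J \<sigma> \<Longrightarrow> open K \<Longrightarrow> K \<subseteq> J \<Longrightarrow> geo K \<sigma>"
proof (rule geo_local)
  fix t assume "geo J \<sigma>" "K \<subseteq> J" "t \<in> K"
  then show "\<exists>J \<sigma>'. t \<in> J \<and> geo J \<sigma>' \<and> (\<forall>\<^sub>F s in nhds t. \<sigma> s = \<sigma>' s)"
    by (intro exI[of _ J] exI[of _ \<sigma>]) auto
qed

lemma geo_affine:
  assumes "geo J \<sigma>" "\<kappa> = 1 \<or> \<kappa> = -1"
  shows "geo {s. c + \<kappa> * s \<in> J} (\<lambda>s. \<sigma> (c + \<kappa> * s))"
  unfolding geo_def
proof
  fix t assume "t \<in> {s. c + \<kappa> * s \<in> J}"
  then obtain e where e: "0 < e" "{c + \<kappa>*t - e<..<c + \<kappa>*t + e} \<subseteq> J"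
      "mline (\<sigma> (c + \<kappa> * t)) e (\<lambda>s. \<sigma> (c + \<kappa> * t + s))"
    using geoE[OF assms(1)] by blast
  have "mline (\<sigma> (c + \<kappa> * t)) e (\<lambda>s. \<sigma> (c + \<kappa> * (t + s)))"
    using assms(2) e(3) mline_reflect[OF e(3)] by (auto simp: algebra_simps)
  moreover have "{t-e<..<t+e} \<subseteq> {s. c + \<kappa> * s \<in> J}" using e(2) assms(2) by (auto simp: subset_iff)
  ultimately show "\<exists>e>0. {t-e<..<t+e} \<subseteq> {s. c + \<kappa> * s \<in> J} \<and>
       mline (\<sigma> (c + \<kappa> * t)) e (\<lambda>s. \<sigma> (c + \<kappa> * (t + s)))" using e by blast
qed

lemma mline_geo: "mline x \<rho> l \<Longrightarrow> geo {-\<rho><..<\<rho>} l"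
  unfolding geo_def
proof
  fix t assume m: "mline x \<rho> l" and t: "t \<in> {-\<rho><..<\<rho>}"
  then show "\<exists>e>0. {t-e<..<t+e} \<subseteq> {-\<rho><..<\<rho>} \<and> mline (l t) e (\<lambda>s. l (t + s))"
    using mline_shift[OF m, of t] by (intro exI[of _ "\<rho> - \<bar>t\<bar>"]) auto
qed

lemma mstar_geo:
  assumes "mstar x n r \<gamma>" "i < n"
  shows "geo {0<..<r} (\<gamma> i)"
  unfolding geo_def
proof
  fix t assume t: "t \<in> {0<..<r}"
  define e where "e = min t (r - t)"
  have e: "0 < e" "e \<le> t" "e \<le> r - t" using t by (auto simp: e_def)
  have "mline (\<gamma> i t) e (\<lambda>s. \<gamma> i (t + s))"
    unfolding mline_def
  proof (intro conjI allI impI)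
    fix y assume y: "y \<notin> I" "d (\<gamma> i t) y < e"
    have git: "\<gamma> i t \<notin> I" using mstarD(5)[OF assms] t by auto
    have "d x y \<le> d x (\<gamma> i t) + d (\<gamma> i t) y"
      using d_tri mstarD(3)[OF assms(1)] git y by blast
    then have "d x y < r" using mstar_dist0[OF assms, of t] t e y by auto
    then obtain j s where j: "j < n" "0 \<le> s" "s < r" "y = \<gamma> j s"
      using mstarD(7)[OF assms(1)] y by blast
    then have "j = i" "\<bar>s - t\<bar> < e"
      using mstarD(6)[OF assms(1,2) j(1), of t s] y t e by (auto split: if_splits)
    then show "\<exists>s. \<bar>s\<bar> < e \<and> y = \<gamma> i (t + s)" using j by (intro exI[of _ "s - t"]) auto
  next
    fix s s' assume "\<bar>s\<bar> < e" "\<bar>s'\<bar> < e"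
    then show "d (\<gamma> i (t + s)) (\<gamma> i (t + s')) = \<bar>s - s'\<bar>"
      using mstarD(6)[OF assms(1,2,2), of "t + s" "t + s'"] e by auto
  next
    fix s assume "\<bar>s\<bar> < e" then show "\<gamma> i (t + s) \<notin> I" using mstarD(5)[OF assms, of "t + s"] e by auto
  qed (use e in auto)
  then show "\<exists>e>0. {t-e<..<t+e} \<subseteq> {0<..<r} \<and> mline (\<gamma> i t) e (\<lambda>s. \<gamma> i (t + s))"
    using e by (intro exI[of _ e]) auto
qed

lemma geo_continuous: "geo J \<sigma> \<Longrightarrow> continuous_on J \<sigma>"
proof (rule iso_continuous)
  fix t assume "geo J \<sigma>" "t \<in> J"
  then obtain e where e: "0 < e" "{t-e<..<t+e} \<subseteq> J" "mline (\<sigma> t) e (\<lambda>s. \<sigma> (t + s))" by (rule geoE)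
  then show "\<exists>e>0. \<forall>s\<in>J. \<bar>s - t\<bar> < e \<longrightarrow> d (\<sigma> t) (\<sigma> s) \<le> \<bar>s - t\<bar>"
    using mline_dist0[OF e(3), of "s - t" for s] e(1) by (intro exI[of _ e]) auto
qed (rule geo_notin_I)

lemma geo_open_image:
  assumes "geo J \<sigma>" shows "open (\<sigma> ` J)"
proof (subst open_iff)
  show "\<forall>x\<in>\<sigma> ` J. \<exists>r>0. \<forall>y. y \<notin> I \<longrightarrow> d x y < r \<longrightarrow> y \<in> \<sigma> ` J"
  proof
    fix x assume "x \<in> \<sigma> ` J"
    then obtain t where t: "t \<in> J" "x = \<sigma> t" by auto
    obtain e where e: "0 < e" "{t-e<..<t+e} \<subseteq> J" "mline (\<sigma> t) e (\<lambda>s. \<sigma> (t + s))"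
      using geoE[OF assms t(1)] by blast
    show "\<exists>r>0. \<forall>y. y \<notin> I \<longrightarrow> d x y < r \<longrightarrow> y \<in> \<sigma> ` J"
    proof (intro exI[of _ e] conjI allI impI)
      fix y assume "y \<notin> I" "d x y < e"
      then obtain s where s: "\<bar>s\<bar> < e" "y = \<sigma> (t + s)" using mlineD(5)[OF e(3)] t by blast
      then have "t + s \<in> J" using e(2) by (auto simp: subset_iff abs_less_iff)
      then show "y \<in> \<sigma> ` J" using s by auto
    qed (rule e(1))
  qed
qed (use geo_notin_I[OF assms] in auto)

text \<open>Agreement near a parameter is a locally constant property. Where it fails, the two
  geodesics either pass through different points or run through the same point in opposite
  directions, and in both cases they differ at all other nearby parameters.\<close>

lemma geo_unique:
  assumes G: "geo J \<sigma>" and G': "geo J \<sigma>'" and "connected J" "t0 \<in> J" "\<forall>\<^sub>F s in nhds t0. \<sigma> s = \<sigma>' s"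
    and "t \<in> J"
  shows "\<sigma> t = \<sigma>' t"
proof -
  define P where "P t \<longleftrightarrow> (\<forall>\<^sub>F s in nhds t. \<sigma> s = \<sigma>' s)" for t
  have "P t0 = P t"
  proof (rule connected_local_const[OF assms(3,4,6)], rule ballI)
    fix t assume t: "t \<in> J"
    have "\<forall>\<^sub>F s in nhds t. s \<noteq> t \<longrightarrow> P t = P s"
    proof (cases "P t")
      case True
      then have "\<forall>\<^sub>F s in nhds t. P s" unfolding P_def by (subst eventually_eventually)
      then show ?thesis by (rule eventually_mono) (use True in auto)
    next
      case False
      obtain e where e: "0 < e" "mline (\<sigma> t) e (\<lambda>s. \<sigma> (t + s))" using geoE[OF G t] by blast
      obtain e' where e': "0 < e'" "mline (\<sigma>' t) e' (\<lambda>s. \<sigma>' (t + s))" using geoE[OF G' t] by blast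
      have "\<exists>\<delta>>0. \<forall>s. \<bar>s\<bar> < \<delta> \<longrightarrow> s \<noteq> 0 \<longrightarrow> \<sigma> (t + s) \<noteq> \<sigma>' (t + s)"
      proof (cases "\<sigma> t = \<sigma>' t")
        case True
        obtain \<kappa> :: real where \<kappa>: "\<kappa> = 1 \<or> \<kappa> = -1"
            "\<forall>s. \<bar>s\<bar> < min e e' \<longrightarrow> \<sigma>' (t + s) = \<sigma> (t + \<kappa> * s)"
          using e'(2) by (rule_tac mline_compare[OF e(2), of e' "\<lambda>s. \<sigma>' (t + s)"]) (simp_all add: True)
        have "\<kappa> \<noteq> 1"
        proof
          assume "\<kappa> = 1"
          then have "P t" unfolding P_def eventually_nhds_metric using \<kappa>(2) e(1) e'(1)
            by (intro exI[of _ "min e e'"])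
              (auto simp: dist_real_def dest: spec[of _ "s - t" for s])
          then show False using False by simp
        qed
        then have k: "\<kappa> = -1" using \<kappa> by auto
        show ?thesis
        proof (intro exI[of _ "min e e'"] conjI allI impI)
          fix s assume s: "\<bar>s\<bar> < min e e'" "s \<noteq> 0"
          have "d (\<sigma> (t + s)) (\<sigma> (t - s)) = \<bar>2 * s\<bar>" using mlineD(4)[OF e(2), of s "-s"] s by auto
          moreover have "\<sigma>' (t + s) = \<sigma> (t - s)" using \<kappa>(2) s k by auto
          moreover have "\<sigma> (t + s) \<notin> I" using mlineD(3)[OF e(2), of s] s by auto
          ultimately show "\<sigma> (t + s) \<noteq> \<sigma>' (t + s)" using d_self s by fastforce
        qed (use e e' in auto)
      next
        case False
        have nI: "\<sigma> t \<notin> I" "\<sigma>' t \<notin> I" using geo_notin_I G G' t by auto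
        define \<eta> where "\<eta> = d (\<sigma> t) (\<sigma>' t)"
        have \<eta>: "0 < \<eta>" using d_pos[OF nI] False d_nonneg[of "\<sigma> t" "\<sigma>' t"] by (auto simp: \<eta>_def less_le)
        show ?thesis
        proof (intro exI[of _ "min (\<eta>/2) (min e e')"] conjI allI impI)
          fix s assume s: "\<bar>s\<bar> < min (\<eta>/2) (min e e')" "s \<noteq> 0"
          show "\<sigma> (t + s) \<noteq> \<sigma>' (t + s)"
          proof
            assume eq: "\<sigma> (t + s) = \<sigma>' (t + s)"
            have "d (\<sigma> t) (\<sigma>' t) \<le> d (\<sigma> t) (\<sigma> (t + s)) + d (\<sigma> (t + s)) (\<sigma>' t)"
              using d_tri nI mlineD(3)[OF e(2), of s] s by auto
            also have "d (\<sigma> (t + s)) (\<sigma>' t) = d (\<sigma>' t) (\<sigma>' (t + s))" by (simp add: eq d_commute)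
            finally show False
              using mline_dist0[OF e(2), of s] mline_dist0[OF e'(2), of s] s \<eta>_def by auto
          qed
        qed (use e e' \<eta> in auto)
      qed
      then obtain \<delta> where \<delta>: "0 < \<delta>" "\<forall>s. \<bar>s\<bar> < \<delta> \<longrightarrow> s \<noteq> 0 \<longrightarrow> \<sigma> (t + s) \<noteq> \<sigma>' (t + s)" by blast
      have "\<not> P s" if "dist s t < \<delta>" for s
      proof
        assume P: "P s"
        show False
        proof (cases "s = t")
          case False
          have "\<sigma> s = \<sigma>' s" using P unfolding P_def by (rule eventually_nhds_x_imp_x)
          then show False using \<delta>(2)[rule_format, of "s - t"] that False by (auto simp: dist_real_def)
        qed (use P \<open>\<not> P t\<close> in simp)
      qed
      then show ?thesis using \<delta>(1) False unfolding eventually_nhds_metric by blast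
    qed
    then show "\<forall>\<^sub>F s in at t within J. P t = P s"
      unfolding eventually_at_filter by (rule eventually_mono) auto
  qed
  then have "P t" using assms(5) by (simp add: P_def)
  then show ?thesis unfolding P_def by (rule eventually_nhds_x_imp_x)
qed

text \<open>\<open>mline_compare\<close> at the common point fixes the relative orientation
  \<open>\<kappa>\<close>, and unique continuation carries the agreement over the interval of shifts
  on which both geodesics are defined.\<close>

lemma geo_meet:
  assumes G: "geo J \<sigma>" and G': "geo J' \<sigma>'" and J: "is_interval J" "is_interval J'"
    and t: "t \<in> J" "t' \<in> J'" "\<sigma> t = \<sigma>' t'"
  obtains \<kappa> :: real where "\<kappa> = 1 \<or> \<kappa> = -1"
    "\<forall>s. t + s \<in> J \<longrightarrow> t' + \<kappa> * s \<in> J' \<longrightarrow> \<sigma> (t + s) = \<sigma>' (t' + \<kappa> * s)"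
proof -
  obtain e where e: "0 < e" "{t-e<..<t+e} \<subseteq> J" "mline (\<sigma> t) e (\<lambda>s. \<sigma> (t + s))"
    using geoE[OF G t(1)] by blast
  obtain e' where e': "0 < e'" "{t'-e'<..<t'+e'} \<subseteq> J'" "mline (\<sigma>' t') e' (\<lambda>s. \<sigma>' (t' + s))"
    using geoE[OF G' t(2)] by blast
  obtain \<kappa> :: real where \<kappa>: "\<kappa> = 1 \<or> \<kappa> = -1" "\<forall>s. \<bar>s\<bar> < min e' e \<longrightarrow> \<sigma> (t + s) = \<sigma>' (t' + \<kappa> * s)"
    using e(3) by (rule_tac mline_compare[OF e'(3), of e "\<lambda>s. \<sigma> (t + s)"]) (simp_all add: t)
  define K where "K = {s. t + s \<in> J} \<inter> {s. t' + \<kappa> * s \<in> J'}"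
  have "open {s. t + s \<in> J}" using geo_open[OF geo_affine[OF G, of 1 t]] by simp
  moreover have o2: "open {s. t' + \<kappa> * s \<in> J'}" using geo_open[OF geo_affine[OF G' \<kappa>(1), of t']] by simp
  ultimately have oK: "open K" by (auto simp: K_def)
  have "geo {s. t + s \<in> J} (\<lambda>s. \<sigma> (t + s))" using geo_affine[OF G, of 1 t] by simp
  then have G1: "geo K (\<lambda>s. \<sigma> (t + s))" using oK by (rule geo_subset) (auto simp: K_def)
  have "geo {s. t' + \<kappa> * s \<in> J'} (\<lambda>s. \<sigma>' (t' + \<kappa> * s))" using geo_affine[OF G' \<kappa>(1), of t'] by simp
  then have G2: "geo K (\<lambda>s. \<sigma>' (t' + \<kappa> * s))" using oK by (rule geo_subset) (auto simp: K_def)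
  have "is_interval K"
    unfolding is_interval_1
  proof (intro ballI allI impI)
    fix a b x assume ab: "a \<in> K" "b \<in> K" "a \<le> x \<and> x \<le> b"
    have "t + x \<in> J" using J(1) ab unfolding is_interval_1 K_def by (auto 4 4 dest: bspec)
    moreover have "t' + \<kappa> * x \<in> J'"
      using \<kappa>(1)
    proof
      assume "\<kappa> = 1" then show ?thesis using J(2) ab unfolding is_interval_1 K_def by (auto 4 4 dest: bspec)
    next
      assume k: "\<kappa> = -1"
      then have "t' - b \<in> J'" "t' - a \<in> J'" using ab by (auto simp: K_def)
      then have "t' - x \<in> J'" using J(2) ab(3) unfolding is_interval_1
        by (metis diff_left_mono)
      then show ?thesis using k by simp
    qed
    ultimately show "x \<in> K" by (simp add: K_def)
  qed
  then have cK: "connected K" by (simp add: is_interval_connected)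
  have K0: "0 \<in> K" using t by (simp add: K_def)
  have ev: "\<forall>\<^sub>F s in nhds 0. \<sigma> (t + s) = \<sigma>' (t' + \<kappa> * s)"
    unfolding eventually_nhds_metric using \<kappa>(2) e e' by (intro exI[of _ "min e' e"]) auto
  show ?thesis
  proof (rule that[OF \<kappa>(1)], intro allI impI)
    fix s assume "t + s \<in> J" "t' + \<kappa> * s \<in> J'"
    then have "s \<in> K" by (simp add: K_def)
    then show "\<sigma> (t + s) = \<sigma>' (t' + \<kappa> * s)" using geo_unique[OF G1 G2 cK K0 ev] by simp
  qed
qed

section \<open>Standard charts\<close>

text \<open>One chart per finite point is chosen once and for all, so that arms can be named by
  numbers. Other charts are reduced to it by \<open>mstar_compare\<close>.\<close>

definition star_data :: "'a \<Rightarrow> nat \<times> real \<times> (nat \<Rightarrow> real \<Rightarrow> 'a)" where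
  "star_data x = (SOME (n, r, \<gamma>). mstar x n r \<gamma>)"

definition val :: "'a \<Rightarrow> nat" where "val x = fst (star_data x)"

definition rad :: "'a \<Rightarrow> real" where "rad x = fst (snd (star_data x))"

definition arm :: "'a \<Rightarrow> nat \<Rightarrow> real \<Rightarrow> 'a" where "arm x = snd (snd (star_data x))"

lemma star: assumes "x \<notin> I" shows "mstar x (val x) (rad x) (arm x)"
proof -
  obtain n r \<gamma> where sc: "star_chart d I x n r \<gamma>"
    using curve assms unfolding tropical_curve_def by blast
  obtain r' where "mstar x n r' \<gamma>" by (rule star_chart_imp_mstar[OF sc])
  then have "case (n, r', \<gamma>) of (n, r, \<gamma>) \<Rightarrow> mstar x n r \<gamma>" by simp
  then have "case star_data x of (n, r, \<gamma>) \<Rightarrow> mstar x n r \<gamma>"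
    unfolding star_data_def by (rule someI)
  then show ?thesis by (simp add: val_def rad_def arm_def split_beta)
qed

lemma rad_pos: "x \<notin> I \<Longrightarrow> 0 < rad x"
  using mstarD(2)[OF star] .

lemma valence_val: "valence d I x = (if x \<in> I then 1 else val x)"
  using star_chart_valence[OF mstar_imp_star_chart[OF star]] by (auto simp: valence_def)

lemma mline_val: assumes "mline x \<rho> l" shows "x \<notin> I" "val x = 2"
proof -
  show x: "x \<notin> I" using mline_center[OF assms] .
  show "val x = 2"
    using star_chart_valence[OF mstar_imp_star_chart[OF mstar_of_mline[OF assms]]] x by (simp add: valence_val)
qed

lemma val_mline:
  assumes "x \<notin> I" "val x = 2"
  shows "mline x (rad x) (\<lambda>s. if 0 \<le> s then arm x 0 s else arm x 1 (- s))"
  using mline_of_mstar[of x "rad x" "arm x"] star[OF assms(1)] assms(2) by simp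

lemma geo_val: "geo J \<sigma> \<Longrightarrow> t \<in> J \<Longrightarrow> val (\<sigma> t) = 2"
  using mline_val geoE by meson

text \<open>An arbitrary end chart may begin with a stretch that passes through a branch point. Here
  such a stretch is excluded, so that the ray is a geodesic and its final pieces are neighbourhoods
  of \<open>p\<close>.\<close>

definition tail_chart :: "'a \<Rightarrow> (real \<Rightarrow> 'a) \<Rightarrow> bool" where
  "tail_chart p \<phi> \<longleftrightarrow> geo {0<..} \<phi> \<and> end_chart d I p \<phi> \<and> (\<forall>T\<ge>0. open (insert p (\<phi> ` {T<..})))"

definition tail :: "'a \<Rightarrow> real \<Rightarrow> 'a" where "tail p = (SOME \<phi>. tail_chart p \<phi>)"

text \<open>Convergence to \<open>p\<close> brings the chart into the interior of its own image for
  good. Cutting off everything before that moment leaves a geodesic.\<close>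

lemma end_chart_tail_chart:
  assumes p: "p \<in> I" and "end_chart d I p \<phi>"
  shows "\<exists>T0\<ge>0. \<forall>T1\<ge>T0. tail_chart p (\<lambda>t. \<phi> (T1 + t))"
proof -
  have ec: "\<And>t. t \<ge> 0 \<Longrightarrow> \<phi> t \<notin> I" "\<And>s t. s \<ge> 0 \<Longrightarrow> t \<ge> 0 \<Longrightarrow> d (\<phi> s) (\<phi> t) = \<bar>s - t\<bar>"
    "(\<phi> \<longlongrightarrow> p) at_top" "p \<in> interior (insert p (\<phi> ` {0..}))"
    using assms(2) by (auto simp: end_chart_def)
  define W where "W = interior (insert p (\<phi> ` {0..}))"
  have W: "open W" "p \<in> W" "W \<subseteq> insert p (\<phi> ` {0..})"
    using ec(4) interior_subset by (auto simp: W_def)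
  have cont: "continuous_on {0..} \<phi>"
    by (rule iso_continuous) (auto simp: ec(1,2) intro!: exI[of _ 1])
  obtain T where T: "\<forall>t\<ge>T. \<phi> t \<in> W"
    using topological_tendstoD[OF ec(3) W(1,2)] by (auto simp: eventually_at_top_linorder)
  have main: "tail_chart p (\<lambda>t. \<phi> (T1 + t))" if T1: "T1 \<ge> max 0 T" for T1
  proof -
    define \<psi> where "\<psi> t = \<phi> (T1 + t)" for t
    have "geo {0<..} \<psi>"
      unfolding geo_def
    proof
      fix t :: real assume t: "t \<in> {0<..}"
      have nI: "\<psi> t \<notin> I" using ec(1) t T1 by (auto simp: \<psi>_def)
      have "\<psi> t \<in> W" using T t T1 by (auto simp: \<psi>_def)
      then obtain r where r: "0 < r" "\<forall>y. y \<notin> I \<longrightarrow> d (\<psi> t) y < r \<longrightarrow> y \<in> W"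
        using ball_in_open[OF W(1)] nI by blast
      define e where "e = min r t"
      have e: "0 < e" "e \<le> r" "e \<le> t" using r t by (auto simp: e_def)
      have "mline (\<psi> t) e (\<lambda>s. \<psi> (t + s))"
        unfolding mline_def
      proof (intro conjI allI impI)
        fix y assume y: "y \<notin> I" "d (\<psi> t) y < e"
        then have "y \<in> W" using r e by auto
        then obtain s where s: "s \<ge> 0" "y = \<phi> s" using W(3) y p by auto
        have "\<bar>(T1 + t) - s\<bar> < e" using y s ec(2)[of "T1 + t" s] t T1 by (auto simp: \<psi>_def)
        then show "\<exists>s. \<bar>s\<bar> < e \<and> y = \<psi> (t + s)"
          using s by (intro exI[of _ "s - (T1 + t)"]) (auto simp: \<psi>_def)
      next
        fix s s' assume "\<bar>s\<bar> < e" "\<bar>s'\<bar> < e"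
        then show "d (\<psi> (t + s)) (\<psi> (t + s')) = \<bar>s - s'\<bar>"
          using ec(2)[of "T1 + (t + s)" "T1 + (t + s')"] e T1 by (auto simp: \<psi>_def)
      next
        fix s assume "\<bar>s\<bar> < e"
        then show "\<psi> (t + s) \<notin> I" using ec(1)[of "T1 + (t + s)"] e T1 by (auto simp: \<psi>_def)
      qed (use e in auto)
      moreover have "{t - e<..<t + e} \<subseteq> {0<..}" using e by auto
      ultimately show "\<exists>e>0. {t - e<..<t + e} \<subseteq> {0<..} \<and> mline (\<psi> t) e (\<lambda>s. \<psi> (t + s))"
        using e by blast
    qed
    moreover have op: "open (insert p (\<psi> ` {U<..}))" if U: "U \<ge> 0" for U
    proof -
      have "compact (\<phi> ` {0..T1 + U})"
        using cont by (intro compact_continuous_image) (auto elim: continuous_on_subset)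
      then have cl: "closed (\<phi> ` {0..T1 + U})" by (rule compact_imp_closed)
      have ne: "\<phi> s \<noteq> \<phi> t" if "s \<noteq> t" "0 \<le> s" "0 \<le> t" for s t
        using ec(2)[OF that(2,3)] ec(1)[OF that(3)] d_self that(1) by fastforce
      \<comment> \<open>The chart is injective, so the final piece is the open set \<open>W\<close>
        without the compact, hence closed, initial piece.\<close>
      have "insert p (\<psi> ` {U<..}) = W \<inter> - (\<phi> ` {0..T1 + U})"
      proof (intro equalityI subsetI)
        fix y assume "y \<in> insert p (\<psi> ` {U<..})"
        then consider "y = p" | t where "t > U" "y = \<psi> t" by auto
        then show "y \<in> W \<inter> - (\<phi> ` {0..T1 + U})"
        proof cases
          case 1 then show ?thesis using W(2) ec(1) p by auto
        next
          case 2
          have "y \<in> W" using T 2 T1 U by (auto simp: \<psi>_def)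
          moreover have "y \<notin> \<phi> ` {0..T1 + U}"
          proof
            assume "y \<in> \<phi> ` {0..T1 + U}"
            then obtain s where "0 \<le> s" "s \<le> T1 + U" "y = \<phi> s" by auto
            then show False using ne[of s "T1 + t"] 2 T1 U by (simp add: \<psi>_def)
          qed
          ultimately show ?thesis by simp
        qed
      next
        fix y assume y: "y \<in> W \<inter> - (\<phi> ` {0..T1 + U})"
        show "y \<in> insert p (\<psi> ` {U<..})"
        proof (cases "y = p")
          case False
          then obtain s where s: "s \<ge> 0" "y = \<phi> s" using y W(3) by auto
          then have "s > T1 + U" using y by force
          then have "y = \<psi> (s - T1)" "s - T1 > U" using s by (auto simp: \<psi>_def)
          then show ?thesis by auto
        qed simp
      qed
      then show ?thesis using W(1) cl by auto
    qed
    moreover have "end_chart d I p \<psi>"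
      unfolding end_chart_def
    proof (intro conjI allI impI)
      have "filterlim (\<lambda>t. T1 + t) at_top at_top"
        by (rule filterlim_tendsto_add_at_top[OF tendsto_const filterlim_ident])
      then show "(\<psi> \<longlongrightarrow> p) at_top" unfolding \<psi>_def by (rule filterlim_compose[OF ec(3)])
      have "insert p (\<psi> ` {0<..}) \<subseteq> insert p (\<psi> ` {0..})" by auto
      then show "p \<in> interior (insert p (\<psi> ` {0..}))"
        using op[of 0] by (meson insertI1 interior_maximal order_refl subsetD)
    next
      fix s t :: real assume "0 \<le> s" "0 \<le> t"
      then show "d (\<psi> s) (\<psi> t) = \<bar>s - t\<bar>" using ec(2)[of "T1 + s" "T1 + t"] T1 by (auto simp: \<psi>_def)
    qed (use ec(1) T1 in \<open>auto simp: \<psi>_def\<close>)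
    ultimately show ?thesis unfolding tail_chart_def \<psi>_def by blast
  qed
  show ?thesis using main by (intro exI[of _ "max 0 T"]) auto
qed

lemma tail: assumes "p \<in> I" shows "tail_chart p (tail p)"
proof -
  obtain \<phi> where "end_chart d I p \<phi>" using curve assms unfolding tropical_curve_def by blast
  then obtain T0 where "\<forall>T1\<ge>T0. tail_chart p (\<lambda>t. \<phi> (T1 + t))"
    using end_chart_tail_chart[OF assms] by blast
  then have "tail_chart p (\<lambda>t. \<phi> (T0 + t))" by simp
  then show ?thesis unfolding tail_def by (rule someI[of "tail_chart p"])
qed

lemma tailD:
  assumes "p \<in> I"
  shows "geo {0<..} (tail p)" "end_chart d I p (tail p)" "T \<ge> 0 \<Longrightarrow> open (insert p (tail p ` {T<..}))"
    "(tail p \<longlongrightarrow> p) at_top" "t \<ge> 0 \<Longrightarrow> tail p t \<notin> I" "s \<ge> 0 \<Longrightarrow> t \<ge> 0 \<Longrightarrow> d (tail p s) (tail p t) = \<bar>s - t\<bar>"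
  using tail[OF assms] by (auto simp: tail_chart_def end_chart_def)

lemma tail_inj: "p \<in> I \<Longrightarrow> s \<ge> 0 \<Longrightarrow> t \<ge> 0 \<Longrightarrow> tail p s = tail p t \<longleftrightarrow> s = t"
  using tailD(5,6)[of p] d_self by (metis abs_eq_0 eq_iff_diff_eq_0)

lemma tail_avoids:
  assumes "p \<in> I" "finite N"
  obtains T where "T > 0" "\<forall>t>T. tail p t \<notin> N"
proof -
  have "finite {t. t \<ge> 0 \<and> tail p t \<in> N}"
    using finite_vimage_IntI[OF assms(2), of "tail p" "{0..}"] tail_inj[OF assms(1)]
    by (simp add: inj_on_def vimage_def Int_def conj_commute)
  then obtain T where T: "\<forall>t\<in>{t. t \<ge> 0 \<and> tail p t \<in> N}. t \<le> T"
    using bdd_above_finite unfolding bdd_above_def by blast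
  show ?thesis
  proof (rule that[of "max T 1"])
    show "\<forall>t>max T 1. tail p t \<notin> N"
    proof (intro allI impI notI)
      fix t assume "max T 1 < t" "tail p t \<in> N"
      then have "t \<le> T" using T by simp
      then show False using \<open>max T 1 < t\<close> by simp
    qed
  qed simp
qed

lemma arm_avoids:
  assumes "x \<notin> I" "finite N"
  obtains e where "0 < e" "e \<le> rad x" "\<forall>y. y \<notin> I \<longrightarrow> d x y < e \<longrightarrow> y \<noteq> x \<longrightarrow> y \<notin> N"
    "\<forall>i<val x. \<forall>t. 0 < t \<longrightarrow> t < e \<longrightarrow> arm x i t \<notin> N \<and> arm x i t \<noteq> x"
proof -
  have "open (- (N - {x}))" by (rule open_Compl[OF finite_imp_closed[OF finite_Diff[OF assms(2)]]])
  then obtain r where r: "0 < r" "\<forall>y. y \<notin> I \<longrightarrow> d x y < r \<longrightarrow> y \<in> - (N - {x})"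
    using ball_in_open[of "- (N - {x})" x] assms(1) by blast
  have "arm x i t \<notin> N \<and> arm x i t \<noteq> x" if "i < val x" "0 < t" "t < min r (rad x)" for i t
  proof -
    have "d x (arm x i t) = t" using mstar_dist0[OF star[OF assms(1)] that(1), of t] that by auto
    moreover have "arm x i t \<notin> I" using mstarD(5)[OF star[OF assms(1)] that(1), of t] that by auto
    ultimately show ?thesis using r(2) that d_self assms(1) by fastforce
  qed
  then show ?thesis using that[of "min r (rad x)"] r rad_pos[OF assms(1)] by auto
qed

text \<open>Points inside the arms of a star or inside a tail lie on geodesics and have valence 2,
  so every point has a neighbourhood in which it is the only possible exception.\<close>

lemma finite_branch_points: "finite {x. x \<notin> I \<and> val x \<noteq> 2}"
proof (rule compact_finite_by_local)
  fix y :: 'a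
  let ?N = "{x. x \<notin> I \<and> val x \<noteq> 2}"
  show "\<exists>U. open U \<and> y \<in> U \<and> finite (U \<inter> ?N)"
  proof (cases "y \<in> I")
    case True
    have "insert y (tail y ` {0<..}) \<inter> ?N \<subseteq> {}"
      using geo_val[OF tailD(1)[OF True]] True by auto
    then show ?thesis using tailD(3)[OF True, of 0]
      by (intro exI[of _ "insert y (tail y ` {0<..})"]) auto
  next
    case False
    have "{z. z \<notin> I \<and> d y z < rad y} \<inter> ?N \<subseteq> {y}"
    proof
      fix z assume z: "z \<in> {z. z \<notin> I \<and> d y z < rad y} \<inter> ?N"
      then obtain i t where it: "i < val y" "0 \<le> t" "t < rad y" "z = arm y i t"
        using mstarD(7)[OF star[OF False]] by blast
      have "t = 0"
      proof (rule ccontr)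
        assume "t \<noteq> 0"
        then have "val z = 2" using geo_val[OF mstar_geo[OF star[OF False] it(1)], of t] it by auto
        then show False using z by simp
      qed
      then show "z \<in> {y}" using it mstarD(4)[OF star[OF False]] by auto
    qed
    moreover have "y \<in> {z. z \<notin> I \<and> d y z < rad y}" using False d_self rad_pos by auto
    ultimately show ?thesis using open_ball[OF False]
      by (intro exI[of _ "{z. z \<notin> I \<and> d y z < rad y}"]) (auto intro: finite_subset)
  qed
qed

end

section \<open>Darts of a subdivided curve\<close>

text \<open>\<open>B_I\<close> excludes a vertex set without finite points, such as the empty set on
  a circle: there would be no arm from which a dart could start.\<close>

locale model = trop_curve +
  fixes B :: "'a set"
  assumes finite_B: "finite B" and I_B: "I \<subseteq> B" and val_B: "x \<notin> B \<Longrightarrow> val x = 2"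
    and B_I: "\<exists>x\<in>B. x \<notin> I"
begin

section \<open>Maximal geodesics issuing from the arms of vertices\<close>

definition darts :: "('a \<times> nat) set" where
  "darts = (SIGMA v:B - I. {..<val v})"

lemma finite_darts: "finite darts"
  using finite_B by (simp add: darts_def)

lemma dartsD: "\<delta> \<in> darts \<Longrightarrow> fst \<delta> \<in> B" "\<delta> \<in> darts \<Longrightarrow> fst \<delta> \<notin> I" "\<delta> \<in> darts \<Longrightarrow> snd \<delta> < val (fst \<delta>)"
  by (auto simp: darts_def)

definition ext :: "'a \<times> nat \<Rightarrow> real \<Rightarrow> (real \<Rightarrow> 'a) \<Rightarrow> bool" where
  "ext \<delta> L \<sigma> \<longleftrightarrow> 0 < L \<and> geo {0<..<L} \<sigma> \<and> (\<forall>t\<in>{0<..<L}. \<sigma> t \<notin> B) \<and>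
     (\<forall>\<^sub>F t in at_right 0. \<sigma> t = arm (fst \<delta>) (snd \<delta>) t)"

definition dom :: "'a \<times> nat \<Rightarrow> real set" where
  "dom \<delta> = {t. \<exists>L \<sigma>. 0 < t \<and> t < L \<and> ext \<delta> L \<sigma>}"

text \<open>Extensions of the same arm agree where both are defined (\<open>ext_agree\<close>), so
  the path is their union and the choice does not matter.\<close>

definition path :: "'a \<times> nat \<Rightarrow> real \<Rightarrow> 'a" where
  "path \<delta> t = (SOME y. \<exists>L \<sigma>. 0 < t \<and> t < L \<and> ext \<delta> L \<sigma> \<and> y = \<sigma> t)"

lemma ext_agree:
  assumes "ext \<delta> L \<sigma>" "ext \<delta> L' \<sigma>'" "0 < t" "t < L" "t < L'"
  shows "\<sigma> t = \<sigma>' t"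
proof -
  let ?J = "{0<..<min L L'}"
  have "\<forall>\<^sub>F t in at_right 0. \<sigma> t = \<sigma>' t"
    using assms(1,2) unfolding ext_def by (auto elim: eventually_elim2)
  then obtain e where e: "0 < e" "\<forall>t. 0 < t \<longrightarrow> t < e \<longrightarrow> \<sigma> t = \<sigma>' t"
    unfolding eventually_at_right_field by auto
  define t0 where "t0 = min e (min L L') / 2"
  have t0: "0 < t0" "t0 < e" "t0 \<in> ?J" using e assms by (auto simp: t0_def)
  have "\<forall>\<^sub>F s in nhds t0. s \<in> {0<..<e}" using t0 by (intro eventually_nhds_in_open) auto
  then have "\<forall>\<^sub>F s in nhds t0. \<sigma> s = \<sigma>' s" by (rule eventually_mono) (use e in auto)
  moreover have "geo ?J \<sigma>" "geo ?J \<sigma>'"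
    using assms(1,2) unfolding ext_def by (auto elim!: geo_subset)
  ultimately show ?thesis using geo_unique[of ?J \<sigma> \<sigma>' t0 t] t0 assms by auto
qed

lemma path_ext:
  assumes "ext \<delta> L \<sigma>" "0 < t" "t < L"
  shows "t \<in> dom \<delta>" "path \<delta> t = \<sigma> t"
proof -
  show "t \<in> dom \<delta>" using assms by (auto simp: dom_def)
  have "\<exists>y L \<sigma>. 0 < t \<and> t < L \<and> ext \<delta> L \<sigma> \<and> y = \<sigma> t" using assms by blast
  then have "\<exists>L \<sigma>. 0 < t \<and> t < L \<and> ext \<delta> L \<sigma> \<and> path \<delta> t = \<sigma> t"
    unfolding path_def by (rule someI_ex)
  then show "path \<delta> t = \<sigma> t" using ext_agree[OF _ assms(1)] assms by metis
qed

lemma domE: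
  assumes "t \<in> dom \<delta>"
  obtains L \<sigma> where "0 < t" "t < L" "ext \<delta> L \<sigma>" "\<forall>s. 0 < s \<longrightarrow> s < L \<longrightarrow> s \<in> dom \<delta> \<and> path \<delta> s = \<sigma> s"
proof -
  obtain L \<sigma> where L: "0 < t" "t < L" "ext \<delta> L \<sigma>" using assms by (auto simp: dom_def)
  show ?thesis by (rule that[OF L]) (simp add: path_ext[OF L(3)])
qed

lemma dom_pos: "t \<in> dom \<delta> \<Longrightarrow> 0 < t"
  by (auto simp: dom_def)

lemma dom_down: "t \<in> dom \<delta> \<Longrightarrow> 0 < s \<Longrightarrow> s \<le> t \<Longrightarrow> s \<in> dom \<delta>"
  unfolding dom_def by force

lemma dom_up: assumes "t \<in> dom \<delta>" obtains s where "s \<in> dom \<delta>" "t < s"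
proof -
  obtain L \<sigma> where L: "0 < t" "t < L" "ext \<delta> L \<sigma>" using assms by (auto simp: dom_def)
  have "(t + L)/2 \<in> dom \<delta>" using path_ext(1)[OF L(3), of "(t+L)/2"] L by auto
  then show ?thesis using that[of "(t+L)/2"] L by auto
qed

lemma open_dom: "open (dom \<delta>)"
proof -
  have "dom \<delta> = (\<Union>L\<in>{L. \<exists>\<sigma>. ext \<delta> L \<sigma>}. {0<..<L})" by (auto simp: dom_def)
  then show ?thesis by auto
qed

lemma dom_interval: "is_interval (dom \<delta>)"
  unfolding is_interval_1 using dom_down dom_pos by (meson less_le_trans)

lemma geo_path: "geo (dom \<delta>) (path \<delta>)"
proof (rule geo_local[OF open_dom])
  fix t assume "t \<in> dom \<delta>"
  then obtain L \<sigma> where L: "0 < t" "t < L" "ext \<delta> L \<sigma>"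
    "\<forall>s. 0 < s \<longrightarrow> s < L \<longrightarrow> s \<in> dom \<delta> \<and> path \<delta> s = \<sigma> s" by (rule domE)
  have "\<forall>\<^sub>F s in nhds t. s \<in> {0<..<L}" using L by (intro eventually_nhds_in_open) auto
  then have "\<forall>\<^sub>F s in nhds t. path \<delta> s = \<sigma> s" by (rule eventually_mono) (use L(4) in auto)
  then show "\<exists>J \<sigma>'. t \<in> J \<and> geo J \<sigma>' \<and> (\<forall>\<^sub>F s in nhds t. path \<delta> s = \<sigma>' s)"
    using L(1-3) by (intro exI[of _ "{0<..<L}"] exI[of _ \<sigma>]) (auto simp: ext_def)
qed

lemma path_notin_B: "t \<in> dom \<delta> \<Longrightarrow> path \<delta> t \<notin> B"
  by (erule domE) (auto simp: ext_def)

lemma path_notin_I: "t \<in> dom \<delta> \<Longrightarrow> path \<delta> t \<notin> I"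
  using path_notin_B I_B by blast

lemma path_start:
  assumes "\<delta> \<in> darts"
  obtains e where "0 < e" "e \<le> rad (fst \<delta>)" "\<forall>t. 0 < t \<longrightarrow> t < e \<longrightarrow> t \<in> dom \<delta>"
    "\<forall>t. 0 < t \<longrightarrow> t < e \<longrightarrow> path \<delta> t = arm (fst \<delta>) (snd \<delta>) t"
    "\<forall>t. 0 < t \<longrightarrow> t < e \<longrightarrow> d (fst \<delta>) (path \<delta> t) = t"
proof -
  let ?v = "fst \<delta>" and ?i = "snd \<delta>"
  note v = dartsD[OF assms]
  obtain e where e: "0 < e" "e \<le> rad ?v" "\<forall>y. y \<notin> I \<longrightarrow> d ?v y < e \<longrightarrow> y \<noteq> ?v \<longrightarrow> y \<notin> B"
    "\<forall>i<val ?v. \<forall>t. 0 < t \<longrightarrow> t < e \<longrightarrow> arm ?v i t \<notin> B \<and> arm ?v i t \<noteq> ?v"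
    by (rule arm_avoids[OF v(2) finite_B])
  have "geo {0<..<rad ?v} (arm ?v ?i)" using mstar_geo[OF star v(3)] v(2) by blast
  then have "geo {0<..<e} (arm ?v ?i)" by (rule geo_subset) (use e in auto)
  then have x: "ext \<delta> e (arm ?v ?i)" unfolding ext_def using e v by auto
  show ?thesis
  proof (rule that[of e]; (intro allI impI)?)
    fix t assume t: "0 < t" "t < e"
    show "t \<in> dom \<delta>" "path \<delta> t = arm ?v ?i t" using path_ext[OF x t] .
    then show "d ?v (path \<delta> t) = t" using mstar_dist0[OF star v(3), of t] v(2) t e by auto
  qed (use e in auto)
qed

text \<open>As \<open>t\<close> tends to 0 the path approaches its vertex and the geodesic
  approaches \<open>\<sigma> u\<close>, so the two limits coincide. It is used to show that a
  geodesic avoiding \<open>B\<close> cannot contain the start of a dart.\<close>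

lemma start_limit:
  assumes "\<delta> \<in> darts" "geo J \<sigma>" "u \<in> J" "\<kappa> = 1 \<or> \<kappa> = (-1 :: real)" "0 < e"
    and eq: "\<And>t. 0 < t \<Longrightarrow> t < e \<Longrightarrow> t \<in> dom \<delta> \<Longrightarrow> path \<delta> t = \<sigma> (u + \<kappa> * t)"
  shows "\<sigma> u = fst \<delta>"
proof (rule ccontr)
  assume ne: "\<sigma> u \<noteq> fst \<delta>"
  have nI: "\<sigma> u \<notin> I" "fst \<delta> \<notin> I" using geo_notin_I assms dartsD by auto
  define \<eta> where "\<eta> = d (fst \<delta>) (\<sigma> u)"
  have \<eta>: "0 < \<eta>" using d_pos[OF nI] ne d_nonneg[of "fst \<delta>" "\<sigma> u"] d_commute[of "fst \<delta>" "\<sigma> u"]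
    by (auto simp: \<eta>_def less_le)
  obtain e1 where e10: "0 < e1" "e1 \<le> rad (fst \<delta>)" "\<forall>t. 0 < t \<longrightarrow> t < e1 \<longrightarrow> t \<in> dom \<delta>"
    "\<forall>t. 0 < t \<longrightarrow> t < e1 \<longrightarrow> path \<delta> t = arm (fst \<delta>) (snd \<delta>) t"
    "\<forall>t. 0 < t \<longrightarrow> t < e1 \<longrightarrow> d (fst \<delta>) (path \<delta> t) = t"
    by (rule path_start[OF assms(1)])
  note e1 = e10[rule_format]
  obtain e2 where e2: "0 < e2" "mline (\<sigma> u) e2 (\<lambda>s. \<sigma> (u + s))" by (rule geoE[OF assms(2,3)])
  define t where "t = min (min e e1) (min e2 (\<eta> / 2)) / 2"
  have t: "0 < t" "t < e" "t < e1" "t < e2" "t < \<eta> / 2" using assms(5) e1(1) e2(1) \<eta> by (auto simp: t_def)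
  have "path \<delta> t = \<sigma> (u + \<kappa> * t)" using eq t e1(3) by auto
  moreover have k: "\<bar>\<kappa> * t\<bar> < e2" using assms(4) t by auto
  ultimately have "d (\<sigma> u) (path \<delta> t) = t" "path \<delta> t \<notin> I"
    using mline_dist0[OF e2(2) k] mlineD(3)[OF e2(2) k] assms(4) t by auto
  moreover have "\<eta> \<le> d (fst \<delta>) (path \<delta> t) + d (path \<delta> t) (\<sigma> u)"
    unfolding \<eta>_def using d_tri nI \<open>path \<delta> t \<notin> I\<close> by auto
  ultimately show False using e1(5)[of t] t by (simp add: d_commute)
qed

text \<open>By maximality, a dart cannot stop inside a geodesic that it has joined.\<close>

lemma glue:
  assumes \<delta>: "\<delta> \<in> darts" and t: "t \<in> dom \<delta>" and G: "geo J \<sigma>" and J: "is_interval J" "0 \<in> J"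
    and B: "\<And>x. x \<in> J \<Longrightarrow> \<sigma> x \<notin> B"
    and eq: "\<And>s. t + s \<in> dom \<delta> \<Longrightarrow> s \<in> J \<Longrightarrow> path \<delta> (t + s) = \<sigma> s"
    and s: "s \<in> J" "0 < t + s"
  shows "t + s \<in> dom \<delta>" "path \<delta> (t + s) = \<sigma> s"
proof -
  have "t + s \<in> dom \<delta>"
  proof (cases "s \<le> 0")
    case True then show ?thesis using dom_down[OF t] s by auto
  next
    case False
    obtain e where e: "0 < e" "{s-e<..<s+e} \<subseteq> J" by (rule geoE[OF G s(1)])
    \<comment> \<open>\<open>ext\<close> speaks of an open interval, so the extension has to go
      beyond \<open>t + s\<close> to have it in the domain.\<close>
    define s' where "s' = s + e / 2"
    have s': "s < s'" "s' \<in> J" using e by (auto simp: s'_def subset_iff)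
    have J': "x \<in> J" if "0 \<le> x" "x \<le> s'" for x using J s' that unfolding is_interval_1 by blast
    define \<tau> where "\<tau> w = (if w \<le> t then path \<delta> w else \<sigma> (w - t))" for w
    have t0: "0 < t" using t by (rule dom_pos)
    have "geo {0<..<t + s'} \<tau>"
    proof (rule geo_local)
      fix w assume w: "w \<in> {0<..<t + s'}"
      show "\<exists>J \<sigma>'. w \<in> J \<and> geo J \<sigma>' \<and> (\<forall>\<^sub>F x in nhds w. \<tau> x = \<sigma>' x)"
      proof (cases "w \<le> t")
        case True
        have wd: "w \<in> dom \<delta>" using dom_down[OF t] w True by auto
        have "\<forall>\<^sub>F x in nhds w. x \<in> dom \<delta> \<inter> {..<t + s'}"
          using wd w by (intro eventually_nhds_in_open) (auto intro: open_dom)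
        then have "\<forall>\<^sub>F x in nhds w. \<tau> x = path \<delta> x"
        proof (rule eventually_mono)
          fix x assume x: "x \<in> dom \<delta> \<inter> {..<t + s'}"
          show "\<tau> x = path \<delta> x"
          proof (cases "x \<le> t")
            case False
            then have "x - t \<in> J" using J'[of "x - t"] x by auto
            then show ?thesis using eq[of "x - t"] x False by (simp add: \<tau>_def)
          qed (simp add: \<tau>_def)
        qed
        then show ?thesis using wd geo_path by (intro exI[of _ "dom \<delta>"] exI[of _ "path \<delta>"] conjI)
      next
        case False
        have "geo {x. -t + 1 * x \<in> J} (\<lambda>x. \<sigma> (-t + 1 * x))" by (rule geo_affine[OF G]) simp
        moreover have "w \<in> {x. -t + 1 * x \<in> J}" using J'[of "w - t"] w False by auto
        moreover have "\<forall>\<^sub>F x in nhds w. x \<in> {t<..}"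
          using False by (intro eventually_nhds_in_open) auto
        then have "\<forall>\<^sub>F x in nhds w. \<tau> x = \<sigma> (-t + 1 * x)"
          by (rule eventually_mono) (auto simp: \<tau>_def)
        ultimately show ?thesis
          by (intro exI[of _ "{x. -t + 1 * x \<in> J}"] exI[of _ "\<lambda>x. \<sigma> (-t + 1 * x)"] conjI)
      qed
    qed auto
    moreover have "\<tau> w \<notin> B" if "w \<in> {0<..<t + s'}" for w
      using that path_notin_B[OF dom_down[OF t, of w]] B[OF J'[of "w - t"]] by (auto simp: \<tau>_def)
    moreover have "\<forall>\<^sub>F w in at_right 0. \<tau> w = arm (fst \<delta>) (snd \<delta>) w"
    proof -
      obtain e where e0: "0 < e" "e \<le> rad (fst \<delta>)" "\<forall>t. 0 < t \<longrightarrow> t < e \<longrightarrow> t \<in> dom \<delta>"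
        "\<forall>t. 0 < t \<longrightarrow> t < e \<longrightarrow> path \<delta> t = arm (fst \<delta>) (snd \<delta>) t"
        "\<forall>t. 0 < t \<longrightarrow> t < e \<longrightarrow> d (fst \<delta>) (path \<delta> t) = t"
        by (rule path_start[OF \<delta>])
      note e = e0[rule_format]
      then show ?thesis unfolding eventually_at_right_field
        using t0 by (intro exI[of _ "min e t"]) (auto simp: \<tau>_def)
    qed
    ultimately have "ext \<delta> (t + s') \<tau>" using t0 s' False by (auto simp: ext_def)
    then show ?thesis using path_ext(1)[of \<delta> "t + s'" \<tau> "t + s"] s s' by auto
  qed
  then show "t + s \<in> dom \<delta>" "path \<delta> (t + s) = \<sigma> s" using eq s by auto
qed

text \<open>Following the geodesic backwards from the meeting point for time \<open>t\<close> would
  arrive at the start vertex, which is in \<open>B\<close>; hence that parameter is outside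
  \<open>J\<close>. In the forward direction the dart is maximal and follows the geodesic as long as
  it lasts.\<close>

lemma dart_meets_geo:
  assumes \<delta>: "\<delta> \<in> darts" and t: "t \<in> dom \<delta>" and G: "geo J \<sigma>" and J: "is_interval J" "u \<in> J"
    and B: "\<And>x. x \<in> J \<Longrightarrow> \<sigma> x \<notin> B" and eq: "path \<delta> t = \<sigma> u"
  obtains \<kappa> :: real where "\<kappa> = 1 \<or> \<kappa> = -1" "u - \<kappa> * t \<notin> J"
    "\<forall>s. t + s \<in> dom \<delta> \<longrightarrow> u + \<kappa> * s \<in> J \<longrightarrow> path \<delta> (t + s) = \<sigma> (u + \<kappa> * s)"
    "\<forall>s. u + \<kappa> * s \<in> J \<longrightarrow> 0 < t + s \<longrightarrow> t + s \<in> dom \<delta> \<and> path \<delta> (t + s) = \<sigma> (u + \<kappa> * s)"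
proof -
  obtain \<kappa> :: real where \<kappa>0: "\<kappa> = 1 \<or> \<kappa> = -1"
    "\<forall>s. t + s \<in> dom \<delta> \<longrightarrow> u + \<kappa> * s \<in> J \<longrightarrow> path \<delta> (t + s) = \<sigma> (u + \<kappa> * s)"
    by (rule geo_meet[OF geo_path G dom_interval J(1) t J(2) eq])
  note \<kappa> = \<kappa>0[rule_format]
  have G': "geo {s. u + \<kappa> * s \<in> J} (\<lambda>s. \<sigma> (u + \<kappa> * s))" by (rule geo_affine[OF G \<kappa>(1)])
  have J': "is_interval {s. u + \<kappa> * s \<in> J}"
    unfolding is_interval_1
  proof (intro ballI allI impI)
    fix a b x assume ab: "a \<in> {s. u + \<kappa> * s \<in> J}" "b \<in> {s. u + \<kappa> * s \<in> J}" "a \<le> x \<and> x \<le> b"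
    show "x \<in> {s. u + \<kappa> * s \<in> J}"
      using \<kappa>(1)
    proof
      assume k: "\<kappa> = 1"
      then have "u + a \<in> J" "u + b \<in> J" "u + a \<le> u + x \<and> u + x \<le> u + b" using ab by auto
      then have "u + x \<in> J" using J(1) unfolding is_interval_1 by blast
      then show ?thesis using k by simp
    next
      assume k: "\<kappa> = -1"
      then have "u - b \<in> J" "u - a \<in> J" "u - b \<le> u - x \<and> u - x \<le> u - a" using ab by auto
      then have "u - x \<in> J" using J(1) unfolding is_interval_1 by blast
      then show ?thesis using k by simp
    qed
  qed
  have *: "t + s \<in> dom \<delta> \<and> path \<delta> (t + s) = \<sigma> (u + \<kappa> * s)" if "u + \<kappa> * s \<in> J" "0 < t + s" for s
  proof -
    have a: "0 \<in> {s. u + \<kappa> * s \<in> J}" using J(2) by simp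
    have b: "\<sigma> (u + \<kappa> * x) \<notin> B" if "x \<in> {s. u + \<kappa> * s \<in> J}" for x using B that by simp
    have c: "path \<delta> (t + x) = \<sigma> (u + \<kappa> * x)" if "t + x \<in> dom \<delta>" "x \<in> {s. u + \<kappa> * s \<in> J}" for x
      using \<kappa>(2) that by simp
    show ?thesis using glue[OF \<delta> t G' J' a b c, of s] that by simp
  qed
  have "u - \<kappa> * t \<notin> J"
  proof
    assume u: "u - \<kappa> * t \<in> J"
    have "\<sigma> (u - \<kappa> * t) = fst \<delta>"
    proof (rule start_limit[OF \<delta> G u \<kappa>(1) dom_pos[OF t]])
      fix w assume w: "0 < w" "w < t" "w \<in> dom \<delta>"
      have "u - \<kappa> * t + \<kappa> * w \<in> J"
        using \<kappa>(1)
      proof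
        assume k: "\<kappa> = 1"
        then have "u - t \<in> J" "u - t \<le> u - t + w" "u - t + w \<le> u" using u w by auto
        then have "u - t + w \<in> J" using mem_is_interval_1_I[OF J(1) _ J(2)] by blast
        then show ?thesis using k by simp
      next
        assume k: "\<kappa> = -1"
        then have "u + t \<in> J" "u \<le> u + t - w" "u + t - w \<le> u + t" using u w by auto
        then have "u + t - w \<in> J" using mem_is_interval_1_I[OF J(1) J(2)] by blast
        then show ?thesis using k by simp
      qed
      then show "path \<delta> w = \<sigma> (u - \<kappa> * t + \<kappa> * w)"
        using \<kappa>(2)[of "w - t"] w by (simp add: algebra_simps)
    qed
    then show False using B[OF u] dartsD[OF \<delta>] by simp
  qed
  with \<kappa> show ?thesis using * by (intro that[of \<kappa>]) auto
qed

text \<open>A point of \<open>J\<close> could be missed only if it came before the start of the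
  dart. Then the start itself would lie in the interval \<open>J\<close>, against
  \<open>dart_meets_geo\<close>.\<close>

lemma dart_covers_geo:
  assumes \<delta>: "\<delta> \<in> darts" and t: "t \<in> dom \<delta>" and G: "geo J \<sigma>" and J: "is_interval J" "u \<in> J"
    and B: "\<And>x. x \<in> J \<Longrightarrow> \<sigma> x \<notin> B" and eq: "path \<delta> t = \<sigma> u"
  shows "\<sigma> ` J \<subseteq> path \<delta> ` dom \<delta>"
proof
  fix y assume "y \<in> \<sigma> ` J"
  then obtain x where x: "x \<in> J" "y = \<sigma> x" by auto
  obtain \<kappa> :: real where \<kappa>0: "\<kappa> = 1 \<or> \<kappa> = -1" "u - \<kappa> * t \<notin> J"
    "\<forall>s. t + s \<in> dom \<delta> \<longrightarrow> u + \<kappa> * s \<in> J \<longrightarrow> path \<delta> (t + s) = \<sigma> (u + \<kappa> * s)"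
    "\<forall>s. u + \<kappa> * s \<in> J \<longrightarrow> 0 < t + s \<longrightarrow> t + s \<in> dom \<delta> \<and> path \<delta> (t + s) = \<sigma> (u + \<kappa> * s)"
    by (rule dart_meets_geo[OF assms])
  note \<kappa> = \<kappa>0[rule_format]
  define s where "s = \<kappa> * (x - u)"
  have us: "u + \<kappa> * s = x" using \<kappa>(1) by (auto simp: s_def)
  have "0 < t + s"
  proof (rule ccontr)
    assume n: "\<not> 0 < t + s"
    have "u - \<kappa> * t \<in> J"
      using \<kappa>(1)
    proof
      assume k: "\<kappa> = 1"
      then have "x \<le> u - t" "u - t \<le> u" using n dom_pos[OF t] by (auto simp: s_def)
      then have "u - t \<in> J" using mem_is_interval_1_I[OF J(1) x(1) J(2)] by blast
      then show ?thesis using k by simp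
    next
      assume k: "\<kappa> = -1"
      then have "u \<le> u + t" "u + t \<le> x" using n dom_pos[OF t] by (auto simp: s_def)
      then have "u + t \<in> J" using mem_is_interval_1_I[OF J(1) J(2) x(1)] by blast
      then show ?thesis using k by simp
    qed
    then show False using \<kappa>(2) by simp
  qed
  then show "y \<in> path \<delta> ` dom \<delta>" using \<kappa>(4)[of s] us x by (metis imageI)
qed

text \<open>With equal orientation, different parameters would put the start of one dart inside the
  other, so both leave the same vertex through the same arm. With opposite orientation each dart
  ends where the other begins, which gives the common length \<open>t + u\<close>.\<close>

lemma dart_meet:
  assumes \<delta>: "\<delta> \<in> darts" and \<delta>': "\<delta>' \<in> darts" and t: "t \<in> dom \<delta>" and u: "u \<in> dom \<delta>'"
    and eq: "path \<delta> t = path \<delta>' u"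
  shows "\<delta> = \<delta>' \<and> t = u \<or>
    \<delta> \<noteq> \<delta>' \<and> dom \<delta> = {0<..<t + u} \<and> dom \<delta>' = {0<..<t + u} \<and>
    (\<forall>w\<in>{0<..<t + u}. path \<delta> w = path \<delta>' (t + u - w))"
proof -
  obtain \<kappa> :: real where \<kappa>0: "\<kappa> = 1 \<or> \<kappa> = -1" "u - \<kappa> * t \<notin> dom \<delta>'"
    "\<forall>s. t + s \<in> dom \<delta> \<longrightarrow> u + \<kappa> * s \<in> dom \<delta>' \<longrightarrow> path \<delta> (t + s) = path \<delta>' (u + \<kappa> * s)"
    "\<forall>s. u + \<kappa> * s \<in> dom \<delta>' \<longrightarrow> 0 < t + s \<longrightarrow> t + s \<in> dom \<delta> \<and> path \<delta> (t + s) = path \<delta>' (u + \<kappa> * s)"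
    by (rule dart_meets_geo[OF \<delta> t geo_path dom_interval u path_notin_B eq])
  note \<kappa> = \<kappa>0[rule_format]
  have tu: "0 < t" "0 < u" using dom_pos t u by auto
  from \<kappa>(1) show ?thesis
  proof
    assume k: "\<kappa> = 1"
    have ut: "u \<le> t"
      by (rule ccontr) (use \<kappa>(2) k dom_down[OF u, of "u - t"] tu in simp)
    have "t \<le> u"
    proof (rule ccontr)
      assume n: "\<not> t \<le> u"
      then have d: "t - u \<in> dom \<delta>" using dom_down[OF t, of "t - u"] tu by auto
      have "path \<delta> (t - u) = fst \<delta>'"
      proof (rule start_limit[OF \<delta>' geo_path d, of 1 u])
        fix w assume w: "0 < w" "w < u" "w \<in> dom \<delta>'"
        then show "path \<delta>' w = path \<delta> (t - u + 1 * w)"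
          using \<kappa>(4)[of "w - u"] k n by (auto simp: algebra_simps)
      qed (use tu in auto)
      then show False using path_notin_B[OF d] dartsD[OF \<delta>'] by simp
    qed
    then have tu': "t = u" using ut by simp
    obtain e1 where e10: "0 < e1" "e1 \<le> rad (fst \<delta>)" "\<forall>t. 0 < t \<longrightarrow> t < e1 \<longrightarrow> t \<in> dom \<delta>"
      "\<forall>t. 0 < t \<longrightarrow> t < e1 \<longrightarrow> path \<delta> t = arm (fst \<delta>) (snd \<delta>) t"
      "\<forall>t. 0 < t \<longrightarrow> t < e1 \<longrightarrow> d (fst \<delta>) (path \<delta> t) = t"
      by (rule path_start[OF \<delta>])
    note e1 = e10[rule_format]
    obtain e2 where e20: "0 < e2" "e2 \<le> rad (fst \<delta>')" "\<forall>t. 0 < t \<longrightarrow> t < e2 \<longrightarrow> t \<in> dom \<delta>'"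
      "\<forall>t. 0 < t \<longrightarrow> t < e2 \<longrightarrow> path \<delta>' t = arm (fst \<delta>') (snd \<delta>') t"
      "\<forall>t. 0 < t \<longrightarrow> t < e2 \<longrightarrow> d (fst \<delta>') (path \<delta>' t) = t"
      by (rule path_start[OF \<delta>'])
    note e2 = e20[rule_format]
    have eqw: "path \<delta> w = path \<delta>' w" if "0 < w" "w < e1" "w < e2" for w
      using \<kappa>(3)[of "w - t"] e1(3)[of w] e2(3)[of w] that k tu' by auto
    note v = dartsD[OF \<delta>] and v' = dartsD[OF \<delta>']
    have vv: "fst \<delta> = fst \<delta>'"
    proof (rule ccontr)
      assume ne: "fst \<delta> \<noteq> fst \<delta>'"
      define \<eta> where "\<eta> = d (fst \<delta>) (fst \<delta>')"
      have \<eta>: "0 < \<eta>" using d_pos[OF v(2) v'(2)] ne d_nonneg[of "fst \<delta>" "fst \<delta>'"]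
        by (auto simp: \<eta>_def less_le)
      define w where "w = min (min e1 e2) (\<eta>/2) / 2"
      have w: "0 < w" "w < e1" "w < e2" "w < \<eta> / 2" using e1(1) e2(1) \<eta> by (auto simp: w_def)
      have "\<eta> \<le> d (fst \<delta>) (path \<delta> w) + d (path \<delta> w) (fst \<delta>')"
        unfolding \<eta>_def using d_tri v(2) v'(2) path_notin_I[OF e1(3)] w by auto
      also have "d (path \<delta> w) (fst \<delta>') = d (fst \<delta>') (path \<delta>' w)"
        using eqw[OF w(1-3)] by (simp add: d_commute)
      finally show False using e1(5)[of w] e2(5)[of w] w by auto
    qed
    have "snd \<delta> = snd \<delta>'"
    proof (rule ccontr)
      assume ne: "snd \<delta> \<noteq> snd \<delta>'"
      define w where "w = min e1 e2 / 2"
      have w: "0 < w" "w < e1" "w < e2" using e1(1) e2(1) by (auto simp: w_def)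
      have "d (arm (fst \<delta>) (snd \<delta>) w) (arm (fst \<delta>) (snd \<delta>') w) = w + w"
        using mstarD(6)[OF star[OF v(2)] v(3), of "snd \<delta>'" w w] v'(3) vv ne w e1(2) by auto
      moreover have "arm (fst \<delta>) (snd \<delta>) w = arm (fst \<delta>) (snd \<delta>') w"
        using eqw[OF w] e1(4)[OF w(1,2)] e2(4)[OF w(1,3)] vv by simp
      moreover have "arm (fst \<delta>) (snd \<delta>') w \<notin> I"
        using mstarD(5)[OF star[OF v'(2)] v'(3), of w] vv w e1(2) by auto
      ultimately show False using d_self w by auto
    qed
    then show ?thesis using vv tu' by (simp add: prod_eq_iff)
  next
    assume k: "\<kappa> = -1"
    have out': "t + u \<notin> dom \<delta>'" using \<kappa>(2) k by (simp add: add.commute)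
    obtain \<kappa>' :: real where \<kappa>'0: "\<kappa>' = 1 \<or> \<kappa>' = -1" "t - \<kappa>' * u \<notin> dom \<delta>"
      "\<forall>s. u + s \<in> dom \<delta>' \<longrightarrow> t + \<kappa>' * s \<in> dom \<delta> \<longrightarrow> path \<delta>' (u + s) = path \<delta> (t + \<kappa>' * s)"
      "\<forall>s. t + \<kappa>' * s \<in> dom \<delta> \<longrightarrow> 0 < u + s \<longrightarrow> u + s \<in> dom \<delta>' \<and> path \<delta>' (u + s) = path \<delta> (t + \<kappa>' * s)"
      by (rule dart_meets_geo[OF \<delta>' u geo_path dom_interval t path_notin_B eq[symmetric]])
    note \<kappa>' = \<kappa>'0[rule_format]
    obtain e1 where e1: "0 < e1" "{t-e1<..<t+e1} \<subseteq> dom \<delta>" "mline (path \<delta> t) e1 (\<lambda>s. path \<delta> (t + s))"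
      by (rule geoE[OF geo_path t])
    \<comment> \<open>The path is injective near \<open>t\<close>, so it cannot agree with its own
      mirror image there. This forces the orientation found with exchanged roles to be reversed as
      well.\<close>
    have refl: "path \<delta> (t + s) \<noteq> path \<delta> (t - s)" if "s \<noteq> 0" "\<bar>s\<bar> < e1" for s
    proof
      assume "path \<delta> (t + s) = path \<delta> (t - s)"
      then have "d (path \<delta> (t + s)) (path \<delta> (t + - s)) = 0"
        using d_self mlineD(3)[OF e1(3), of "-s"] that by auto
      then show False using mlineD(4)[OF e1(3), of s "-s"] that by auto
    qed
    have k': "\<kappa>' = -1"
    proof (rule ccontr)
      assume "\<kappa>' \<noteq> -1"
      then have k': "\<kappa>' = 1" using \<kappa>'(1) by simp
      obtain e2 where e2: "0 < e2" "{u-e2<..<u+e2} \<subseteq> dom \<delta>'" by (rule geoE[OF geo_path u])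
      define s where "s = min e1 e2 / 2"
      have s: "0 < s" "s < e1" "s < e2" using e1(1) e2(1) by (auto simp: s_def)
      have "t + s \<in> dom \<delta>" "t - s \<in> dom \<delta>" "u - s \<in> dom \<delta>'" using e1(2) e2(2) s by (auto simp: subset_iff)
      then have "path \<delta> (t + s) = path \<delta> (t - s)" using \<kappa>(3)[of s] \<kappa>'(3)[of "-s"] k k' by auto
      then show False using refl[of s] s by auto
    qed
    then have out: "t + u \<notin> dom \<delta>" using \<kappa>'(2) by simp
    have sub: "w < t + u" if "w \<in> dom \<delta>" for w
      using that out dom_down[OF that, of "t + u"] tu by force
    have sub': "w < t + u" if "w \<in> dom \<delta>'" for w
      using that out' dom_down[OF that, of "t + u"] tu by force
    have in1: "w \<in> dom \<delta>" if "0 < w" "w < t + u" for w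
    proof (cases "w \<le> t")
      case False
      then have "u - (w - t) \<in> dom \<delta>'" using dom_down[OF u] that by auto
      then show ?thesis using \<kappa>(4)[of "w - t"] k that by (simp add: algebra_simps)
    qed (use dom_down[OF t] that in auto)
    have in2: "w \<in> dom \<delta>'" if "0 < w" "w < t + u" for w
    proof (cases "w \<le> u")
      case False
      then have "t - (w - u) \<in> dom \<delta>" using dom_down[OF t] that by auto
      then show ?thesis using \<kappa>'(4)[of "w - u"] k' that by (simp add: algebra_simps)
    qed (use dom_down[OF u] that in auto)
    have d1: "dom \<delta> = {0<..<t + u}" by (intro set_eqI iffI) (simp_all add: in1 sub dom_pos)
    have d2: "dom \<delta>' = {0<..<t + u}" by (intro set_eqI iffI) (simp_all add: in2 sub' dom_pos)
    have e: "path \<delta> w = path \<delta>' (t + u - w)" if "0 < w" "w < t + u" for w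
      using \<kappa>(3)[of "w - t"] in1[OF that] in2[of "t + u - w"] that k by (simp add: algebra_simps)
    have "\<delta> \<noteq> \<delta>'"
    proof
      assume dd: "\<delta> = \<delta>'"
      \<comment> \<open>A dart that is its own reversal would be folded at its midpoint.\<close>
      define m where "m = (t + u) / 2"
      have "m \<in> dom \<delta>" using tu in1 by (simp add: m_def)
      then obtain e3 where e3: "0 < e3" "{m-e3<..<m+e3} \<subseteq> dom \<delta>" "mline (path \<delta> m) e3 (\<lambda>s. path \<delta> (m + s))"
        by (rule geoE[OF geo_path])
      define s where "s = e3 / 2"
      have s: "0 < s" "\<bar>s\<bar> < e3" "\<bar>- s\<bar> < e3" using e3(1) by (auto simp: s_def)
      have "m + s \<in> dom \<delta>" using s e3(2) by (auto simp: subset_iff)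
      then have "path \<delta> (m + s) = path \<delta> (m - s)"
      proof -
        have "t + u - (m + s) = m - s" by (simp add: m_def)
        then show ?thesis using e[of "m + s"] dd d1 \<open>m + s \<in> dom \<delta>\<close> by simp
      qed
      then have "d (path \<delta> (m + s)) (path \<delta> (m + - s)) = 0"
        using d_self mlineD(3)[OF e3(3) s(3)] by simp
      then show False using mlineD(4)[OF e3(3) s(2,3)] s by auto
    qed
    then show ?thesis using d1 d2 e by auto
  qed
qed

lemma path_inj: "\<delta> \<in> darts \<Longrightarrow> t \<in> dom \<delta> \<Longrightarrow> u \<in> dom \<delta> \<Longrightarrow> path \<delta> t = path \<delta> u \<Longrightarrow> t = u"
  using dart_meet[of \<delta> \<delta> t u] by blast

lemma dom_nonempty: "\<delta> \<in> darts \<Longrightarrow> \<exists>t. t \<in> dom \<delta>"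
proof -
  assume "\<delta> \<in> darts"
  then obtain e where e: "0 < e" "e \<le> rad (fst \<delta>)" "\<forall>t. 0 < t \<longrightarrow> t < e \<longrightarrow> t \<in> dom \<delta>"
    "\<forall>t. 0 < t \<longrightarrow> t < e \<longrightarrow> path \<delta> t = arm (fst \<delta>) (snd \<delta>) t"
    "\<forall>t. 0 < t \<longrightarrow> t < e \<longrightarrow> d (fst \<delta>) (path \<delta> t) = t" by (rule path_start)
  then show ?thesis by (intro exI[of _ "e/2"]) auto
qed

section \<open>Where darts end, and that they cover the curve\<close>

lemma arms_are_paths:
  assumes v: "v \<in> B" "v \<notin> I"
  obtains e where "0 < e" "e \<le> rad v"
    "\<forall>i<val v. \<forall>t. 0 < t \<longrightarrow> t < e \<longrightarrow> t \<in> dom (v, i) \<and> path (v, i) t = arm v i t"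
proof -
  have "\<exists>e>0. \<forall>t. 0 < t \<longrightarrow> t < e \<longrightarrow> t \<in> dom (v, i) \<and> path (v, i) t = arm v i t" if "i < val v" for i
  proof -
    have "(v, i) \<in> darts" using v that by (auto simp: darts_def)
    then obtain e where e: "0 < e" "e \<le> rad (fst (v, i))" "\<forall>t. 0 < t \<longrightarrow> t < e \<longrightarrow> t \<in> dom (v, i)"
      "\<forall>t. 0 < t \<longrightarrow> t < e \<longrightarrow> path (v, i) t = arm (fst (v, i)) (snd (v, i)) t"
      "\<forall>t. 0 < t \<longrightarrow> t < e \<longrightarrow> d (fst (v, i)) (path (v, i) t) = t" by (rule path_start)
    then show ?thesis by (intro exI[of _ e]) auto
  qed
  then obtain E where E: "\<forall>i<val v. 0 < E i \<and> (\<forall>t. 0 < t \<longrightarrow> t < E i \<longrightarrow> t \<in> dom (v, i) \<and> path (v, i) t = arm v i t)"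
    by metis
  define e where "e = Min (insert (rad v) (E ` {..<val v}))"
  have le: "e \<le> rad v" "\<forall>i<val v. e \<le> E i" unfolding e_def by auto
  have "0 < e" unfolding e_def using E rad_pos[OF v(2)] by (subst Min_gr_iff) auto
  then show ?thesis using that[of e] le E by force
qed

lemma B_line:
  assumes "x \<notin> B"
  obtains \<rho> l where "mline x \<rho> l" "\<forall>s. \<bar>s\<bar> < \<rho> \<longrightarrow> l s \<notin> B"
proof -
  have x: "x \<notin> I" "val x = 2" using assms I_B val_B by auto
  let ?l = "\<lambda>s. if 0 \<le> s then arm x 0 s else arm x 1 (- s)"
  have l: "mline x (rad x) ?l" by (rule val_mline[OF x])
  have "open (- B)" using finite_B by (simp add: finite_imp_closed open_Compl)
  then obtain r where r: "0 < r" "\<forall>y. y \<notin> I \<longrightarrow> d x y < r \<longrightarrow> y \<in> - B"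
    using ball_in_open[of "- B" x] assms x(1) by blast
  have m: "mline x (min r (rad x)) ?l" using mline_mono[OF l] r rad_pos[OF x(1)] by auto
  have "?l s \<notin> B" if s: "\<bar>s\<bar> < min r (rad x)" for s
    using r(2) mline_dist0[OF m s] mlineD(3)[OF m s] s by auto
  then show ?thesis by (intro that[OF m]) blast
qed

lemma line_in_path:
  assumes "\<delta> \<in> darts" "t \<in> dom \<delta>" "mline x \<rho> l" "\<forall>s. \<bar>s\<bar> < \<rho> \<longrightarrow> l s \<notin> B" "path \<delta> t \<notin> I" "d x (path \<delta> t) < \<rho>"
  shows "l ` {-\<rho><..<\<rho>} \<subseteq> path \<delta> ` dom \<delta>"
proof -
  obtain s where s: "\<bar>s\<bar> < \<rho>" "path \<delta> t = l s" using mlineD(5)[OF assms(3,5,6)] by blast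
  show ?thesis
  proof (rule dart_covers_geo[OF assms(1,2) mline_geo[OF assms(3)] _ _ _ s(2)])
    show "is_interval {-\<rho><..<\<rho>}" by (rule is_interval_oo)
  qed (use s assms(4) in auto)
qed

text \<open>The dart cannot run inwards: it would have started further out on the tail, at parameter
  \<open>u + t\<close>, where there is no point of \<open>B\<close>.\<close>

lemma tail_meet:
  assumes \<delta>: "\<delta> \<in> darts" and p: "p \<in> I" and T: "0 \<le> T" "\<forall>t>T. tail p t \<notin> B"
    and t: "t \<in> dom \<delta>" and u: "T < u" and eq: "path \<delta> t = tail p u"
  shows "dom \<delta> = {0<..}" "0 < w \<Longrightarrow> T < w + (u - t) \<Longrightarrow> path \<delta> w = tail p (w + (u - t))"
proof -
  have G: "geo {T<..} (tail p)" using tailD(1)[OF p] by (rule geo_subset) (use T in auto)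
  have int: "is_interval {T<..}" by (rule is_interval_oi)
  have u': "u \<in> {T<..}" using u by simp
  have nB: "tail p x \<notin> B" if "x \<in> {T<..}" for x using T that by simp
  obtain \<kappa> :: real where \<kappa>: "\<kappa> = 1 \<or> \<kappa> = -1" "u - \<kappa> * t \<notin> {T<..}"
    "\<forall>s. t + s \<in> dom \<delta> \<longrightarrow> u + \<kappa> * s \<in> {T<..} \<longrightarrow> path \<delta> (t + s) = tail p (u + \<kappa> * s)"
    "\<forall>s. u + \<kappa> * s \<in> {T<..} \<longrightarrow> 0 < t + s \<longrightarrow> t + s \<in> dom \<delta> \<and> path \<delta> (t + s) = tail p (u + \<kappa> * s)"
    by (rule dart_meets_geo[OF \<delta> t G int u' nB eq])
  have k: "\<kappa> = 1" using \<kappa>(1,2) u dom_pos[OF t] by auto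
  have *: "w \<in> dom \<delta> \<and> path \<delta> w = tail p (w + (u - t))" if "0 < w" "T < w + (u - t)" for w
    using \<kappa>(4)[rule_format, of "w - t"] that k by (simp add: algebra_simps)
  have "w \<in> dom \<delta>" if "0 < w" for w
  proof -
    define w' where "w' = max w (T - u + t + 1)"
    have "w' \<in> dom \<delta>" using *[of w'] that by (auto simp: w'_def)
    then show ?thesis using dom_down[of w' \<delta> w] that by (auto simp: w'_def)
  qed
  then show "dom \<delta> = {0<..}" by (intro set_eqI iffI) (simp_all add: dom_pos)
  show "path \<delta> w = tail p (w + (u - t))" if "0 < w" "T < w + (u - t)" using * that by blast
qed

text \<open>Otherwise finitely many open sets, each left for good after some parameter, cover the
  curve. A parameter beyond the largest of these exists because domains have no maximum.\<close>

lemma dart_cluster: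
  assumes \<delta>: "\<delta> \<in> darts"
  obtains y where "\<forall>U. open U \<longrightarrow> y \<in> U \<longrightarrow> (\<forall>t\<in>dom \<delta>. \<exists>s\<in>dom \<delta>. t < s \<and> path \<delta> s \<in> U)"
proof (rule ccontr)
  assume nt: "\<not> thesis"
  have "\<exists>U t. open U \<and> y \<in> U \<and> t \<in> dom \<delta> \<and> (\<forall>s\<in>dom \<delta>. t < s \<longrightarrow> path \<delta> s \<notin> U)" for y
  proof -
    have "\<not> (\<forall>U. open U \<longrightarrow> y \<in> U \<longrightarrow> (\<forall>t\<in>dom \<delta>. \<exists>s\<in>dom \<delta>. t < s \<and> path \<delta> s \<in> U))"
      using nt that[of y] by (rule contrapos_nn)
    then show ?thesis by meson
  qed
  then obtain U t where U: "\<And>y. open (U y) \<and> y \<in> U y \<and> t y \<in> dom \<delta> \<and> (\<forall>s\<in>dom \<delta>. t y < s \<longrightarrow> path \<delta> s \<notin> U y)"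
    by metis
  have "UNIV \<subseteq> (\<Union>y\<in>UNIV. U y)" using U by blast
  then obtain C where C: "finite C" "UNIV \<subseteq> (\<Union>y\<in>C. U y)"
    using compactE_image[OF compact_UNIV, of UNIV U] U by (metis UNIV_I)
  then have "C \<noteq> {}" by auto
  then have "Max (t ` C) \<in> t ` C" using C(1) by (intro Max_in) auto
  then have "Max (t ` C) \<in> dom \<delta>" using U by auto
  then obtain s where s: "s \<in> dom \<delta>" "Max (t ` C) < s" by (rule dom_up)
  obtain y where y: "y \<in> C" "path \<delta> s \<in> U y" using C(2) by blast
  have "t y < s" using s(2) C(1) y(1) by (meson Max_ge finite_imageI imageI le_less_trans)
  then show False using U s(1) y(2) by blast
qed

text \<open>The nature of a cluster point \<open>y\<close> decides. At infinity the dart joins the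
  tail. Off \<open>B\<close> it would pass through \<open>y\<close> and come back, against
  injectivity. At a finite vertex it approaches along an arm and meets the dart of that arm, which
  runs in the opposite direction.\<close>

lemma dart_end:
  assumes \<delta>: "\<delta> \<in> darts"
  shows "(dom \<delta> = {0<..} \<and> (\<exists>p\<in>I. \<exists>c T. 0 \<le> T \<and> 0 \<le> T + c \<and> (\<forall>w>T. path \<delta> w = tail p (w + c)))) \<or>
    (\<exists>\<delta>'\<in>darts. \<delta>' \<noteq> \<delta> \<and> (\<exists>L>0. dom \<delta> = {0<..<L} \<and> dom \<delta>' = {0<..<L} \<and>
       (\<forall>w\<in>{0<..<L}. path \<delta> w = path \<delta>' (L - w))))"
proof -
  obtain y where y: "\<forall>U. open U \<longrightarrow> y \<in> U \<longrightarrow> (\<forall>t\<in>dom \<delta>. \<exists>s\<in>dom \<delta>. t < s \<and> path \<delta> s \<in> U)"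
    by (rule dart_cluster[OF \<delta>])
  obtain t1 where t1: "t1 \<in> dom \<delta>" using dom_nonempty[OF \<delta>] by blast
  consider "y \<in> I" | "y \<notin> B" | "y \<in> B" "y \<notin> I" by blast
  then show ?thesis
  proof cases
    case 1
    obtain T where T: "0 < T" "\<forall>t>T. tail y t \<notin> B" by (rule tail_avoids[OF 1 finite_B])
    have "open (insert y (tail y ` {T<..}))" using tailD(3)[OF 1] T by simp
    then obtain s where s: "s \<in> dom \<delta>" "path \<delta> s \<in> insert y (tail y ` {T<..})"
      using y t1 by (meson insertI1)
    then obtain u where u: "T < u" "path \<delta> s = tail y u" using path_notin_I[OF s(1)] 1 by auto
    have T0: "0 \<le> T" using T by simp
    note m = tail_meet[OF \<delta> 1 T0 T(2) s(1) u]
    have "\<forall>w>max 0 (T - (u - s)). path \<delta> w = tail y (w + (u - s))"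
      using m(2) by auto
    then show ?thesis using m(1) 1 T0
      by (intro disjI1 conjI bexI[of _ y] exI[of _ "u - s"] exI[of _ "max 0 (T - (u - s))"]) auto
  next
    case 2
    obtain \<rho> l where l: "mline y \<rho> l" "\<forall>s. \<bar>s\<bar> < \<rho> \<longrightarrow> l s \<notin> B" by (rule B_line[OF 2])
    note yI = mline_center[OF l(1)]
    have "open {z. z \<notin> I \<and> d y z < \<rho>}" "y \<in> {z. z \<notin> I \<and> d y z < \<rho>}"
      using open_ball[OF yI] d_self[OF yI] mlineD(1)[OF l(1)] yI by auto
    then obtain s where s: "s \<in> dom \<delta>" "path \<delta> s \<in> {z. z \<notin> I \<and> d y z < \<rho>}"
      using y t1 by meson
    have "l ` {-\<rho><..<\<rho>} \<subseteq> path \<delta> ` dom \<delta>" using line_in_path[OF \<delta> s(1) l] s by auto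
    moreover have "l 0 \<in> l ` {-\<rho><..<\<rho>}" using mlineD(1)[OF l(1)] by (intro imageI) auto
    ultimately obtain t0 where t0: "t0 \<in> dom \<delta>" "y = path \<delta> t0" using mlineD(2)[OF l(1)] by auto
    obtain e where e: "0 < e" "{t0-e<..<t0+e} \<subseteq> dom \<delta>" using geoE[OF geo_path t0(1)] by metis
    let ?J = "{t0-e/2<..<t0+e/2}"
    have sub: "?J \<subseteq> dom \<delta>" using e by (auto simp: subset_iff)
    have "geo ?J (path \<delta>)" by (rule geo_subset[OF geo_path]) (use sub in auto)
    then have "open (path \<delta> ` ?J)" by (rule geo_open_image)
    moreover have "y \<in> path \<delta> ` ?J" using t0 e by auto
    moreover have "t0 + e/2 \<in> dom \<delta>" using e by (auto simp: subset_iff)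
    ultimately obtain s where s: "s \<in> dom \<delta>" "t0 + e/2 < s" "path \<delta> s \<in> path \<delta> ` ?J"
      using y by meson
    then obtain w where "w \<in> ?J" "path \<delta> s = path \<delta> w" by auto
    then have "s \<in> ?J" using path_inj[OF \<delta> s(1), of w] sub by auto
    then show ?thesis using s(2) by simp
  next
    case 3
    obtain e where e: "0 < e" "e \<le> rad y"
      "\<forall>i<val y. \<forall>t. 0 < t \<longrightarrow> t < e \<longrightarrow> t \<in> dom (y, i) \<and> path (y, i) t = arm y i t"
      by (rule arms_are_paths[OF 3])
    \<comment> \<open>The bound \<open>t1\<close> excludes that the dart found near \<open>y\<close>
      is \<open>\<delta>\<close> at the same parameter: the parameters satisfy
      \<open>r < t1 < s\<close>.\<close>
    let ?U = "{z. z \<notin> I \<and> d y z < min e t1}"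
    have "open ?U" by (rule open_ball[OF 3(2)])
    moreover have "y \<in> ?U" using d_self[OF 3(2)] 3 e dom_pos[OF t1] by auto
    ultimately
    obtain s where s: "s \<in> dom \<delta>" "t1 < s" "path \<delta> s \<in> ?U" using y t1 by meson
    then obtain j r where j: "j < val y" "0 \<le> r" "r < rad y" "path \<delta> s = arm y j r"
      using mstarD(7)[OF star[OF 3(2)], of "path \<delta> s"] e by auto
    have "d y (path \<delta> s) = r" using mstar_dist0[OF star[OF 3(2)] j(1-3)] j(4) by simp
    then have r: "r < e" "r < t1" using s by auto
    have "r \<noteq> 0" using j mstarD(4)[OF star[OF 3(2)] j(1)] path_notin_B[OF s(1)] 3 by auto
    then have r0: "0 < r" using j by simp
    have \<delta>': "(y, j) \<in> darts" using 3 j by (auto simp: darts_def)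
    have rd: "r \<in> dom (y, j)" "path \<delta> s = path (y, j) r" using e(3) j r r0 by auto
    have "\<not> (\<delta> = (y, j) \<and> s = r)" using r s by auto
    then show ?thesis using dart_meet[OF \<delta> \<delta>' s(1) rd] dom_pos[OF s(1)] r0
      by (intro disjI2 bexI[OF _ \<delta>']) (auto intro!: exI[of _ "s + r"])
  qed
qed

text \<open>The set \<open>Y\<close> of everything that darts and finite vertices account for is
  nonempty and clopen. Off \<open>B\<close> a line that meets a dart is wholly covered by it, so
  that the complement of \<open>Y\<close> is open as well; ends are treated through a final piece of
  their tail.\<close>

lemma cover:
  "x \<notin> B \<Longrightarrow> \<exists>\<delta>\<in>darts. x \<in> path \<delta> ` dom \<delta>"
  "p \<in> I \<Longrightarrow> \<exists>\<delta>\<in>darts. \<exists>T\<ge>0. (\<forall>t>T. tail p t \<notin> B) \<and> tail p ` {T<..} \<subseteq> path \<delta> ` dom \<delta>"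
proof -
  define reached where "reached p \<longleftrightarrow> (\<exists>\<delta>\<in>darts. \<exists>T\<ge>0. (\<forall>t>T. tail p t \<notin> B) \<and> tail p ` {T<..} \<subseteq> path \<delta> ` dom \<delta>)" for p
  define E where "E = (\<Union>\<delta>\<in>darts. path \<delta> ` dom \<delta>)"
  have oE: "open E" unfolding E_def using geo_open_image[OF geo_path] by auto
  define Y where "Y = E \<union> (B - I) \<union> {p\<in>I. reached p}"
  have nbh1: "\<exists>U. open U \<and> y \<in> U \<and> U \<subseteq> Y" if y: "y \<in> Y" for y
  proof -
    consider "y \<in> E" | "y \<in> B" "y \<notin> I" | "y \<in> I" "reached y" using y unfolding Y_def by blast
    then show ?thesis
    proof cases
      case 1 then show ?thesis using oE unfolding Y_def by blast
    next
      case 2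
      obtain e where e: "0 < e" "e \<le> rad y"
        "\<forall>i<val y. \<forall>t. 0 < t \<longrightarrow> t < e \<longrightarrow> t \<in> dom (y, i) \<and> path (y, i) t = arm y i t"
        by (rule arms_are_paths[OF 2])
      have "{z. z \<notin> I \<and> d y z < e} \<subseteq> Y"
      proof
        fix z assume z: "z \<in> {z. z \<notin> I \<and> d y z < e}"
        then obtain j r where j: "j < val y" "0 \<le> r" "r < rad y" "z = arm y j r"
          using mstarD(7)[OF star[OF 2(2)], of z] e by auto
        have r: "r < e" using mstar_dist0[OF star[OF 2(2)] j(1-3)] j(4) z by simp
        show "z \<in> Y"
        proof (cases "r = 0")
          case True then show ?thesis using mstarD(4)[OF star[OF 2(2)] j(1)] 2 j unfolding Y_def by simp
        next
          case False
          then have "r \<in> dom (y, j)" "z = path (y, j) r" using e(3) j r by auto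
          moreover have "(y, j) \<in> darts" using 2 j by (auto simp: darts_def)
          ultimately show ?thesis unfolding Y_def E_def by blast
        qed
      qed
      then show ?thesis using open_ball[OF 2(2)] d_self[OF 2(2)] 2 e by (intro exI[of _ "{z. z \<notin> I \<and> d y z < e}"]) auto
    next
      case 3
      then obtain \<delta> T where "\<delta> \<in> darts" "T \<ge> 0" "tail y ` {T<..} \<subseteq> path \<delta> ` dom \<delta>"
        unfolding reached_def by blast
      then show ?thesis using tailD(3)[OF 3(1)] 3 unfolding Y_def E_def
        by (intro exI[of _ "insert y (tail y ` {T<..})"]) auto
    qed
  qed
  have nbh2: "\<exists>U. open U \<and> y \<in> U \<and> U \<subseteq> - Y" if y: "y \<notin> Y" for y
  proof -
    consider "y \<notin> B" "y \<notin> E" | "y \<in> I" "\<not> reached y" using y I_B unfolding Y_def by blast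
    then show ?thesis
    proof cases
      case 1
      obtain \<rho> l where l: "mline y \<rho> l" "\<forall>s. \<bar>s\<bar> < \<rho> \<longrightarrow> l s \<notin> B" by (rule B_line[OF 1(1)])
      note yI = mline_center[OF l(1)]
      have "z \<notin> Y" if z: "z \<notin> I" "d y z < \<rho>" for z
      proof
        assume "z \<in> Y"
        obtain s where "\<bar>s\<bar> < \<rho>" "z = l s" using mlineD(5)[OF l(1) z] by blast
        then have "z \<notin> B" using l(2) by blast
        then obtain \<delta> t where t: "\<delta> \<in> darts" "t \<in> dom \<delta>" "z = path \<delta> t"
          using \<open>z \<in> Y\<close> z unfolding Y_def E_def by blast
        then have "l ` {-\<rho><..<\<rho>} \<subseteq> path \<delta> ` dom \<delta>" using line_in_path[OF t(1,2) l] z by simp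
        moreover have "l 0 \<in> l ` {-\<rho><..<\<rho>}" using mlineD(1)[OF l(1)] by (intro imageI) auto
        ultimately show False using mlineD(2)[OF l(1)] 1(2) t(1) unfolding E_def by auto
      qed
      then show ?thesis using open_ball[OF yI] d_self[OF yI] mlineD(1)[OF l(1)] yI
        by (intro exI[of _ "{z. z \<notin> I \<and> d y z < \<rho>}"]) auto
    next
      case 2
      obtain T where T: "0 < T" "\<forall>t>T. tail y t \<notin> B" by (rule tail_avoids[OF 2(1) finite_B])
      have "tail y u \<notin> E" if u: "T < u" for u
      proof
        assume "tail y u \<in> E"
        then obtain \<delta> t where t: "\<delta> \<in> darts" "t \<in> dom \<delta>" "path \<delta> t = tail y u" unfolding E_def by auto
        have G: "geo {T<..} (tail y)" using tailD(1)[OF 2(1)] by (rule geo_subset) (use T in auto)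
        have "tail y ` {T<..} \<subseteq> path \<delta> ` dom \<delta>"
          by (rule dart_covers_geo[OF t(1,2) G is_interval_oi _ _ t(3)]) (use u T(2) in auto)
        then show False using 2(2) t(1) T unfolding reached_def by (meson less_imp_le)
      qed
      moreover have "tail y u \<notin> I" if "T < u" for u using tailD(5)[OF 2(1), of u] T that by simp
      ultimately have "tail y u \<notin> Y" if "T < u" for u using T(2) that unfolding Y_def by simp
      moreover have "open (insert y (tail y ` {T<..}))" using tailD(3)[OF 2(1)] T by simp
      ultimately show ?thesis using y by (intro exI[of _ "insert y (tail y ` {T<..})"]) auto
    qed
  qed
  have "open Y" using nbh1 by (subst open_subopen) blast
  moreover have "open (- Y)" using nbh2 by (subst open_subopen) blast
  moreover have "Y \<noteq> {}" using B_I unfolding Y_def by blast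
  ultimately have "Y = UNIV"
    using connected_UNIV unfolding connected_clopen by (auto simp: closed_def)
  then have in_Y: "x \<in> E \<or> x \<in> B \<and> x \<notin> I \<or> x \<in> I \<and> reached x" for x
    unfolding Y_def by blast
  show "\<exists>\<delta>\<in>darts. x \<in> path \<delta> ` dom \<delta>" if "x \<notin> B"
  proof -
    have "x \<in> E" using in_Y[of x] that I_B by blast
    then show ?thesis by (simp add: E_def)
  qed
  show "\<exists>\<delta>\<in>darts. \<exists>T\<ge>0. (\<forall>t>T. tail p t \<notin> B) \<and> tail p ` {T<..} \<subseteq> path \<delta> ` dom \<delta>" if "p \<in> I"
  proof -
    have "p \<notin> E" using path_notin_I that unfolding E_def by blast
    then have "reached p" using in_Y[of p] that by blast
    then show ?thesis by (simp add: reached_def)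
  qed
qed

section \<open>Reversal, length and end point of a dart\<close>

definition unbounded :: "'a \<times> nat \<Rightarrow> bool" where
  "unbounded \<delta> \<longleftrightarrow> dom \<delta> = {0<..}"

definition len :: "'a \<times> nat \<Rightarrow> real" where
  "len \<delta> = Sup (dom \<delta>)"

definition rev :: "'a \<times> nat \<Rightarrow> 'a \<times> nat" where
  "rev \<delta> = (SOME \<delta>'. \<delta>' \<in> darts \<and> \<delta>' \<noteq> \<delta> \<and> dom \<delta>' = dom \<delta> \<and>
     (\<forall>w\<in>dom \<delta>. path \<delta> w = path \<delta>' (len \<delta> - w)))"

definition tip :: "'a \<times> nat \<Rightarrow> 'a" where
  "tip \<delta> = (SOME p. p \<in> I \<and> (\<exists>c T. 0 \<le> T \<and> 0 \<le> T + c \<and> (\<forall>w>T. path \<delta> w = tail p (w + c))))"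

definition tgt :: "'a \<times> nat \<Rightarrow> 'a" where
  "tgt \<delta> = (if unbounded \<delta> then tip \<delta> else fst (rev \<delta>))"

text \<open>Equality is tested at \<open>t / 2\<close>: if the darts were reverse to each other,
  \<open>dart_meet\<close> would give the domain \<open>{0<..<t}\<close>, which does not contain
  \<open>t\<close>.\<close>

lemma dart_eqI:
  assumes \<delta>: "\<delta> \<in> darts" and \<delta>': "\<delta>' \<in> darts"
    and eq: "\<And>w. w \<in> dom \<delta> \<Longrightarrow> w \<in> dom \<delta>' \<and> path \<delta> w = path \<delta>' w"
  shows "\<delta> = \<delta>'"
proof (rule ccontr)
  assume ne: "\<delta> \<noteq> \<delta>'"
  obtain t where t: "t \<in> dom \<delta>" using dom_nonempty[OF \<delta>] by blast
  have t0: "0 < t" using dom_pos[OF t] .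
  then have t2: "t / 2 \<in> dom \<delta>" using dom_down[OF t, of "t/2"] by simp
  have "dom \<delta> = {0<..<t/2 + t/2}" using dart_meet[OF \<delta> \<delta>' t2, of "t/2"] eq[OF t2] ne by blast
  then show False using t by simp
qed

lemma len_bounded: "dom \<delta> = {0<..<L} \<Longrightarrow> 0 < L \<Longrightarrow> len \<delta> = L"
  by (simp add: len_def)

lemma bounded:
  assumes \<delta>: "\<delta> \<in> darts" and b: "\<not> unbounded \<delta>"
  shows "0 < len \<delta>" "dom \<delta> = {0<..<len \<delta>}" "rev \<delta> \<in> darts" "rev \<delta> \<noteq> \<delta>" "dom (rev \<delta>) = {0<..<len \<delta>}"
    "0 < w \<Longrightarrow> w < len \<delta> \<Longrightarrow> path \<delta> w = path (rev \<delta>) (len \<delta> - w)"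
    "len (rev \<delta>) = len \<delta>" "\<not> unbounded (rev \<delta>)" "rev (rev \<delta>) = \<delta>"
proof -
  have main: "0 < len \<delta> \<and> dom \<delta> = {0<..<len \<delta>} \<and> rev \<delta> \<in> darts \<and> rev \<delta> \<noteq> \<delta> \<and> dom (rev \<delta>) = dom \<delta> \<and>
      (\<forall>w\<in>dom \<delta>. path \<delta> w = path (rev \<delta>) (len \<delta> - w))"
    if \<delta>: "\<delta> \<in> darts" and b: "\<not> unbounded \<delta>" for \<delta>
  proof -
    obtain \<delta>' L where L: "\<delta>' \<in> darts" "\<delta>' \<noteq> \<delta>" "L > 0" "dom \<delta> = {0<..<L}" "dom \<delta>' = {0<..<L}"
      "\<forall>w\<in>{0<..<L}. path \<delta> w = path \<delta>' (L - w)"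
      using dart_end[OF \<delta>] b unfolding unbounded_def by blast
    have "len \<delta> = L" using len_bounded L by blast
    then have "\<delta>' \<in> darts \<and> \<delta>' \<noteq> \<delta> \<and> dom \<delta>' = dom \<delta> \<and> (\<forall>w\<in>dom \<delta>. path \<delta> w = path \<delta>' (len \<delta> - w))"
      using L by simp
    then have "rev \<delta> \<in> darts \<and> rev \<delta> \<noteq> \<delta> \<and> dom (rev \<delta>) = dom \<delta> \<and>
        (\<forall>w\<in>dom \<delta>. path \<delta> w = path (rev \<delta>) (len \<delta> - w))"
      unfolding rev_def by (rule someI)
    then show ?thesis using \<open>len \<delta> = L\<close> L by simp
  qed
  note m = main[OF \<delta> b]
  show pos: "0 < len \<delta>" and d: "dom \<delta> = {0<..<len \<delta>}" and r: "rev \<delta> \<in> darts" "rev \<delta> \<noteq> \<delta>"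
    and d': "dom (rev \<delta>) = {0<..<len \<delta>}" using m by (blast, blast, blast, blast, metis)
  have m1: "\<forall>w\<in>dom \<delta>. path \<delta> w = path (rev \<delta>) (len \<delta> - w)" using m by blast
  show p: "path \<delta> w = path (rev \<delta>) (len \<delta> - w)" if "0 < w" "w < len \<delta>" for w
    using m1 that unfolding d by simp
  show l: "len (rev \<delta>) = len \<delta>" by (rule len_bounded[OF d' pos])
  have "len \<delta> \<in> {0<..}" "len \<delta> \<notin> {0<..<len \<delta>}" using pos by auto
  then show b': "\<not> unbounded (rev \<delta>)" unfolding unbounded_def d' by metis
  note m' = main[OF r(1) b']
  have m2: "\<forall>w\<in>dom (rev \<delta>). path (rev \<delta>) w = path (rev (rev \<delta>)) (len (rev \<delta>) - w)" using m' by blast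
  have d2: "dom (rev (rev \<delta>)) = {0<..<len \<delta>}" using m' d' by metis
  show "rev (rev \<delta>) = \<delta>"
  proof (rule dart_eqI[symmetric, OF \<delta>])
    fix w assume w: "w \<in> dom \<delta>"
    then have w': "len \<delta> - w \<in> dom (rev \<delta>)" using d d' by auto
    have "path (rev \<delta>) (len \<delta> - w) = path (rev (rev \<delta>)) (len \<delta> - (len \<delta> - w))"
      using m2 w' unfolding l by blast
    then show "w \<in> dom (rev (rev \<delta>)) \<and> path \<delta> w = path (rev (rev \<delta>)) w"
      using p[of w] w unfolding d d2 by simp
  qed (use m' in blast)
qed

text \<open>A point of an edge has one dart coordinate on an unbounded edge and two on a bounded
  one. This is what makes functions prescribed dart by dart well defined.\<close>

lemma path_rep:
  assumes \<delta>: "\<delta> \<in> darts" and \<delta>': "\<delta>' \<in> darts" and t: "t \<in> dom \<delta>" and u: "u \<in> dom \<delta>'"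
    and eq: "path \<delta> t = path \<delta>' u"
  shows "\<delta>' = \<delta> \<and> u = t \<or> \<not> unbounded \<delta> \<and> \<delta>' = rev \<delta> \<and> u = len \<delta> - t"
proof (cases "\<delta> = \<delta>'")
  case True then show ?thesis using dart_meet[OF assms] by auto
next
  case False
  then have m: "dom \<delta> = {0<..<t + u}" "dom \<delta>' = {0<..<t + u}"
    "\<forall>w\<in>{0<..<t + u}. path \<delta> w = path \<delta>' (t + u - w)" using dart_meet[OF assms] by blast+
  have p: "0 < t" "0 < u" using dom_pos t u by auto
  have l: "len \<delta> = t + u" using len_bounded m(1) p by auto
  have "t + u \<in> {0<..}" "t + u \<notin> {0<..<t + u}" using p by auto
  then have b: "\<not> unbounded \<delta>" unfolding unbounded_def m(1) by metis
  note bd = bounded[OF \<delta> b]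
  have "\<delta>' = rev \<delta>"
  proof (rule dart_eqI[OF \<delta>' bd(3)])
    fix w assume w: "w \<in> dom \<delta>'"
    then have "path \<delta> (t + u - w) = path \<delta>' w" using m by auto
    moreover have "path \<delta> (t + u - w) = path (rev \<delta>) w" using bd(6)[of "t + u - w"] l w m by auto
    ultimately show "w \<in> dom (rev \<delta>) \<and> path \<delta>' w = path (rev \<delta>) w" using bd(5) w m l by auto
  qed
  then show ?thesis using b l by auto
qed

lemma tip:
  assumes "\<delta> \<in> darts" "unbounded \<delta>"
  shows "tip \<delta> \<in> I" "\<exists>c T. 0 \<le> T \<and> 0 \<le> T + c \<and> (\<forall>w>T. path \<delta> w = tail (tip \<delta>) (w + c))"
proof -
  have "\<exists>p. p \<in> I \<and> (\<exists>c T. 0 \<le> T \<and> 0 \<le> T + c \<and> (\<forall>w>T. path \<delta> w = tail p (w + c)))"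
  proof -
    have "\<not> (\<exists>L>0. dom \<delta> = {0<..<L})"
    proof
      assume "\<exists>L>0. dom \<delta> = {0<..<L}"
      then obtain L :: real where "L > 0" "{0<..} = {0<..<L}" using assms(2) unfolding unbounded_def by auto
      then have "L \<in> {0<..<L}" by blast
      then show False by simp
    qed
    then show ?thesis using dart_end[OF assms(1)] by blast
  qed
  then have "tip \<delta> \<in> I \<and> (\<exists>c T. 0 \<le> T \<and> 0 \<le> T + c \<and> (\<forall>w>T. path \<delta> w = tail (tip \<delta>) (w + c)))"
    unfolding tip_def by (rule someI_ex)
  then show "tip \<delta> \<in> I" "\<exists>c T. 0 \<le> T \<and> 0 \<le> T + c \<and> (\<forall>w>T. path \<delta> w = tail (tip \<delta>) (w + c))" by auto
qed

lemma tail_path_limit: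
  assumes "p \<in> I" "\<forall>w>T. path \<delta> w = tail p (w + c)"
  shows "(path \<delta> \<longlongrightarrow> p) at_top"
proof -
  have "filterlim (\<lambda>t. c + t) at_top at_top"
    by (rule filterlim_tendsto_add_at_top[OF tendsto_const filterlim_ident])
  then have "((\<lambda>t. tail p (c + t)) \<longlongrightarrow> p) at_top" by (rule filterlim_compose[OF tailD(4)[OF assms(1)]])
  moreover have "\<forall>\<^sub>F t in at_top. tail p (c + t) = path \<delta> t"
    by (rule eventually_mono[OF eventually_gt_at_top[of T]]) (use assms(2) in \<open>simp add: add.commute\<close>)
  ultimately show ?thesis by (rule Lim_transform_eventually)
qed

lemma tip_limit: assumes "\<delta> \<in> darts" "unbounded \<delta>" shows "(path \<delta> \<longlongrightarrow> tip \<delta>) at_top"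
proof -
  obtain c T where "\<forall>w>T. path \<delta> w = tail (tip \<delta>) (w + c)" using tip(2)[OF assms] by blast
  then show ?thesis by (rule tail_path_limit[OF tip(1)[OF assms]])
qed

text \<open>Far out both darts are shifts of the same tail and therefore meet, and
  \<open>path_rep\<close> allows a different dart only on bounded edges.\<close>

lemma tip_inj:
  assumes \<delta>: "\<delta> \<in> darts" "unbounded \<delta>" and \<delta>': "\<delta>' \<in> darts" "unbounded \<delta>'" and eq: "tip \<delta> = tip \<delta>'"
  shows "\<delta> = \<delta>'"
proof -
  obtain c T where cT: "0 \<le> T" "0 \<le> T + c" "\<forall>w>T. path \<delta> w = tail (tip \<delta>) (w + c)"
    using tip[OF \<delta>] by blast
  obtain c' T' where cT': "0 \<le> T'" "0 \<le> T' + c'" "\<forall>w>T'. path \<delta>' w = tail (tip \<delta>) (w + c')"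
    using tip[OF \<delta>'] eq by metis
  define w where "w = max T (T' + c' - c) + 1"
  have w: "T < w" "T' < w + c - c'" by (auto simp: w_def)
  then have "path \<delta> w = path \<delta>' (w + c - c')" using cT cT' by simp
  moreover have "w \<in> dom \<delta>" "w + c - c' \<in> dom \<delta>'"
    using \<delta>(2) \<delta>'(2) w cT cT' by (auto simp: unbounded_def)
  ultimately have "\<delta>' = \<delta> \<or> \<not> unbounded \<delta>" using path_rep[OF \<delta>(1) \<delta>'(1)] by blast
  then show ?thesis using \<delta> by simp
qed

lemma tip_surj:
  assumes "p \<in> I"
  obtains \<delta> where "\<delta> \<in> darts" "unbounded \<delta>" "tip \<delta> = p"
proof -
  obtain \<delta> T where T: "\<delta> \<in> darts" "T \<ge> 0" "\<forall>t>T. tail p t \<notin> B" "tail p ` {T<..} \<subseteq> path \<delta> ` dom \<delta>"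
    using cover(2)[OF assms] by blast
  have "tail p (T + 1) \<in> path \<delta> ` dom \<delta>" using T(4) by auto
  then obtain t where t: "t \<in> dom \<delta>" "path \<delta> t = tail p (T + 1)" by auto
  note m = tail_meet[OF T(1) assms T(2,3) t(1) _ t(2)]
  have u: "unbounded \<delta>" using m(1) by (simp add: unbounded_def)
  have "\<forall>w>max 0 (T - (T + 1 - t)). path \<delta> w = tail p (w + (T + 1 - t))" using m(2) by simp
  then have "(path \<delta> \<longlongrightarrow> p) at_top" by (rule tail_path_limit[OF assms])
  then have "tip \<delta> = p" using tip_limit[OF T(1) u] tendsto_unique[OF trivial_limit_at_top_linorder] by blast
  then show ?thesis using that T(1) u by blast
qed

end

section \<open>Rational functions and their germs\<close>

text \<open>First the slope and then the intercept is locally constant on a connected set.\<close>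

lemma locally_affine_imp_affine:
  fixes u :: "real \<Rightarrow> real"
  assumes J: "connected J" and loc: "\<And>t. t \<in> J \<Longrightarrow> \<exists>m::int. \<forall>\<^sub>F s in nhds 0. u (t + s) = u t + of_int m * s"
  shows "\<exists>m::int. \<forall>s\<in>J. \<forall>t\<in>J. u t = u s + of_int m * (t - s)"
proof (cases "J = {}")
  case False
  then obtain t0 where t0: "t0 \<in> J" by blast
  obtain m :: "real \<Rightarrow> int" where m: "\<And>t. t \<in> J \<Longrightarrow> \<forall>\<^sub>F s in nhds 0. u (t + s) = u t + of_int (m t) * s"
    using loc by metis
  have nb: "\<exists>\<delta>>0. \<forall>t'\<in>J. \<bar>t' - t\<bar> < \<delta> \<longrightarrow> m t' = m t \<and> u t' = u t + of_int (m t) * (t' - t)" if t: "t \<in> J" for t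
  proof -
    obtain \<delta> where \<delta>: "0 < \<delta>" "\<forall>s. \<bar>s\<bar> < \<delta> \<longrightarrow> u (t + s) = u t + of_int (m t) * s"
      using m[OF t] unfolding eventually_nhds_metric by (auto simp: dist_real_def)
    show ?thesis
    proof (intro exI[of _ \<delta>] conjI ballI impI)
      fix t' assume t': "t' \<in> J" "\<bar>t' - t\<bar> < \<delta>"
      show ut': "u t' = u t + of_int (m t) * (t' - t)" using \<delta>(2)[rule_format, of "t' - t"] t' by simp
      obtain \<delta>' where \<delta>': "0 < \<delta>'" "\<forall>s. \<bar>s\<bar> < \<delta>' \<longrightarrow> u (t' + s) = u t' + of_int (m t') * s"
        using m[OF t'(1)] unfolding eventually_nhds_metric by (auto simp: dist_real_def)
      \<comment> \<open>A second point slightly to the right of \<open>t'\<close>, inside the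
        windows of both \<open>t\<close> and \<open>t'\<close>, allows the two slopes to be
        compared.\<close>
      define s where "s = min \<delta>' (\<delta> - \<bar>t' - t\<bar>) / 2"
      have s: "0 < s" "\<bar>s\<bar> < \<delta>'" using \<delta>'(1) t'(2) by (auto simp: s_def)
      define z where "z = \<bar>t' - t\<bar>"
      have "s \<le> (\<delta> - z) / 2" "z < \<delta>" using t'(2) by (simp_all add: s_def z_def)
      moreover have "\<bar>t' - t + s\<bar> \<le> z + s" using s(1) abs_triangle_ineq[of "t' - t" s] by (simp add: z_def)
      ultimately have "\<bar>t' - t + s\<bar> < \<delta>" using s(1) by simp
      note s = s this
      have "u (t' + s) = u t + of_int (m t) * (t' - t + s)"
        using \<delta>(2)[rule_format, of "t' - t + s"] s by simp
      moreover have "u (t' + s) = u t' + of_int (m t') * s" using \<delta>'(2) s by simp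
      ultimately have "of_int (m t') * s = (of_int (m t) :: real) * s" using ut' by (simp only: distrib_left)
      then have "real_of_int (m t') = of_int (m t)" using s(1) by (simp only: mult_cancel_right) simp
      then show "m t' = m t" by simp
    qed (rule \<delta>(1))
  qed
  have mc: "m t = m t0" if "t \<in> J" for t
  proof (rule connected_local_const[OF J that t0, where f = m], rule ballI)
    fix t assume "t \<in> J"
    then obtain \<delta> where \<delta>: "0 < \<delta>" "\<forall>t'\<in>J. \<bar>t' - t\<bar> < \<delta> \<longrightarrow> m t' = m t" using nb by metis
    then show "\<forall>\<^sub>F t' in at t within J. m t = m t'"
      unfolding eventually_at by (intro exI[of _ \<delta>]) (simp add: dist_real_def)
  qed
  have gc: "u t - of_int (m t0) * t = u s - of_int (m t0) * s" if "t \<in> J" "s \<in> J" for s t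
  proof (rule connected_local_const[OF J that, where f = "\<lambda>t. u t - of_int (m t0) * t"], rule ballI)
    fix t assume t: "t \<in> J"
    then obtain \<delta> where \<delta>: "0 < \<delta>" "\<forall>t'\<in>J. \<bar>t' - t\<bar> < \<delta> \<longrightarrow> u t' = u t + of_int (m t) * (t' - t)" using nb by metis
    then show "\<forall>\<^sub>F t' in at t within J. u t - of_int (m t0) * t = u t' - of_int (m t0) * t'"
      unfolding eventually_at using mc[OF t] by (intro exI[of _ \<delta>]) (simp add: dist_real_def algebra_simps)
  qed
  show ?thesis
  proof (intro exI[of _ "m t0"] ballI)
    fix s t assume "s \<in> J" "t \<in> J"
    then show "u t = u s + of_int (m t0) * (t - s)" using gc[of t s] by (simp add: algebra_simps)
  qed
qed auto

text \<open>The limit of \<open>c - m * t\<close> as \<open>t\<close> tends to infinity. With this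
  sign \<open>m\<close> is the order at the end, the slope for travel inwards, as in
  \<open>ord_at\<close>.\<close>

definition endval :: "real \<Rightarrow> int \<Rightarrow> ereal" where
  "endval c m = (if m = 0 then ereal c else if m > 0 then - \<infinity> else \<infinity>)"

lemma endval_limit: "((\<lambda>t. ereal (c - of_int m * t)) \<longlongrightarrow> endval c m) at_top"
proof -
  consider "m = 0" | "m > 0" | "m < 0" by linarith
  then show ?thesis
  proof cases
    case 2
    have "filterlim (\<lambda>t. of_int m * t :: real) at_top at_top"
      by (rule filterlim_tendsto_pos_mult_at_top[OF tendsto_const _ filterlim_ident]) (use 2 in simp)
    then have "filterlim (\<lambda>t. - c + of_int m * t :: real) at_top at_top"
      by (rule filterlim_tendsto_add_at_top[OF tendsto_const])
    then have "((\<lambda>t. ereal (- c + of_int m * t)) \<longlongrightarrow> \<infinity>) at_top" by (simp add: tendsto_PInfty_eq_at_top)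
    then have "((\<lambda>t. - ereal (- c + of_int m * t)) \<longlongrightarrow> - \<infinity>) at_top" by (rule tendsto_uminus_ereal)
    then show ?thesis using 2 by (simp add: endval_def)
  next
    case 3
    have "filterlim (\<lambda>t. of_int (- m) * t :: real) at_top at_top"
      by (rule filterlim_tendsto_pos_mult_at_top[OF tendsto_const _ filterlim_ident]) (use 3 in simp)
    then have "filterlim (\<lambda>t. c + of_int (- m) * t :: real) at_top at_top"
      by (rule filterlim_tendsto_add_at_top[OF tendsto_const])
    then show ?thesis using 3 by (simp add: endval_def tendsto_PInfty_eq_at_top)
  qed (simp add: endval_def)
qed

lemma linear_eventually_unique:
  assumes "\<forall>\<^sub>F t in at_top. (a::real) - of_int m * t = b - of_int n * t"
  shows "m = n"
proof -
  obtain T where T: "\<forall>t\<ge>T. a - of_int m * t = b - of_int n * t"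
    using assms by (auto simp: eventually_at_top_linorder)
  have "a - of_int m * T = b - of_int n * T" "a - of_int m * (T + 1) = b - of_int n * (T + 1)"
    using T by simp_all
  then have "real_of_int m = of_int n" by (simp add: algebra_simps)
  then show ?thesis by simp
qed

abbreviation fv :: "('a \<Rightarrow> ereal) \<Rightarrow> 'a \<Rightarrow> real" where
  "fv f x \<equiv> real_of_ereal (f x)"

context trop_curve
begin

definition slope :: "('a \<Rightarrow> ereal) \<Rightarrow> 'a \<Rightarrow> nat \<Rightarrow> int \<Rightarrow> bool" where
  "slope f x i s \<longleftrightarrow> (\<forall>\<^sub>F t in at_right 0. f (arm x i t) = f x + ereal (of_int s * t))"

definition end_germ :: "('a \<Rightarrow> ereal) \<Rightarrow> 'a \<Rightarrow> real \<Rightarrow> int \<Rightarrow> bool" where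
  "end_germ f p c m \<longleftrightarrow> (\<forall>\<^sub>F t in at_top. f (tail p t) = ereal (c - of_int m * t)) \<and> f p = endval c m"

text \<open>A pointwise substitute for \<open>rational_function\<close>
  (\<open>rational_iff_germs\<close>). Neither a breakpoint set nor continuity is mentioned, which
  suits functions that are built edge by edge.\<close>

definition germs :: "('a \<Rightarrow> ereal) \<Rightarrow> bool" where
  "germs f \<longleftrightarrow> (\<forall>x. x \<notin> I \<longrightarrow> \<bar>f x\<bar> \<noteq> \<infinity> \<and> (\<forall>i<val x. \<exists>s. slope f x i s)) \<and>
     (\<forall>p\<in>I. \<exists>c m. end_germ f p c m)"

definition sl :: "('a \<Rightarrow> ereal) \<Rightarrow> 'a \<Rightarrow> nat \<Rightarrow> int" where
  "sl f x i = (THE s. slope f x i s)"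

text \<open>The condition that \<open>pw_linear\<close> imposes off \<open>B\<close>, named so that
  it can be moved between charts.\<close>

definition loclin :: "('a \<Rightarrow> ereal) \<Rightarrow> 'a \<Rightarrow> bool" where
  "loclin f x \<longleftrightarrow> (\<exists>r \<gamma>. \<exists>m::int. star_chart d I x 2 r \<gamma> \<and>
      (\<forall>t\<in>{0..<r}. f (\<gamma> 0 t) = f x + ereal (of_int m * t) \<and> f (\<gamma> 1 t) = f x - ereal (of_int m * t)))"

lemma pw_linear_loclin: "pw_linear d I f \<longleftrightarrow> (\<exists>B. finite B \<and> I \<subseteq> B \<and> (\<forall>x. x \<notin> B \<longrightarrow> loclin f x))"
  unfolding pw_linear_def loclin_def ..

lemma slope_unique:
  assumes "\<bar>f x\<bar> \<noteq> \<infinity>" "slope f x i s" "slope f x i s'"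
  shows "s = s'"
proof -
  have "\<forall>\<^sub>F t in at_right 0. f x + ereal (of_int s * t) = f x + ereal (of_int s' * t)"
    using assms(2,3) unfolding slope_def by eventually_elim simp
  then obtain b where b: "b > 0" "\<forall>y>0. y < b \<longrightarrow> f x + ereal (of_int s * y) = f x + ereal (of_int s' * y)"
    unfolding eventually_at_right_field by auto
  then have "f x + ereal (of_int s * (b/2)) = f x + ereal (of_int s' * (b/2))"
    using b(2)[rule_format, of "b/2"] by simp
  then show ?thesis using assms(1) b(1) by (cases "f x") auto
qed

lemma sl_eq: "\<bar>f x\<bar> \<noteq> \<infinity> \<Longrightarrow> slope f x i s \<Longrightarrow> sl f x i = s"
  unfolding sl_def using slope_unique by (intro the_equality)

lemma slope_sl: "germs f \<Longrightarrow> x \<notin> I \<Longrightarrow> i < val x \<Longrightarrow> slope f x i (sl f x i)"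
  using sl_eq unfolding germs_def by metis

lemma germs_fin: "germs f \<Longrightarrow> x \<notin> I \<Longrightarrow> \<bar>f x\<bar> \<noteq> \<infinity>"
  by (simp add: germs_def)

lemma germs_end: "germs f \<Longrightarrow> p \<in> I \<Longrightarrow> \<exists>c m. end_germ f p c m"
  by (simp add: germs_def)

lemma germs_finite: "germs f \<Longrightarrow> x \<notin> I \<Longrightarrow> f x = ereal (fv f x)"
  unfolding germs_def by (metis ereal_real')

lemma slope_fv:
  assumes "germs f" "x \<notin> I" "i < val x"
  obtains e where "0 < e" "e \<le> rad x" "\<forall>t. 0 \<le> t \<longrightarrow> t < e \<longrightarrow> fv f (arm x i t) = fv f x + of_int (sl f x i) * t"
proof -
  obtain e where e: "0 < e" "\<forall>t>0. t < e \<longrightarrow> f (arm x i t) = f x + ereal (of_int (sl f x i) * t)"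
    using slope_sl[OF assms] unfolding slope_def eventually_at_right_field by auto
  have "fv f (arm x i t) = fv f x + of_int (sl f x i) * t" if "0 \<le> t" "t < min e (rad x)" for t
  proof (cases "t = 0")
    case True then show ?thesis using mstarD(4)[OF star[OF assms(2)] assms(3)] by simp
  next
    case False
    then have "f (arm x i t) = ereal (fv f x) + ereal (of_int (sl f x i) * t)"
      using e that germs_finite[OF assms(1,2)] by auto
    then show ?thesis by simp
  qed
  then show ?thesis using e(1) rad_pos[OF assms(2)] that[of "min e (rad x)"] by auto
qed

lemma slopeI:
  assumes "\<bar>f x\<bar> \<noteq> \<infinity>" "0 < e"
    "\<forall>t. 0 < t \<longrightarrow> t < e \<longrightarrow> f (arm x i t) = ereal (fv f x + of_int s * t)"
  shows "slope f x i s"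
proof -
  have "f x = ereal (fv f x)" using assms(1) by (simp add: ereal_real')
  then have "f (arm x i t) = f x + ereal (of_int s * t)" if "0 < t" "t < e" for t
    using assms(3) that by (metis plus_ereal.simps(1))
  then show ?thesis unfolding slope_def eventually_at_right_field using assms(2) by blast
qed

text \<open>\<open>ord_at\<close> allows any chart; \<open>mstar_compare\<close> matches its arms
  with the standard ones by a permutation, which does not change the sum of the slopes.\<close>

lemma ord_at_finite:
  assumes g: "germs f" and x: "x \<notin> I"
  shows "ord_at d I x f = (\<Sum>i<val x. sl f x i)"
proof -
  let ?P = "\<lambda>m. \<exists>n r \<gamma> s. star_chart d I x n r \<gamma> \<and>
      (\<forall>i<n. \<forall>\<^sub>F t in at_right 0. f (\<gamma> i t) = f x + ereal (of_int (s i) * t)) \<and> m = (\<Sum>i<n. s i)"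
  have fx: "\<bar>f x\<bar> \<noteq> \<infinity>" using g x by (simp add: germs_def)
  have "(THE m. ?P m) = (\<Sum>i<val x. sl f x i)"
  proof (rule the_equality)
    show "?P (\<Sum>i<val x. sl f x i)"
      using mstar_imp_star_chart[OF star[OF x]] slope_sl[OF g x] unfolding slope_def
      by (intro exI[of _ "val x"] exI[of _ "rad x"] exI[of _ "arm x"] exI[of _ "sl f x"]) auto
  next
    fix m assume "?P m"
    then obtain n r \<gamma> s where P: "star_chart d I x n r \<gamma>"
      "\<forall>i<n. \<forall>\<^sub>F t in at_right 0. f (\<gamma> i t) = f x + ereal (of_int (s i) * t)" "m = (\<Sum>i<n. s i)" by blast
    obtain r' where r': "0 < r'" "r' \<le> r" "mstar x n r' \<gamma>" by (rule star_chart_imp_mstar[OF P(1)])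
    obtain \<pi> where \<pi>: "bij_betw \<pi> {..<val x} {..<n}"
        "\<forall>i<val x. \<forall>t. 0 \<le> t \<longrightarrow> t < min (rad x) r' \<longrightarrow> arm x i t = \<gamma> (\<pi> i) t"
      by (rule mstar_compare[OF star[OF x] r'(3)])
    have "sl f x i = s (\<pi> i)" if i: "i < val x" for i
    proof (rule sl_eq)
      show "\<bar>f x\<bar> \<noteq> \<infinity>" by (rule fx)
      have "\<pi> i < n" using \<pi>(1) i by (auto simp: bij_betw_def)
      then have "\<forall>\<^sub>F t in at_right 0. f (\<gamma> (\<pi> i) t) = f x + ereal (of_int (s (\<pi> i)) * t)" using P(2) by blast
      moreover have "\<forall>\<^sub>F t in at_right 0. 0 < t \<and> t < min (rad x) r'"
        unfolding eventually_at_right_field using rad_pos[OF x] r' by (intro exI[of _ "min (rad x) r'"]) auto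
      ultimately show "slope f x i (s (\<pi> i))"
        unfolding slope_def
      proof eventually_elim
        case (elim t)
        then have "arm x i t = \<gamma> (\<pi> i) t" using \<pi>(2) i by auto
        then show ?case using elim by simp
      qed
    qed
    then have "(\<Sum>i<val x. sl f x i) = (\<Sum>i<val x. s (\<pi> i))" by simp
    also have "\<dots> = (\<Sum>i<n. s i)" using \<pi>(1) by (rule sum.reindex_bij_betw)
    finally show "m = (\<Sum>i<val x. sl f x i)" using P(3) by simp
  qed
  then show ?thesis using x by (simp add: ord_at_def)
qed

text \<open>The parameter change \<open>h\<close> between the two rays preserves distances and stays
  positive. It cannot run backwards beyond \<open>T2 + h T2\<close>, which leaves a shift.\<close>

lemma end_chart_tail:
  assumes p: "p \<in> I" and \<phi>: "end_chart d I p \<phi>"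
  obtains c where "\<forall>\<^sub>F t in at_top. \<phi> t = tail p (t + c)"
proof -
  have ec: "\<And>s t. s \<ge> 0 \<Longrightarrow> t \<ge> 0 \<Longrightarrow> d (\<phi> s) (\<phi> t) = \<bar>s - t\<bar>" "\<And>t. t \<ge> 0 \<Longrightarrow> \<phi> t \<notin> I"
    "(\<phi> \<longlongrightarrow> p) at_top" using \<phi> by (auto simp: end_chart_def)
  have "\<forall>\<^sub>F t in at_top. \<phi> t \<in> insert p (tail p ` {0<..})"
    using topological_tendstoD[OF ec(3) tailD(3)[OF p, of 0]] by simp
  then obtain T where "\<forall>t\<ge>T. \<phi> t \<in> insert p (tail p ` {0<..})" by (auto simp: eventually_at_top_linorder)
  then have "\<exists>u>0. \<phi> t = tail p u" if "t \<ge> max T 0" for t using that ec(2)[of t] p by auto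
  then obtain h where h: "\<And>t. t \<ge> max T 0 \<Longrightarrow> h t > 0 \<and> \<phi> t = tail p (h t)" by metis
  define T2 where "T2 = max T 0"
  have dist: "\<bar>h s - h t\<bar> = \<bar>s - t\<bar>" if "s \<ge> T2" "t \<ge> T2" for s t
    using ec(1)[of s t] h[of s] h[of t] tailD(6)[OF p, of "h s" "h t"] that by (auto simp: T2_def)
  have ht: "h t = t + (h T2 - T2)" if "t > T2 + h T2" for t
  proof -
    have T2: "T2 \<ge> max T 0" by (simp add: T2_def)
    then have "0 < h T2" using h by blast
    then have "t \<ge> T2" using that by simp
    then have "0 < h t" using h T2 by (meson order_trans)
    moreover have "\<bar>h t - h T2\<bar> = \<bar>t - T2\<bar>" using dist \<open>t \<ge> T2\<close> by simp
    ultimately show ?thesis using that \<open>0 < h T2\<close> by linarith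
  qed
  have "\<phi> t = tail p (t + (h T2 - T2))" if "t > max T2 (T2 + h T2)" for t
  proof -
    have "t \<ge> max T 0" "t > T2 + h T2" using that by (auto simp: T2_def)
    then show ?thesis using h[of t] ht[of t] by simp
  qed
  then have "\<forall>\<^sub>F t in at_top. \<phi> t = tail p (t + (h T2 - T2))"
    by (rule eventually_mono[OF eventually_gt_at_top])
  then show ?thesis by (rule that)
qed

lemma ord_at_end:
  assumes p: "p \<in> I" and f: "\<forall>\<^sub>F t in at_top. f (tail p t) = ereal (c - of_int m * t)"
  shows "ord_at d I p f = m"
proof -
  let ?P = "\<lambda>m. \<exists>\<phi> c. end_chart d I p \<phi> \<and> (\<forall>\<^sub>F t in at_top. f (\<phi> t) = ereal (c - of_int m * t))"
  have "(THE m. ?P m) = m"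
  proof (rule the_equality)
    show "?P m" using f tailD(2)[OF p] by blast
  next
    fix m' assume "?P m'"
    then obtain \<phi> c' where P: "end_chart d I p \<phi>" "\<forall>\<^sub>F t in at_top. f (\<phi> t) = ereal (c' - of_int m' * t)" by blast
    obtain a where a: "\<forall>\<^sub>F t in at_top. \<phi> t = tail p (t + a)" by (rule end_chart_tail[OF p P(1)])
    have "filterlim (\<lambda>t. a + t) at_top at_top"
      by (rule filterlim_tendsto_add_at_top[OF tendsto_const filterlim_ident])
    then have "\<forall>\<^sub>F t in at_top. f (tail p (a + t)) = ereal (c - of_int m * (a + t))"
      by (rule eventually_compose_filterlim[OF f])
    then have "\<forall>\<^sub>F t in at_top. c' - of_int m' * t = (c - of_int m * a) - of_int m * t"
      using P(2) a by eventually_elim (auto simp: algebra_simps)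
    then show "m' = m" by (rule linear_eventually_unique)
  qed
  then show ?thesis using p by (simp add: ord_at_def)
qed

lemma ord_end_germ: "p \<in> I \<Longrightarrow> end_germ f p c m \<Longrightarrow> ord_at d I p f = m"
  unfolding end_germ_def by (elim conjE) (rule ord_at_end)

lemma line_change:
  assumes l: "mline x \<rho> l" and l': "mline x \<rho>' l'"
    and lin: "\<forall>\<^sub>F s in nhds 0. (u (l s) :: real) = u x + of_int (m :: int) * s"
  shows "\<exists>m'::int. \<forall>\<^sub>F s in nhds 0. u (l' s) = u x + of_int m' * s"
proof -
  obtain \<kappa> :: real where \<kappa>: "\<kappa> = 1 \<or> \<kappa> = -1" "\<forall>s. \<bar>s\<bar> < min \<rho> \<rho>' \<longrightarrow> l' s = l (\<kappa> * s)"
    by (rule mline_compare[OF l l'])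
  obtain \<delta> where \<delta>: "0 < \<delta>" "\<forall>s. \<bar>s\<bar> < \<delta> \<longrightarrow> u (l s) = u x + of_int m * s"
    using lin unfolding eventually_nhds_metric by (auto simp: dist_real_def)
  define m' :: int where "m' = (if \<kappa> = 1 then m else - m)"
  have "\<forall>s. \<bar>s\<bar> < min \<delta> (min \<rho> \<rho>') \<longrightarrow> u (l' s) = u x + of_int m' * s"
    using \<kappa> \<delta>(2)[rule_format, of "\<kappa> * s" for s] by (auto simp: m'_def)
  then show ?thesis unfolding eventually_nhds_metric using \<delta>(1) mlineD(1)[OF l] mlineD(1)[OF l']
    by (intro exI[of _ m'] exI[of _ "min \<delta> (min \<rho> \<rho>')"]) (auto simp: dist_real_def)
qed

lemma loclin_line:
  assumes f: "loclin f x" "\<bar>f x\<bar> \<noteq> \<infinity>" and l: "mline x \<rho> l"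
  shows "\<exists>m::int. \<forall>\<^sub>F s in nhds 0. fv f (l s) = fv f x + of_int m * s"
proof -
  obtain r \<gamma> and m :: int where g: "star_chart d I x 2 r \<gamma>"
    "\<forall>t\<in>{0..<r}. f (\<gamma> 0 t) = f x + ereal (of_int m * t) \<and> f (\<gamma> 1 t) = f x - ereal (of_int m * t)"
    using f(1) unfolding loclin_def by blast
  obtain r' where r': "0 < r'" "r' \<le> r" "mstar x 2 r' \<gamma>" by (rule star_chart_imp_mstar[OF g(1)])
  have fx: "f x = ereal (fv f x)" using f(2) by (simp add: ereal_real')
  let ?l = "\<lambda>s. if 0 \<le> s then \<gamma> 0 s else \<gamma> 1 (- s)"
  have "fv f (?l s) = fv f x + of_int m * s" if "\<bar>s\<bar> < r'" for s
  proof (cases "0 \<le> s")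
    case True
    then have "f (\<gamma> 0 s) = ereal (fv f x + of_int m * s)" using g(2) that r' fx by (metis abs_of_nonneg atLeastLessThan_iff less_le_trans plus_ereal.simps(1))
    then show ?thesis using True by simp
  next
    case False
    then have "f (\<gamma> 1 (- s)) = ereal (fv f x - of_int m * (- s))"
      using g(2) that r' fx by (metis abs_of_neg atLeastLessThan_iff ereal_minus(1) less_le_trans linear neg_0_le_iff_le not_less)
    then show ?thesis using False by simp
  qed
  then have "\<forall>\<^sub>F s in nhds 0. fv f (?l s) = fv f x + of_int m * s"
    unfolding eventually_nhds_metric using r'(1) by (intro exI[of _ r']) (auto simp: dist_real_def)
  then show ?thesis by (rule line_change[OF mline_of_mstar[OF r'(3)] l])
qed

lemma line_loclin:
  assumes l: "mline x \<rho> l" and fin: "\<forall>s. \<bar>s\<bar> < \<rho> \<longrightarrow> \<bar>f (l s)\<bar> \<noteq> \<infinity>"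
    and lin: "\<forall>\<^sub>F s in nhds 0. fv f (l s) = fv f x + of_int (m::int) * s"
  shows "loclin f x"
proof -
  obtain \<delta> where \<delta>: "0 < \<delta>" "\<forall>s. \<bar>s\<bar> < \<delta> \<longrightarrow> fv f (l s) = fv f x + of_int m * s"
    using lin unfolding eventually_nhds_metric by (auto simp: dist_real_def)
  define r where "r = min \<delta> \<rho>"
  have r: "0 < r" "r \<le> \<delta>" "r \<le> \<rho>" using \<delta> mlineD(1)[OF l] by (auto simp: r_def)
  let ?\<gamma> = "\<lambda>i::nat. \<lambda>s. if i = 0 then l s else l (- s)"
  have fs: "f (l s) = f x + ereal (of_int m * s)" if "\<bar>s\<bar> < r" for s
  proof -
    have "f (l s) = ereal (fv f (l s))" "f x = ereal (fv f x)"
      using fin[rule_format, of s] fin[rule_format, of 0] mlineD(1,2)[OF l] that r by (simp_all add: ereal_real')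
    then show ?thesis using \<delta>(2) that r by (metis less_le_trans plus_ereal.simps(1))
  qed
  have "f (?\<gamma> 0 t) = f x + ereal (of_int m * t) \<and> f (?\<gamma> 1 t) = f x - ereal (of_int m * t)"
    if "t \<in> {0..<r}" for t
    using fs[of t] fs[of "-t"] that by (simp add: minus_ereal_def)
  then show ?thesis unfolding loclin_def
    using mstar_imp_star_chart[OF mstar_of_mline[OF mline_mono[OF l r(1,3)]]] by blast
qed

lemma loclin_affine:
  assumes G: "geo J \<sigma>" and J: "is_interval J"
    and lin: "\<And>t. t \<in> J \<Longrightarrow> loclin f (\<sigma> t) \<and> \<bar>f (\<sigma> t)\<bar> \<noteq> \<infinity>"
  shows "\<exists>m::int. \<forall>s\<in>J. \<forall>t\<in>J. fv f (\<sigma> t) = fv f (\<sigma> s) + of_int m * (t - s)"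
proof (rule locally_affine_imp_affine[of J "\<lambda>t. fv f (\<sigma> t)"])
  show "connected J" using J by (rule is_interval_connected)
  fix t assume t: "t \<in> J"
  then obtain e where e: "0 < e" "{t-e<..<t+e} \<subseteq> J" "mline (\<sigma> t) e (\<lambda>s. \<sigma> (t + s))" by (rule geoE[OF G])
  show "\<exists>m::int. \<forall>\<^sub>F s in nhds 0. fv f (\<sigma> (t + s)) = fv f (\<sigma> t) + of_int m * s"
    by (rule loclin_line[OF _ _ e(3)]) (use lin[OF t] in auto)
qed

lemma arm_limit:
  assumes "x \<notin> I" "i < val x"
  shows "(arm x i \<longlongrightarrow> x) (at_right 0)"
proof (rule topological_tendstoI)
  fix U assume U: "open U" "x \<in> U"
  obtain r where r: "0 < r" "\<forall>y. y \<notin> I \<longrightarrow> d x y < r \<longrightarrow> y \<in> U" using ball_in_open[OF U assms(1)] by blast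
  have "arm x i t \<in> U" if "0 < t" "t < min r (rad x)" for t
    using r(2) mstar_dist0[OF star[OF assms(1)] assms(2), of t] mstarD(5)[OF star[OF assms(1)] assms(2), of t] that
    by auto
  then show "\<forall>\<^sub>F t in at_right 0. arm x i t \<in> U"
    unfolding eventually_at_right_field using r(1) rad_pos[OF assms(1)] by (intro exI[of _ "min r (rad x)"]) auto
qed

text \<open>Initial pieces of arms and final pieces of tails miss the finite breakpoint set, so
  \<open>f\<close> is affine on them. Continuity then identifies the value of \<open>f\<close> at
  the point with the limit of the affine expression.\<close>

lemma rational_imp_germs:
  assumes f: "rational_function d I f"
  shows "germs f"
proof -
  have cont: "continuous_on UNIV f" and fin: "\<And>x. x \<notin> I \<Longrightarrow> \<bar>f x\<bar> \<noteq> \<infinity>" and "pw_linear d I f"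
    using f by (auto simp: rational_function_def)
  then obtain B where B: "finite B" "I \<subseteq> B" "\<forall>x. x \<notin> B \<longrightarrow> loclin f x" unfolding pw_linear_loclin by blast
  have isc: "isCont f x" for x using cont by (simp add: continuous_on_eq_continuous_at)
  have 1: "\<exists>s. slope f x i s" if x: "x \<notin> I" and i: "i < val x" for x i
  proof -
    obtain e where e: "0 < e" "e \<le> rad x" "\<forall>y. y \<notin> I \<longrightarrow> d x y < e \<longrightarrow> y \<noteq> x \<longrightarrow> y \<notin> B"
      "\<forall>i<val x. \<forall>t. 0 < t \<longrightarrow> t < e \<longrightarrow> arm x i t \<notin> B \<and> arm x i t \<noteq> x"
      by (rule arm_avoids[OF x B(1)])
    have "geo {0<..<rad x} (arm x i)" by (rule mstar_geo[OF star[OF x] i])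
    then have G: "geo {0<..<e} (arm x i)" by (rule geo_subset) (use e in auto)
    have nb: "arm x i t \<notin> B" if "t \<in> {0<..<e}" for t using e(4) i that by auto
    have "\<exists>m::int. \<forall>s\<in>{0<..<e}. \<forall>t\<in>{0<..<e}. fv f (arm x i t) = fv f (arm x i s) + of_int m * (t - s)"
    proof (rule loclin_affine[OF G is_interval_oo])
      fix t assume "t \<in> {0<..<e}"
      then have "arm x i t \<notin> B" by (rule nb)
      then show "loclin f (arm x i t) \<and> \<bar>f (arm x i t)\<bar> \<noteq> \<infinity>" using B(2,3) fin by (meson subsetD)
    qed
    then obtain m :: int where m: "\<And>s t. s \<in> {0<..<e} \<Longrightarrow> t \<in> {0<..<e} \<Longrightarrow>
        fv f (arm x i t) = fv f (arm x i s) + of_int m * (t - s)" by blast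
    define k where "k = fv f (arm x i (e/2)) - of_int m * (e/2)"
    have k: "f (arm x i t) = ereal (k + of_int m * t)" if "t \<in> {0<..<e}" for t
    proof -
      have "arm x i t \<notin> I" using nb[OF that] B(2) by blast
      then have "f (arm x i t) = ereal (fv f (arm x i t))" using fin by (simp add: ereal_real')
      moreover have "fv f (arm x i t) = k + of_int m * t"
        using m[of "e/2" t] that e(1) by (simp add: k_def algebra_simps)
      ultimately show ?thesis by simp
    qed
    have "((\<lambda>t. f (arm x i t)) \<longlongrightarrow> f x) (at_right 0)"
      using isCont_tendsto_compose[OF isc arm_limit[OF x i]] .
    moreover have "((\<lambda>t. f (arm x i t)) \<longlongrightarrow> ereal (k + of_int m * 0)) (at_right 0)"
    proof (rule Lim_transform_eventually)
      show "((\<lambda>t. ereal (k + of_int m * t)) \<longlongrightarrow> ereal (k + of_int m * 0)) (at_right 0)"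
        by (intro tendsto_intros)
      show "\<forall>\<^sub>F t in at_right 0. ereal (k + of_int m * t) = f (arm x i t)"
        unfolding eventually_at_right_field using e(1) k by (intro exI[of _ e]) auto
    qed
    ultimately have fx: "f x = ereal k" using tendsto_unique[OF trivial_limit_at_right_real] by fastforce
    have "slope f x i m"
      unfolding slope_def eventually_at_right_field using e(1) k fx by (intro exI[of _ e]) auto
    then show ?thesis by blast
  qed
  have 2: "\<exists>c m. end_germ f p c m" if p: "p \<in> I" for p
  proof -
    obtain T where T: "0 < T" "\<forall>t>T. tail p t \<notin> B" by (rule tail_avoids[OF p B(1)])
    have G: "geo {T<..} (tail p)" using tailD(1)[OF p] by (rule geo_subset) (use T in auto)
    have "\<exists>m::int. \<forall>s\<in>{T<..}. \<forall>t\<in>{T<..}. fv f (tail p t) = fv f (tail p s) + of_int m * (t - s)"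
    proof (rule loclin_affine[OF G is_interval_oi])
      fix t assume "t \<in> {T<..}"
      then have "tail p t \<notin> B" using T(2) by simp
      then show "loclin f (tail p t) \<and> \<bar>f (tail p t)\<bar> \<noteq> \<infinity>" using B(2,3) fin by (meson subsetD)
    qed
    then obtain m :: int where m: "\<And>s t. s \<in> {T<..} \<Longrightarrow> t \<in> {T<..} \<Longrightarrow>
        fv f (tail p t) = fv f (tail p s) + of_int m * (t - s)" by blast
    define k where "k = fv f (tail p (T+1)) - of_int m * (T+1)"
    have k: "f (tail p t) = ereal (k - of_int (-m) * t)" if "T < t" for t
    proof -
      have "tail p t \<notin> I" using T(2) that B(2) by blast
      then have "f (tail p t) = ereal (fv f (tail p t))" using fin by (simp add: ereal_real')
      moreover have "fv f (tail p t) = k - of_int (-m) * t"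
        using m[of "T+1" t] that by (simp add: k_def algebra_simps)
      ultimately show ?thesis by simp
    qed
    then have ev: "\<forall>\<^sub>F t in at_top. f (tail p t) = ereal (k - of_int (-m) * t)"
      by (intro eventually_mono[OF eventually_gt_at_top[of T]])
    have "((\<lambda>t. f (tail p t)) \<longlongrightarrow> f p) at_top"
      using isCont_tendsto_compose[OF isc tailD(4)[OF p]] .
    moreover have "((\<lambda>t. f (tail p t)) \<longlongrightarrow> endval k (-m)) at_top"
      by (rule Lim_transform_eventually[OF endval_limit]) (use ev in \<open>simp add: eq_commute\<close>)
    ultimately have "f p = endval k (-m)" using tendsto_unique[OF trivial_limit_at_top_linorder] by blast
    then show ?thesis using ev unfolding end_germ_def by blast
  qed
  show ?thesis unfolding germs_def by (simp add: 1 2 fin)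
qed

text \<open>At a finite point the finitely many slopes give a Lipschitz estimate on a small ball. At
  infinity \<open>endval\<close> is the limit along the tail, whose final pieces are
  neighbourhoods.\<close>

lemma germs_continuous:
  assumes g: "germs f"
  shows "isCont f x"
proof (cases "x \<in> I")
  case True
  obtain c m where cm: "\<forall>\<^sub>F t in at_top. f (tail x t) = ereal (c - of_int m * t)" "f x = endval c m"
    using germs_end[OF g True] unfolding end_germ_def by (elim exE conjE)
  show ?thesis
    unfolding isCont_def
  proof (rule topological_tendstoI)
    fix U assume U: "open U" "f x \<in> U"
    have "\<forall>\<^sub>F t in at_top. ereal (c - of_int m * t) \<in> U"
      using topological_tendstoD[OF endval_limit U(1)] U(2) cm(2) by simp
    then have "\<forall>\<^sub>F t in at_top. f (tail x t) \<in> U" using cm(1) by eventually_elim simp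
    then obtain T where T: "\<forall>t\<ge>T. f (tail x t) \<in> U" by (auto simp: eventually_at_top_linorder)
    have "open (insert x (tail x ` {max T 0<..}))" using tailD(3)[OF True] by simp
    moreover have "f y \<in> U" if "y \<in> insert x (tail x ` {max T 0<..})" for y using that T U by auto
    ultimately show "\<forall>\<^sub>F y in at x. f y \<in> U"
      unfolding eventually_at_topological
      by (intro exI[of _ "insert x (tail x ` {max T 0<..})"]) simp
  qed
next
  case False
  have "\<exists>e>0. e \<le> rad x \<and> (\<forall>t. 0 \<le> t \<longrightarrow> t < e \<longrightarrow> fv f (arm x i t) = fv f x + of_int (sl f x i) * t)"
    if "i < val x" for i
    using slope_fv[OF g False that] by metis
  then obtain E where E: "\<forall>i<val x. 0 < E i \<and> E i \<le> rad x \<and>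
      (\<forall>t. 0 \<le> t \<longrightarrow> t < E i \<longrightarrow> fv f (arm x i t) = fv f x + of_int (sl f x i) * t)" by metis
  define e where "e = Min (insert (rad x) (E ` {..<val x}))"
  have le: "e \<le> rad x" "\<forall>i<val x. e \<le> E i" unfolding e_def by auto
  have e0: "0 < e" unfolding e_def using E rad_pos[OF False] by (subst Min_gr_iff) auto
  define K where "K = (\<Sum>i<val x. \<bar>real_of_int (sl f x i)\<bar>)"
  have K: "0 \<le> K" "\<forall>i<val x. \<bar>real_of_int (sl f x i)\<bar> \<le> K"
    unfolding K_def by (auto intro: sum_nonneg member_le_sum)
  have lip: "\<bar>fv f y - fv f x\<bar> \<le> K * d x y" if y: "y \<notin> I" "d x y < e" for y
  proof -
    obtain i t where it: "i < val x" "0 \<le> t" "t < rad x" "y = arm x i t"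
      using mstarD(7)[OF star[OF False], of y] y le by auto
    have t: "d x y = t" using mstar_dist0[OF star[OF False] it(1-3)] it(4) by simp
    then have "fv f y = fv f x + of_int (sl f x i) * t" using E it y le by (metis less_le_trans)
    then show ?thesis using K it t by (auto simp: abs_mult intro!: mult_right_mono)
  qed
  have lim: "((fv f) \<longlongrightarrow> fv f x) (at x)"
  proof (rule tendstoI)
    fix \<epsilon> :: real assume \<epsilon>: "0 < \<epsilon>"
    \<comment> \<open>The summand 1 covers the case that all slopes vanish.\<close>
    define r where "r = min e (\<epsilon> / (K + 1))"
    have "r \<le> \<epsilon> / (K + 1)" by (simp add: r_def)
    then have "r * (K + 1) \<le> \<epsilon>" using K(1) by (simp add: pos_le_divide_eq)
    moreover have "0 < r" "r \<le> e" using e0 \<epsilon> K(1) by (auto simp: r_def)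
    ultimately have r: "0 < r" "r \<le> e" "r * (K + 1) \<le> \<epsilon>" by auto
    have "dist (fv f y) (fv f x) < \<epsilon>" if y: "y \<notin> I" "d x y < r" for y
    proof -
      have "\<bar>fv f y - fv f x\<bar> \<le> K * d x y" using lip y r by auto
      also have "\<dots> \<le> K * r" using K(1) y by (intro mult_left_mono) auto
      also have "\<dots> < \<epsilon>" using r by (simp add: algebra_simps)
      finally show ?thesis by (simp add: dist_real_def)
    qed
    moreover have "open {y. y \<notin> I \<and> d x y < r}" "x \<in> {y. y \<notin> I \<and> d x y < r}"
      using open_ball[OF False] d_self[OF False] False r by auto
    ultimately show "\<forall>\<^sub>F y in at x. dist (fv f y) (fv f x) < \<epsilon>"
      unfolding eventually_at_topological
      by (intro exI[of _ "{y. y \<notin> I \<and> d x y < r}"]) simp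
  qed
  have "((\<lambda>y. ereal (fv f y)) \<longlongrightarrow> ereal (fv f x)) (at x)" using lim by (rule tendsto_ereal)
  moreover have "\<forall>\<^sub>F y in at x. ereal (fv f y) = f y"
    unfolding eventually_at_topological
    using closed_I False germs_finite[OF g] by (intro exI[of _ "- I"]) auto
  ultimately have "(f \<longlongrightarrow> ereal (fv f x)) (at x)" by (rule Lim_transform_eventually)
  then show ?thesis using germs_finite[OF g False] unfolding isCont_def by simp
qed

lemma affine_loclin:
  assumes g: "germs f" and G: "geo J \<sigma>" and aff: "\<And>t. t \<in> J \<Longrightarrow> fv f (\<sigma> t) = a + of_int (m::int) * t" and t: "t \<in> J"
  shows "loclin f (\<sigma> t)"
proof -
  obtain e where e: "0 < e" "{t-e<..<t+e} \<subseteq> J" "mline (\<sigma> t) e (\<lambda>s. \<sigma> (t + s))" by (rule geoE[OF G t])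
  show ?thesis
  proof (rule line_loclin[OF e(3), of _ m])
    show "\<forall>s. \<bar>s\<bar> < e \<longrightarrow> \<bar>f (\<sigma> (t + s))\<bar> \<noteq> \<infinity>"
      using germs_fin[OF g mlineD(3)[OF e(3)]] by simp
    have "fv f (\<sigma> (t + s)) = fv f (\<sigma> t) + of_int m * s" if "\<bar>s\<bar> < e" for s
    proof -
      have "t + s \<in> J" using e(2) that by (auto simp: subset_iff abs_less_iff)
      then show ?thesis using aff t by (simp add: algebra_simps)
    qed
    then show "\<forall>\<^sub>F s in nhds 0. fv f (\<sigma> (t + s)) = fv f (\<sigma> t) + of_int m * s"
      unfolding eventually_nhds_metric using e(1) by (auto simp: dist_real_def)
  qed
qed

text \<open>The germ is affine on an initial piece of each arm and a final piece of each tail, so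
  every point has a neighbourhood with no other non-affine finite point. Compactness then yields a
  finite breakpoint set.\<close>

lemma germs_imp_rational:
  assumes g: "germs f"
  shows "rational_function d I f"
proof -
  have "finite {x. x \<notin> I \<and> \<not> loclin f x}"
  proof (rule compact_finite_by_local)
    fix y :: 'a
    let ?N = "{x. x \<notin> I \<and> \<not> loclin f x}"
    show "\<exists>U. open U \<and> y \<in> U \<and> finite (U \<inter> ?N)"
    proof (cases "y \<in> I")
      case True
      obtain c m where cm: "\<forall>\<^sub>F t in at_top. f (tail y t) = ereal (c - of_int m * t)"
        using germs_end[OF g True] unfolding end_germ_def by (elim exE conjE)
      then obtain T where T: "\<forall>t\<ge>T. f (tail y t) = ereal (c - of_int m * t)" by (auto simp: eventually_at_top_linorder)
      have G: "geo {max T 0<..} (tail y)" using tailD(1)[OF True] by (rule geo_subset) auto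
      have "loclin f (tail y t)" if "t \<in> {max T 0<..}" for t
        by (rule affine_loclin[OF g G, of c "-m"]) (use T that in auto)
      then have "insert y (tail y ` {max T 0<..}) \<inter> ?N = {}" using True by auto
      moreover have "open (insert y (tail y ` {max T 0<..}))" using tailD(3)[OF True] by simp
      ultimately show ?thesis by (intro exI[of _ "insert y (tail y ` {max T 0<..})"]) simp
    next
      case False
      have "\<exists>e>0. e \<le> rad y \<and> (\<forall>t. 0 < t \<longrightarrow> t < e \<longrightarrow> loclin f (arm y i t))" if i: "i < val y" for i
      proof -
        obtain e where e: "0 < e" "e \<le> rad y"
          "\<forall>t. 0 \<le> t \<longrightarrow> t < e \<longrightarrow> fv f (arm y i t) = fv f y + of_int (sl f y i) * t"
          by (rule slope_fv[OF g False i])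
        have "geo {0<..<rad y} (arm y i)" by (rule mstar_geo[OF star[OF False] i])
        then have G: "geo {0<..<e} (arm y i)" by (rule geo_subset) (use e in auto)
        have "loclin f (arm y i t)" if "t \<in> {0<..<e}" for t
          by (rule affine_loclin[OF g G]) (use e that in auto)
        then show ?thesis using e by auto
      qed
      then obtain E where E: "\<forall>i<val y. 0 < E i \<and> E i \<le> rad y \<and> (\<forall>t. 0 < t \<longrightarrow> t < E i \<longrightarrow> loclin f (arm y i t))"
        by metis
      define e where "e = Min (insert (rad y) (E ` {..<val y}))"
      have le: "e \<le> rad y" "\<forall>i<val y. e \<le> E i" unfolding e_def by auto
      have e0: "0 < e" unfolding e_def using E rad_pos[OF False] by (subst Min_gr_iff) auto
      have "{z. z \<notin> I \<and> d y z < e} \<inter> ?N \<subseteq> {y}"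
      proof
        fix z assume z: "z \<in> {z. z \<notin> I \<and> d y z < e} \<inter> ?N"
        then obtain i t where it: "i < val y" "0 \<le> t" "t < rad y" "z = arm y i t"
          using mstarD(7)[OF star[OF False], of z] le by auto
        have t: "t < e" using mstar_dist0[OF star[OF False] it(1-3)] it(4) z by simp
        have "t = 0"
        proof (rule ccontr)
          assume "t \<noteq> 0"
          then have "0 < t" "t < E i" using it le(2) t by (auto intro: less_le_trans)
          then have "loclin f z" using E it by blast
          then show False using z by simp
        qed
        then show "z \<in> {y}" using it mstarD(4)[OF star[OF False]] by auto
      qed
      moreover have "y \<in> {z. z \<notin> I \<and> d y z < e}" using False d_self e0 by auto
      ultimately show ?thesis using open_ball[OF False]
        by (intro exI[of _ "{z. z \<notin> I \<and> d y z < e}"]) (auto intro: finite_subset)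
    qed
  qed
  then have "pw_linear d I f"
    unfolding pw_linear_loclin using finite_I by (intro exI[of _ "I \<union> {x. x \<notin> I \<and> \<not> loclin f x}"]) auto
  moreover have "continuous_on UNIV f" using germs_continuous[OF g] by (simp add: continuous_at_imp_continuous_on)
  ultimately show ?thesis using g by (simp add: rational_function_def germs_def)
qed

lemma rational_iff_germs: "rational_function d I f \<longleftrightarrow> germs f"
  using rational_imp_germs[of f] germs_imp_rational[of f] by (rule iffI)

text \<open>The values at infinity are read off from the germ of the sum, since pointwise they may be
  of the form \<open>\<infinity> - \<infinity>\<close>.\<close>

lemma germs_add:
  assumes f: "germs f" and h: "germs h"
  obtains g where "germs g" "\<forall>x. x \<notin> I \<longrightarrow> g x = f x + h x"
    "\<forall>x. ord_at d I x g = ord_at d I x f + ord_at d I x h"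
proof -
  obtain cf mf where cf: "\<And>p. p \<in> I \<Longrightarrow> end_germ f p (cf p) (mf p)" using germs_end[OF f] by metis
  obtain ch mh where ch: "\<And>p. p \<in> I \<Longrightarrow> end_germ h p (ch p) (mh p)" using germs_end[OF h] by metis
  define g where "g x = (if x \<in> I then endval (cf x + ch x) (mf x + mh x) else f x + h x)" for x
  have gv: "g x = ereal (fv f x + fv h x)" if "x \<notin> I" for x
    using germs_finite[OF f that] germs_finite[OF h that] that by (metis g_def plus_ereal.simps(1))
  have e: "end_germ g p (cf p + ch p) (mf p + mh p)" if p: "p \<in> I" for p
  proof -
    have "\<forall>\<^sub>F t in at_top. f (tail p t) = ereal (cf p - of_int (mf p) * t)"
      "\<forall>\<^sub>F t in at_top. h (tail p t) = ereal (ch p - of_int (mh p) * t)"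
      using cf[OF p] ch[OF p] by (auto simp: end_germ_def)
    moreover have "\<forall>\<^sub>F t in at_top. tail p t \<notin> I"
      by (rule eventually_mono[OF eventually_ge_at_top[of 0]]) (rule tailD(5)[OF p])
    ultimately have "\<forall>\<^sub>F t in at_top. g (tail p t) = ereal (cf p + ch p - of_int (mf p + mh p) * t)"
      by eventually_elim (simp add: g_def algebra_simps)
    then show ?thesis using p by (simp add: end_germ_def g_def)
  qed
  have s: "slope g x i (sl f x i + sl h x i)" if x: "x \<notin> I" and i: "i < val x" for x i
  proof -
    obtain e1 where e1: "0 < e1" "e1 \<le> rad x"
      "\<forall>t. 0 \<le> t \<longrightarrow> t < e1 \<longrightarrow> fv f (arm x i t) = fv f x + of_int (sl f x i) * t" by (rule slope_fv[OF f x i])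
    obtain e2 where e2: "0 < e2" "e2 \<le> rad x"
      "\<forall>t. 0 \<le> t \<longrightarrow> t < e2 \<longrightarrow> fv h (arm x i t) = fv h x + of_int (sl h x i) * t" by (rule slope_fv[OF h x i])
    show ?thesis
    proof (rule slopeI[of g x "min e1 e2"])
      show "\<forall>t. 0 < t \<longrightarrow> t < min e1 e2 \<longrightarrow> g (arm x i t) = ereal (fv g x + of_int (sl f x i + sl h x i) * t)"
      proof (intro allI impI)
        fix t assume t: "0 < t" "t < min e1 e2"
        have "arm x i t \<notin> I" using mstarD(5)[OF star[OF x] i, of t] t e1 by auto
        then show "g (arm x i t) = ereal (fv g x + of_int (sl f x i + sl h x i) * t)"
          using gv[OF x] gv[of "arm x i t"] e1(3) e2(3) t by (simp add: algebra_simps)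
      qed
    qed (use gv[OF x] x e1 e2 in auto)
  qed
  have g: "germs g"
    unfolding germs_def
  proof (intro conjI allI impI ballI)
    fix p assume "p \<in> I"
    then show "\<exists>c m. end_germ g p c m" by (intro exI) (rule e)
  next
    fix x i assume "x \<notin> I" "i < val x"
    then show "\<exists>s. slope g x i s" by (intro exI) (rule s)
  qed (simp add: gv)
  have "ord_at d I x g = ord_at d I x f + ord_at d I x h" for x
  proof (cases "x \<in> I")
    case True
    have "ord_at d I x f = mf x" "ord_at d I x h = mh x" "ord_at d I x g = mf x + mh x"
      using ord_end_germ[OF True] cf[OF True] ch[OF True] e[OF True] by simp_all
    then show ?thesis by simp
  next
    case False
    have "sl g x i = sl f x i + sl h x i" if "i < val x" for i
      using sl_eq[OF _ s[OF False that]] gv[OF False] by simp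
    then show ?thesis
      using ord_at_finite[OF g False] ord_at_finite[OF f False] ord_at_finite[OF h False]
      by (simp add: sum.distrib)
  qed
  then show ?thesis using that[OF g] by (auto simp: g_def)
qed

lemma ord_zero_line:
  assumes g: "germs f" and x: "x \<notin> I" "val x = 2" and o: "ord_at d I x f = 0" and l: "mline x \<rho> l"
  shows "\<exists>m::int. \<forall>\<^sub>F s in nhds 0. fv f (l s) = fv f x + of_int m * s"
proof -
  let ?l = "\<lambda>s. if 0 \<le> s then arm x 0 s else arm x 1 (- s)"
  have i: "0 < val x" "1 < val x" using x by auto
  have z: "sl f x 0 + sl f x 1 = 0" using o ord_at_finite[OF g x(1)] x(2) by (simp add: numeral_2_eq_2)
  obtain e1 where e1: "0 < e1" "e1 \<le> rad x"
    "\<forall>t. 0 \<le> t \<longrightarrow> t < e1 \<longrightarrow> fv f (arm x 0 t) = fv f x + of_int (sl f x 0) * t" by (rule slope_fv[OF g x(1) i(1)])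
  obtain e2 where e2: "0 < e2" "e2 \<le> rad x"
    "\<forall>t. 0 \<le> t \<longrightarrow> t < e2 \<longrightarrow> fv f (arm x 1 t) = fv f x + of_int (sl f x 1) * t" by (rule slope_fv[OF g x(1) i(2)])
  have s1: "sl f x 1 = - sl f x 0" using z by simp
  have "fv f (?l s) = fv f x + of_int (sl f x 0) * s" if "\<bar>s\<bar> < min e1 e2" for s
    using e1(3)[rule_format, of s] e2(3)[rule_format, of "-s"] that s1
    by (auto simp del: One_nat_def)
  then have "\<forall>\<^sub>F s in nhds 0. fv f (?l s) = fv f x + of_int (sl f x 0) * s"
    unfolding eventually_nhds_metric using e1(1) e2(1) by (intro exI[of _ "min e1 e2"]) (auto simp: dist_real_def)
  then show ?thesis by (rule line_change[OF val_mline[OF x] l])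
qed

lemma ord_zero_affine:
  assumes g: "germs f" and G: "geo J \<sigma>" and J: "is_interval J"
    and o: "\<And>t. t \<in> J \<Longrightarrow> ord_at d I (\<sigma> t) f = 0"
  shows "\<exists>m::int. \<forall>s\<in>J. \<forall>t\<in>J. fv f (\<sigma> t) = fv f (\<sigma> s) + of_int m * (t - s)"
proof (rule locally_affine_imp_affine[of J "\<lambda>t. fv f (\<sigma> t)"])
  show "connected J" using J by (rule is_interval_connected)
  fix t assume t: "t \<in> J"
  then obtain e where e: "0 < e" "{t-e<..<t+e} \<subseteq> J" "mline (\<sigma> t) e (\<lambda>s. \<sigma> (t + s))" by (rule geoE[OF G])
  show "\<exists>m::int. \<forall>\<^sub>F s in nhds 0. fv f (\<sigma> (t + s)) = fv f (\<sigma> t) + of_int m * s"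
    by (rule ord_zero_line[OF g _ _ o[OF t] e(3)]) (use geo_notin_I[OF G t] geo_val[OF G t] in auto)
qed

section \<open>Bounding the slopes\<close>

text \<open>The line may run along the two standard arms in either order, hence the two
  alternatives; the sum of the slopes is the same.\<close>

lemma line_slopes:
  assumes g: "\<And>y. y \<notin> I \<Longrightarrow> \<bar>f y\<bar> \<noteq> \<infinity>" and l: "mline x \<rho> l" and e: "0 < e"
    and a: "\<forall>s. 0 < s \<longrightarrow> s < e \<longrightarrow> fv f (l s) = fv f x + of_int a * s"
    and b: "\<forall>s. 0 < s \<longrightarrow> s < e \<longrightarrow> fv f (l (- s)) = fv f x + of_int b * s"
  shows "slope f x 0 a \<and> slope f x 1 b \<or> slope f x 0 b \<and> slope f x 1 a"
proof -
  note x = mline_val[OF l]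
  let ?l = "\<lambda>s. if 0 \<le> s then arm x 0 s else arm x 1 (- s)"
  obtain \<kappa> :: real where \<kappa>: "\<kappa> = 1 \<or> \<kappa> = -1" "\<forall>s. \<bar>s\<bar> < min \<rho> (rad x) \<longrightarrow> ?l s = l (\<kappa> * s)"
    by (rule mline_compare[OF l val_mline[OF x]])
  define e' where "e' = min e (min \<rho> (rad x))"
  have e': "0 < e'" "e' \<le> e" "e' \<le> \<rho>" "e' \<le> rad x" using e mlineD(1)[OF l] rad_pos[OF x(1)] by (auto simp: e'_def)
  have v: "f y = ereal (fv f y)" if "y \<notin> I" for y using g[OF that] by (simp add: ereal_real')
  have fin: "\<bar>f x\<bar> \<noteq> \<infinity>" by (rule g[OF x(1)])
  have lI: "l s \<notin> I" if "\<bar>s\<bar> < e'" for s using mlineD(3)[OF l, of s] that e' by simp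
  have arm0: "arm x 0 s = l (\<kappa> * s)" if "0 < s" "s < e'" for s
    using \<kappa>(2)[rule_format, of s] that e' by simp
  have arm1: "arm x 1 s = l (- (\<kappa> * s))" if "0 < s" "s < e'" for s
    using \<kappa>(2)[rule_format, of "- s"] that e' by simp
  have pos: "f (l s) = ereal (fv f x + of_int a * s)" if "0 < s" "s < e'" for s
    using v[OF lI[of s]] a that e' by simp
  have neg: "f (l (- s)) = ereal (fv f x + of_int b * s)" if "0 < s" "s < e'" for s
    using v[OF lI[of "-s"]] b that e' by simp

  from \<kappa>(1) show ?thesis
  proof
    assume k: "\<kappa> = 1"
    have "slope f x 0 a" by (rule slopeI[of f x, OF fin e'(1)]) (use arm0 pos k in auto)
    moreover have "slope f x 1 b" by (rule slopeI[of f x, OF fin e'(1)]) (use arm1 neg k in auto)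
    ultimately show ?thesis by simp
  next
    assume k: "\<kappa> = -1"
    have "slope f x 0 b" by (rule slopeI[of f x, OF fin e'(1)]) (use arm0 neg k in auto)
    moreover have "slope f x 1 a" by (rule slopeI[of f x, OF fin e'(1)]) (use arm1 pos k in auto)
    ultimately show ?thesis by simp
  qed
qed

lemma ord_line:
  assumes g: "germs f" and l: "mline x \<rho> l" and e: "0 < e"
    and a: "\<forall>s. 0 < s \<longrightarrow> s < e \<longrightarrow> fv f (l s) = fv f x + of_int a * s"
    and b: "\<forall>s. 0 < s \<longrightarrow> s < e \<longrightarrow> fv f (l (- s)) = fv f x + of_int b * s"
  shows "ord_at d I x f = a + b"
proof -
  note x = mline_val[OF l]
  have "sl f x 0 + sl f x 1 = a + b"
    using line_slopes[OF germs_fin[OF g] l e a b] sl_eq[of f x] germs_fin[OF g x(1)] by auto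
  then show ?thesis using ord_at_finite[OF g x(1)] x(2) by (simp add: numeral_2_eq_2)
qed

lemma loclin_ord:
  assumes g: "germs f" and x: "x \<notin> I" and lin: "loclin f x"
  shows "ord_at d I x f = 0"
proof -
  have "val x = 2"
    using lin star_chart_valence x unfolding loclin_def by (metis valence_val)
  note l = val_mline[OF x this]
  obtain m :: int where "\<forall>\<^sub>F s in nhds 0. fv f ((\<lambda>s. if 0 \<le> s then arm x 0 s else arm x 1 (- s)) s) = fv f x + of_int m * s"
    using loclin_line[OF lin germs_fin[OF g x] l] by (elim exE)
  then obtain e where e: "0 < e" "\<forall>s. \<bar>s\<bar> < e \<longrightarrow> fv f ((\<lambda>s. if 0 \<le> s then arm x 0 s else arm x 1 (- s)) s) = fv f x + of_int m * s"
    unfolding eventually_nhds_metric dist_real_def by auto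
  have "ord_at d I x f = m + (- m)"
  proof (rule ord_line[OF g l e(1)]; intro allI impI)
    fix s assume "0 < s" "s < e"
    then show "fv f (if 0 \<le> s then arm x 0 s else arm x 1 (- s)) = fv f x + of_int m * s"
      "fv f (if 0 \<le> - s then arm x 0 (- s) else arm x 1 (- (- s))) = fv f x + of_int (- m) * s"
      using e(2)[rule_format, of s] e(2)[rule_format, of "-s"] by simp_all
  qed
  then show ?thesis by simp
qed

lemma finite_ord: assumes "germs f" shows "finite {x. ord_at d I x f \<noteq> 0}"
proof -
  have "pw_linear d I f" using germs_imp_rational[OF assms] by (simp add: rational_function_def)
  then obtain B where B: "finite B" "I \<subseteq> B" "\<forall>x. x \<notin> B \<longrightarrow> loclin f x" unfolding pw_linear_loclin by (elim exE conjE)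
  have "{x. ord_at d I x f \<noteq> 0} \<subseteq> B" using B loclin_ord[OF assms] by blast
  then show ?thesis using B(1) by (rule finite_subset)
qed

lemma germs_tendsto: "germs f \<Longrightarrow> (g \<longlongrightarrow> x) F \<Longrightarrow> ((\<lambda>t. f (g t)) \<longlongrightarrow> f x) F"
  using isCont_tendsto_compose[OF germs_continuous] .

end

section \<open>Functions along darts\<close>

context model
begin

definition dsl :: "('a \<Rightarrow> ereal) \<Rightarrow> 'a \<times> nat \<Rightarrow> int" where
  "dsl f \<delta> = sl f (fst \<delta>) (snd \<delta>)"

text \<open>The formula includes the parameter \<open>a\<close>, which may itself be a break point:
  there it follows by continuity from the left.\<close>

lemma dart_affine:
  assumes g: "germs f" and \<delta>: "\<delta> \<in> darts" and a: "a \<in> dom \<delta>"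
    and o: "\<And>t. 0 < t \<Longrightarrow> t < a \<Longrightarrow> ord_at d I (path \<delta> t) f = 0"
    and t: "0 < t" "t \<le> a"
  shows "fv f (path \<delta> t) = fv f (fst \<delta>) + of_int (dsl f \<delta>) * t"
proof -
  note v = dartsD[OF \<delta>]
  have a0: "0 < a" by (rule dom_pos[OF a])
  have sub: "{0<..<a} \<subseteq> dom \<delta>" using dom_down[OF a] by auto
  have G: "geo {0<..<a} (path \<delta>)" by (rule geo_subset[OF geo_path]) (use sub in auto)
  have "\<exists>m::int. \<forall>s\<in>{0<..<a}. \<forall>t\<in>{0<..<a}. fv f (path \<delta> t) = fv f (path \<delta> s) + of_int m * (t - s)"
    by (rule ord_zero_affine[OF g G is_interval_oo]) (use o in auto)
  then obtain m :: int where m: "\<And>s t. s \<in> {0<..<a} \<Longrightarrow> t \<in> {0<..<a} \<Longrightarrow>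
      fv f (path \<delta> t) = fv f (path \<delta> s) + of_int m * (t - s)" by blast
  obtain e1 where e1: "0 < e1" "e1 \<le> rad (fst \<delta>)" "\<forall>t. 0 < t \<longrightarrow> t < e1 \<longrightarrow> t \<in> dom \<delta>"
    "\<forall>t. 0 < t \<longrightarrow> t < e1 \<longrightarrow> path \<delta> t = arm (fst \<delta>) (snd \<delta>) t"
    "\<forall>t. 0 < t \<longrightarrow> t < e1 \<longrightarrow> d (fst \<delta>) (path \<delta> t) = t" by (rule path_start[OF \<delta>])
  obtain e2 where e2: "0 < e2" "e2 \<le> rad (fst \<delta>)"
    "\<forall>t. 0 \<le> t \<longrightarrow> t < e2 \<longrightarrow> fv f (arm (fst \<delta>) (snd \<delta>) t) = fv f (fst \<delta>) + of_int (dsl f \<delta>) * t"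
    using slope_fv[OF g v(2,3)] unfolding dsl_def by metis
  have near: "fv f (path \<delta> t) = fv f (fst \<delta>) + of_int (dsl f \<delta>) * t" if "0 < t" "t < min e1 e2" for t
    using e1(4) e2(3) that by simp
  \<comment> \<open>Two points close to the vertex identify the slope \<open>m\<close>, found in the
    interior, with the slope of the arm.\<close>
  define s where "s = min (min e1 e2) a / 2"
  have s: "0 < s" "s < min e1 e2" "s \<in> {0<..<a}" using e1(1) e2(1) a0 by (auto simp: s_def)
  have s2: "0 < s / 2" "s / 2 < min e1 e2" "s / 2 \<in> {0<..<a}" using s by auto
  have "fv f (path \<delta> s) - fv f (path \<delta> (s/2)) = of_int m * (s / 2)" using m[OF s2(3) s(3)] by simp
  moreover have "fv f (path \<delta> s) - fv f (path \<delta> (s/2)) = of_int (dsl f \<delta>) * (s / 2)"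
    unfolding near[OF s(1,2)] near[OF s2(1,2)] by simp
  ultimately have "of_int (dsl f \<delta>) * (s / 2) = of_int m * (s / 2)" by simp
  then have "real_of_int (dsl f \<delta>) = of_int m" using s(1) by simp
  then have inner: "fv f (path \<delta> t) = fv f (fst \<delta>) + of_int (dsl f \<delta>) * t" if "t \<in> {0<..<a}" for t
    using m[OF s(3) that] near[OF s(1,2)] by (simp add: algebra_simps)
  show ?thesis
  proof (cases "t = a")
    case True
    have cont: "isCont (path \<delta>) a"
      using geo_continuous[OF geo_path] a open_dom continuous_on_eq_continuous_at by blast
    have "(path \<delta> \<longlongrightarrow> path \<delta> a) (at_left a)"
      using cont unfolding isCont_def filterlim_at_split by simp
    then have "((\<lambda>t. f (path \<delta> t)) \<longlongrightarrow> f (path \<delta> a)) (at_left a)" by (rule germs_tendsto[OF g])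
    moreover have "((\<lambda>t. f (path \<delta> t)) \<longlongrightarrow> ereal (fv f (fst \<delta>) + of_int (dsl f \<delta>) * a)) (at_left a)"
    proof (rule Lim_transform_eventually)
      show "((\<lambda>t. ereal (fv f (fst \<delta>) + of_int (dsl f \<delta>) * t)) \<longlongrightarrow> ereal (fv f (fst \<delta>) + of_int (dsl f \<delta>) * a)) (at_left a)"
        by (intro tendsto_intros)
      have "\<forall>\<^sub>F t in at_left a. t \<in> {0<..<a}" by (rule eventually_at_leftI[of 0]) (use a0 in auto)
      then show "\<forall>\<^sub>F t in at_left a. ereal (fv f (fst \<delta>) + of_int (dsl f \<delta>) * t) = f (path \<delta> t)"
      proof eventually_elim
        case (elim t)
        then have "f (path \<delta> t) = ereal (fv f (path \<delta> t))"
          using germs_finite[OF g] path_notin_I sub by blast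
        then show ?case using inner[OF elim] by simp
      qed
    qed
    ultimately have "f (path \<delta> a) = ereal (fv f (fst \<delta>) + of_int (dsl f \<delta>) * a)"
      using tendsto_unique[OF trivial_limit_at_left_real] by blast
    then show ?thesis using True by simp
  qed (use inner t in auto)
qed

definition flat :: "('a \<Rightarrow> ereal) \<Rightarrow> 'a \<times> nat \<Rightarrow> bool" where
  "flat f \<delta> \<longleftrightarrow> (\<forall>t\<in>dom \<delta>. ord_at d I (path \<delta> t) f = 0)"

lemma flat_affine:
  assumes "germs f" "\<delta> \<in> darts" "flat f \<delta>" "t \<in> dom \<delta>"
  shows "fv f (path \<delta> t) = fv f (fst \<delta>) + of_int (dsl f \<delta>) * t"
  using dart_affine[OF assms(1,2,4), of t] assms(3) dom_down[OF assms(4)] dom_pos[OF assms(4)]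
  by (simp add: flat_def)

lemma flat_rev: "\<delta> \<in> darts \<Longrightarrow> \<not> unbounded \<delta> \<Longrightarrow> flat f \<delta> \<Longrightarrow> flat f (rev \<delta>)"
proof -
  assume \<delta>: "\<delta> \<in> darts" "\<not> unbounded \<delta>" and f: "flat f \<delta>"
  note b = bounded[OF \<delta>]
  show "flat f (rev \<delta>)"
    unfolding flat_def
  proof
    fix t assume "t \<in> dom (rev \<delta>)"
    then have t: "0 < len \<delta> - t" "len \<delta> - t < len \<delta>" using b(5) by auto
    have "path \<delta> (len \<delta> - t) = path (rev \<delta>) t" using b(6)[OF t] by simp
    moreover have "len \<delta> - t \<in> dom \<delta>" unfolding b(2) using t by simp
    ultimately show "ord_at d I (path (rev \<delta>) t) f = 0" using f unfolding flat_def by metis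
  qed
qed

text \<open>The affine formulas from the two ends hold along the whole edge; comparing them at one
  half and at one quarter of the length determines slope and value at the far end.\<close>

lemma flat_bounded:
  assumes g: "germs f" and \<delta>: "\<delta> \<in> darts" "\<not> unbounded \<delta>" and f: "flat f \<delta>"
  shows "dsl f (rev \<delta>) = - dsl f \<delta>" "fv f (fst (rev \<delta>)) = fv f (fst \<delta>) + of_int (dsl f \<delta>) * len \<delta>"
proof -
  note b = bounded[OF \<delta>]
  have eq: "fv f (fst \<delta>) + of_int (dsl f \<delta>) * w = fv f (fst (rev \<delta>)) + of_int (dsl f (rev \<delta>)) * (len \<delta> - w)"
    if w: "0 < w" "w < len \<delta>" for w
  proof -
    have "w \<in> dom \<delta>" "len \<delta> - w \<in> dom (rev \<delta>)" using w b(2,5) by auto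
    then show ?thesis using flat_affine[OF g \<delta>(1) f] flat_affine[OF g b(3) flat_rev[OF \<delta> f]] b(6)[OF w] by metis
  qed
  define L where "L = len \<delta>"
  have L: "0 < L" using b(1) by (simp add: L_def)
  have e1: "fv f (fst \<delta>) + of_int (dsl f \<delta>) * (L/2) = fv f (fst (rev \<delta>)) + of_int (dsl f (rev \<delta>)) * (L/2)"
    using eq[of "L/2"] L by (simp add: L_def)
  have e2: "fv f (fst \<delta>) + of_int (dsl f \<delta>) * (L/4) = fv f (fst (rev \<delta>)) + of_int (dsl f (rev \<delta>)) * (3*L/4)"
    using eq[of "L/4"] L by (simp add: L_def)
  have "(of_int (dsl f \<delta>) + of_int (dsl f (rev \<delta>))) * L = (0::real)"
    using e1 e2 by (simp add: algebra_simps)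
  then have z: "real_of_int (dsl f \<delta>) + of_int (dsl f (rev \<delta>)) = 0" using L by simp
  then show "dsl f (rev \<delta>) = - dsl f \<delta>" by linarith
  then show "fv f (fst (rev \<delta>)) = fv f (fst \<delta>) + of_int (dsl f \<delta>) * len \<delta>"
    using e1 by (simp add: L_def algebra_simps)
qed

lemma flat_unbounded:
  assumes g: "germs f" and \<delta>: "\<delta> \<in> darts" "unbounded \<delta>" and f: "flat f \<delta>"
  shows "ord_at d I (tip \<delta>) f = - dsl f \<delta>" "f (tip \<delta>) = endval (fv f (fst \<delta>)) (- dsl f \<delta>)"
proof -
  have dom: "w \<in> dom \<delta>" if "0 < w" for w using \<delta>(2) that by (simp add: unbounded_def)
  have fp: "f (path \<delta> w) = ereal (fv f (fst \<delta>) - of_int (- dsl f \<delta>) * w)" if "0 < w" for w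
    using flat_affine[OF g \<delta>(1) f dom[OF that]] germs_finite[OF g path_notin_I[OF dom[OF that]]] by simp
  obtain c T where cT: "0 \<le> T" "0 \<le> T + c" "\<forall>w>T. path \<delta> w = tail (tip \<delta>) (w + c)" using tip(2)[OF \<delta>] by blast
  show "ord_at d I (tip \<delta>) f = - dsl f \<delta>"
  proof (rule ord_at_end[OF tip(1)[OF \<delta>], of f "fv f (fst \<delta>) + of_int (- dsl f \<delta>) * c"])
    have "f (tail (tip \<delta>) t) = ereal (fv f (fst \<delta>) + of_int (- dsl f \<delta>) * c - of_int (- dsl f \<delta>) * t)" if "T + c < t" for t
      using cT(3)[rule_format, of "t - c"] fp[of "t - c"] that cT(1) by (simp add: algebra_simps)
    then show "\<forall>\<^sub>F t in at_top. f (tail (tip \<delta>) t) = ereal (fv f (fst \<delta>) + of_int (- dsl f \<delta>) * c - of_int (- dsl f \<delta>) * t)"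
      by (rule eventually_mono[OF eventually_gt_at_top])
  qed
  have "((\<lambda>t. f (path \<delta> t)) \<longlongrightarrow> f (tip \<delta>)) at_top" by (rule germs_tendsto[OF g tip_limit[OF \<delta>]])
  moreover have "((\<lambda>t. f (path \<delta> t)) \<longlongrightarrow> endval (fv f (fst \<delta>)) (- dsl f \<delta>)) at_top"
  proof (rule Lim_transform_eventually[OF endval_limit])
    show "\<forall>\<^sub>F t in at_top. ereal (fv f (fst \<delta>) - of_int (- dsl f \<delta>) * t) = f (path \<delta> t)"
      using fp by (intro eventually_mono[OF eventually_gt_at_top[of 0]]) simp
  qed
  ultimately show "f (tip \<delta>) = endval (fv f (fst \<delta>)) (- dsl f \<delta>)"
    using tendsto_unique[OF trivial_limit_at_top_linorder] by blast
qed

lemma tgt_in_B: "\<delta> \<in> darts \<Longrightarrow> tgt \<delta> \<in> B"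
  using tip(1)[of \<delta>] bounded(3)[of \<delta>] dartsD(1)[of "rev \<delta>"] I_B by (cases "unbounded \<delta>") (auto simp: tgt_def)

text \<open>This translates slopes into membership in superlevel sets. It includes targets at
  infinity, where the value is infinite unless the slope is 0.\<close>

lemma flat_increase:
  assumes g: "germs f" and \<delta>: "\<delta> \<in> darts" and f: "flat f \<delta>"
  shows "f (fst \<delta>) < f (tgt \<delta>) \<longleftrightarrow> 0 < dsl f \<delta>" "f (tgt \<delta>) < f (fst \<delta>) \<longleftrightarrow> dsl f \<delta> < 0"
proof -
  have fs: "f (fst \<delta>) = ereal (fv f (fst \<delta>))" using germs_finite[OF g] dartsD(2)[OF \<delta>] by blast
  have "(f (fst \<delta>) < f (tgt \<delta>) \<longleftrightarrow> 0 < dsl f \<delta>) \<and> (f (tgt \<delta>) < f (fst \<delta>) \<longleftrightarrow> dsl f \<delta> < 0)"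
  proof (cases "unbounded \<delta>")
    case True
    have "f (tgt \<delta>) = endval (fv f (fst \<delta>)) (- dsl f \<delta>)" using flat_unbounded(2)[OF g \<delta> True f] True by (simp add: tgt_def)
    then show ?thesis by (subst (1 2) fs) (auto simp: endval_def)
  next
    case False
    note b = bounded[OF \<delta> False]
    have "f (tgt \<delta>) = ereal (fv f (fst \<delta>) + of_int (dsl f \<delta>) * len \<delta>)"
      using germs_finite[OF g dartsD(2)[OF b(3)]] flat_bounded(2)[OF g \<delta> False f] False by (simp add: tgt_def)
    then show ?thesis using b(1) by (subst (1 2) fs) (auto simp: zero_less_mult_iff mult_less_0_iff)
  qed
  then show "f (fst \<delta>) < f (tgt \<delta>) \<longleftrightarrow> 0 < dsl f \<delta>" "f (tgt \<delta>) < f (fst \<delta>) \<longleftrightarrow> dsl f \<delta> < 0" by auto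
qed

text \<open>Flow conservation: summing the orders over the superlevel set \<open>W\<close>, the slopes of darts inside
  \<open>W\<close> cancel and every dart leaving \<open>W\<close> contributes a negative slope.\<close>

lemma descending_slope_bound:
  assumes g: "germs f" and fl: "\<And>\<delta>. \<delta> \<in> darts \<Longrightarrow> flat f \<delta>"
    and D: "finite (supp D)" "\<And>x. 0 \<le> D x + ord_at d I x f"
    and \<delta>0: "\<delta>0 \<in> darts" "dsl f \<delta>0 < 0"
  shows "- dsl f \<delta>0 \<le> (\<Sum>x\<in>supp D. \<bar>D x\<bar>)"
proof -
  \<comment> \<open>The strict superlevel set at the lower end of \<open>\<delta>0\<close>, so that
    \<open>\<delta>0\<close> starts in \<open>W\<close> and ends outside.\<close>
  define W where "W = {w\<in>B. f (tgt \<delta>0) < f w}"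
  have W: "finite W" "W \<subseteq> B" using finite_B by (auto simp: W_def)
  define dd where "dd P = (\<Sum>\<delta>\<in>{\<delta>\<in>darts. P \<delta>}. dsl f \<delta>)" for P
  have inner: "(\<Sum>w\<in>W - I. ord_at d I w f) = (\<Sum>\<delta>\<in>{\<delta>\<in>darts. fst \<delta> \<in> W}. dsl f \<delta>)"
  proof -
    have "(\<Sum>w\<in>W - I. ord_at d I w f) = (\<Sum>w\<in>W - I. \<Sum>i<val w. sl f w i)"
      by (intro sum.cong refl ord_at_finite[OF g]) auto
    also have "\<dots> = (\<Sum>(w, i)\<in>(SIGMA w:W - I. {..<val w}). sl f w i)"
      using W by (intro sum.Sigma) auto
    also have "\<dots> = (\<Sum>\<delta>\<in>{\<delta>\<in>darts. fst \<delta> \<in> W}. dsl f \<delta>)"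
      by (rule sum.cong) (use W in \<open>auto simp: darts_def dsl_def\<close>)
    finally show ?thesis .
  qed
  have ends: "(\<Sum>w\<in>W \<inter> I. ord_at d I w f) = (\<Sum>\<delta>\<in>{\<delta>\<in>darts. unbounded \<delta> \<and> tgt \<delta> \<in> W}. - dsl f \<delta>)"
  proof (rule sum.reindex_cong[of tip])
    show "inj_on tip {\<delta>\<in>darts. unbounded \<delta> \<and> tgt \<delta> \<in> W}" by (rule inj_onI, rule tip_inj) auto
    show "W \<inter> I = tip ` {\<delta>\<in>darts. unbounded \<delta> \<and> tgt \<delta> \<in> W}"
    proof (intro equalityI subsetI)
      fix p assume p: "p \<in> W \<inter> I"
      then have "p \<in> I" by simp
      then obtain \<delta> where "\<delta> \<in> darts" "unbounded \<delta>" "tip \<delta> = p" by (rule tip_surj)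
      then show "p \<in> tip ` {\<delta>\<in>darts. unbounded \<delta> \<and> tgt \<delta> \<in> W}" using p by (force simp: tgt_def)
    next
      fix p assume "p \<in> tip ` {\<delta>\<in>darts. unbounded \<delta> \<and> tgt \<delta> \<in> W}"
      then show "p \<in> W \<inter> I" using tip(1) by (auto simp: tgt_def)
    qed
    show "ord_at d I (tip \<delta>) f = - dsl f \<delta>" if "\<delta> \<in> {\<delta>\<in>darts. unbounded \<delta> \<and> tgt \<delta> \<in> W}" for \<delta>
      using flat_unbounded(1)[OF g _ _ fl] that by auto
  qed
  let ?C = "{\<delta>\<in>darts. \<not> unbounded \<delta> \<and> fst \<delta> \<in> W \<and> tgt \<delta> \<in> W}"
  have "(\<Sum>\<delta>\<in>?C. dsl f \<delta>) = (\<Sum>\<delta>\<in>?C. - dsl f \<delta>)"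
  proof (rule sum.reindex_bij_witness[of _ rev rev])
    fix \<delta> assume "\<delta> \<in> ?C"
    then have \<delta>: "\<delta> \<in> darts" "\<not> unbounded \<delta>" "fst \<delta> \<in> W" "tgt \<delta> \<in> W" by auto
    note b = bounded[OF \<delta>(1,2)]
    show "rev (rev \<delta>) = \<delta>" "rev (rev \<delta>) = \<delta>" by (rule b(9))+
    show "rev \<delta> \<in> ?C" "rev \<delta> \<in> ?C" using b(3,8,9) \<delta> by (auto simp: tgt_def)
    show "- dsl f (rev \<delta>) = dsl f \<delta>" using flat_bounded(1)[OF g \<delta>(1,2) fl[OF \<delta>(1)]] by simp
  qed
  then have C0: "(\<Sum>\<delta>\<in>?C. dsl f \<delta>) = 0" by (simp add: sum_negf)
  \<comment> \<open>The net contribution of a dart to the sum of orders over \<open>W\<close>. The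
    last term, whose total is 0 by reversal, cancels the bounded darts inside \<open>W\<close>; what
    remains of each dart is at most 0.\<close>
  define w where "w \<delta> = (if fst \<delta> \<in> W then dsl f \<delta> else 0) - (if unbounded \<delta> \<and> tgt \<delta> \<in> W then dsl f \<delta> else 0)
      - (if \<not> unbounded \<delta> \<and> fst \<delta> \<in> W \<and> tgt \<delta> \<in> W then dsl f \<delta> else 0)" for \<delta>
  have "(\<Sum>w\<in>W. ord_at d I w f) = (\<Sum>w\<in>W - I. ord_at d I w f) + (\<Sum>w\<in>W \<inter> I. ord_at d I w f)"
    using W(1) by (metis Int_commute add.commute sum.Int_Diff)
  also have "\<dots> = (\<Sum>\<delta>\<in>darts. w \<delta>)"
    unfolding inner ends w_def sum_subtractf using C0 finite_darts
    by (simp add: sum_negf sum.inter_filter[symmetric] Int_def)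
  finally have S: "(\<Sum>w\<in>W. ord_at d I w f) = (\<Sum>\<delta>\<in>darts. w \<delta>)" .
  have w_le: "w \<delta> \<le> 0" if \<delta>: "\<delta> \<in> darts" for \<delta>
  proof -
    note inc = flat_increase[OF g \<delta> fl[OF \<delta>]]
    have fB: "fst \<delta> \<in> B" "tgt \<delta> \<in> B" using dartsD(1)[OF \<delta>] tgt_in_B[OF \<delta>] by auto
    consider "fst \<delta> \<in> W" "tgt \<delta> \<in> W" | "fst \<delta> \<in> W" "tgt \<delta> \<notin> W" | "fst \<delta> \<notin> W" "tgt \<delta> \<in> W" | "fst \<delta> \<notin> W" "tgt \<delta> \<notin> W"
      by blast
    then show ?thesis
    proof cases
      case 2
      then have "f (tgt \<delta>) < f (fst \<delta>)" using fB by (auto simp: W_def intro: le_less_trans)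
      then show ?thesis using 2 inc(2) by (simp add: w_def)
    next
      case 3
      then have "f (fst \<delta>) < f (tgt \<delta>)" using fB by (auto simp: W_def intro: le_less_trans)
      then show ?thesis using 3 inc(1) by (simp add: w_def)
    qed (auto simp: w_def)
  qed
  have src: "fst \<delta>0 \<in> W" "tgt \<delta>0 \<notin> W"
    using dartsD(1)[OF \<delta>0(1)] flat_increase(2)[OF g \<delta>0(1) fl[OF \<delta>0(1)]] \<delta>0(2) by (auto simp: W_def)
  have "(\<Sum>\<delta>\<in>darts. w \<delta>) = w \<delta>0 + (\<Sum>\<delta>\<in>darts - {\<delta>0}. w \<delta>)" using finite_darts \<delta>0(1) by (rule sum.remove)
  also have "(\<Sum>\<delta>\<in>darts - {\<delta>0}. w \<delta>) \<le> 0" by (rule sum_nonpos) (use w_le in auto)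
  finally have "(\<Sum>\<delta>\<in>darts. w \<delta>) \<le> w \<delta>0" by simp
  also have "\<dots> = dsl f \<delta>0" using src by (simp add: w_def)
  finally have "- dsl f \<delta>0 \<le> - (\<Sum>w\<in>W. ord_at d I w f)" using S by simp
  \<comment> \<open>Effectivity bounds each negated order by the coefficient of
    \<open>D\<close>.\<close>
  also have "\<dots> \<le> (\<Sum>w\<in>W. D w)"
    unfolding sum_negf[symmetric]   proof (rule sum_mono)
    show "- ord_at d I x f \<le> D x" for x using D(2)[of x] by simp
  qed
  also have "\<dots> \<le> (\<Sum>w\<in>W. \<bar>D w\<bar>)" by (rule sum_mono) simp
  also have "\<dots> = (\<Sum>w\<in>W \<inter> supp D. \<bar>D w\<bar>)"
    using W(1) by (intro sum.mono_neutral_right) (auto simp: supp_def)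
  also have "\<dots> \<le> (\<Sum>x\<in>supp D. \<bar>D x\<bar>)" using D(1) by (intro sum_mono2) auto
  finally show ?thesis .
qed

end

context trop_curve
begin

lemma model_exists: "finite N \<Longrightarrow> x \<notin> I \<Longrightarrow> model d I (I \<union> {y. y \<notin> I \<and> val y \<noteq> 2} \<union> insert x N)"
  using finite_I finite_branch_points by unfold_locales auto

text \<open>All break points of \<open>f\<close> and \<open>x\<close> itself are made vertices, so
  that every dart is flat and the slope at \<open>x\<close> belongs to a dart. A positive slope is
  negative when seen from the other end of a bounded edge; on an unbounded one it is a negative
  order at the end, which \<open>D\<close> has to compensate.\<close>

lemma slope_bound:
  assumes f: "f \<in> Rset d I D" and D: "divisor D" and x: "x \<notin> I" "i < val x"
  shows "\<bar>sl f x i\<bar> \<le> (\<Sum>x\<in>supp D. \<bar>D x\<bar>)"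
proof -
  have g: "germs f" using f by (simp add: Rset_def rational_iff_germs)
  have eff: "0 \<le> D y + ord_at d I y f" for y
    using f by (simp add: Rset_def effective_def div_add_def princ_div_def)
  have fD: "finite (supp D)" using D by (simp add: divisor_def)
  interpret m: model d I "I \<union> {y. y \<notin> I \<and> val y \<noteq> 2} \<union> insert x {y. ord_at d I y f \<noteq> 0}"
    using model_exists[OF finite_ord[OF g] x(1)] .
  have fl: "m.flat f \<delta>" for \<delta>
    unfolding m.flat_def using m.path_notin_B by blast
  note bound = m.descending_slope_bound[OF g fl fD eff]
  define \<delta> where "\<delta> = (x, i)"
  have \<delta>: "\<delta> \<in> m.darts" unfolding m.darts_def \<delta>_def using x by simp
  have s: "sl f x i = m.dsl f \<delta>" by (simp add: m.dsl_def \<delta>_def)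
  have K: "0 \<le> (\<Sum>x\<in>supp D. \<bar>D x\<bar>)" by (rule sum_nonneg) simp
  consider "m.dsl f \<delta> < 0" | "m.dsl f \<delta> = 0" | "0 < m.dsl f \<delta>" "m.unbounded \<delta>" | "0 < m.dsl f \<delta>" "\<not> m.unbounded \<delta>"
    by linarith
  then show ?thesis
  proof cases
    case 1 then show ?thesis using bound[OF \<delta>] s by simp
  next
    case 2 then show ?thesis using s K by simp
  next
    case 3
    have o: "ord_at d I (m.tip \<delta>) f = - m.dsl f \<delta>" by (rule m.flat_unbounded(1)[OF g \<delta> 3(2) fl])
    then have le: "m.dsl f \<delta> \<le> D (m.tip \<delta>)" using eff[of "m.tip \<delta>"] by simp
    then have "m.tip \<delta> \<in> supp D" using 3(1) by (auto simp: supp_def)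
    then have "\<bar>D (m.tip \<delta>)\<bar> \<le> (\<Sum>x\<in>supp D. \<bar>D x\<bar>)" using fD by (intro member_le_sum) auto
    then show ?thesis using le s 3(1) by simp
  next
    case 4
    note b = m.bounded[OF \<delta> 4(2)]
    have r: "m.dsl f (m.rev \<delta>) = - m.dsl f \<delta>" by (rule m.flat_bounded(1)[OF g \<delta> 4(2) fl])
    then show ?thesis using bound[OF b(3)] s 4(1) by simp
  qed
qed

end

section \<open>Finiteness modulo scaling\<close>

text \<open>A neighbourhood of the limit \<open>p\<close> contains all but a compact initial piece
  of the ray.\<close>

lemma compact_ray:
  fixes \<phi> :: "real \<Rightarrow> 'a::t2_space"
  assumes cont: "continuous_on {a..} \<phi>" and lim: "(\<phi> \<longlongrightarrow> p) at_top"
  shows "compact (insert p (\<phi> ` {a..}))"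
proof (rule compactI)
  fix C assume C: "\<forall>c\<in>C. open c" "insert p (\<phi> ` {a..}) \<subseteq> \<Union>C"
  then obtain U where U: "U \<in> C" "p \<in> U" by blast
  then have "\<forall>\<^sub>F t in at_top. \<phi> t \<in> U" using C(1) by (intro topological_tendstoD[OF lim]) auto
  then obtain T where T: "\<forall>t\<ge>T. \<phi> t \<in> U" by (auto simp: eventually_at_top_linorder)
  have "compact (\<phi> ` {a..max a T})"
    by (intro compact_continuous_image continuous_on_subset[OF cont]) auto
  moreover have "\<phi> ` {a..max a T} \<subseteq> \<Union>C" using C(2) by auto
  ultimately obtain C' where C': "C' \<subseteq> C" "finite C'" "\<phi> ` {a..max a T} \<subseteq> \<Union>C'"
    using C(1) by (meson compactE)
  have "insert p (\<phi> ` {a..}) \<subseteq> \<Union>(insert U C')"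
  proof
    fix x assume "x \<in> insert p (\<phi> ` {a..})"
    then consider "x = p" | t where "t \<ge> a" "x = \<phi> t" by auto
    then show "x \<in> \<Union>(insert U C')"
    proof cases
      case 2
      show ?thesis
      proof (cases "t \<ge> T")
        case False
        then have "x \<in> \<phi> ` {a..max a T}" using 2 by auto
        then show ?thesis using C'(3) by blast
      qed (use 2 T in auto)
    qed (use U in auto)
  qed
  then show "\<exists>C'\<subseteq>C. finite C' \<and> insert p (\<phi> ` {a..}) \<subseteq> \<Union>C'"
    using C' U by (intro exI[of _ "insert U C'"]) auto
qed

context model
begin

lemma B_notin_path:
  assumes "x \<in> B" "K \<subseteq> dom \<delta>"
  shows "x \<notin> path \<delta> ` K"
proof
  assume "x \<in> path \<delta> ` K"
  then obtain t where "t \<in> K" "x = path \<delta> t" by (elim imageE)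
  then show False using assms path_notin_B[of t \<delta>] by auto
qed

lemma open_path_image: "K \<subseteq> dom \<delta> \<Longrightarrow> open K \<Longrightarrow> open (path \<delta> ` K)"
  by (rule geo_open_image[OF geo_subset[OF geo_path]])

lemma open_path_end:
  assumes \<delta>: "\<delta> \<in> darts" "unbounded \<delta>" and t: "0 \<le> t"
  shows "open (insert (tip \<delta>) (path \<delta> ` {t<..}))"
proof -
  obtain c T where cT: "0 \<le> T" "0 \<le> T + c" "\<forall>w>T. path \<delta> w = tail (tip \<delta>) (w + c)" using tip(2)[OF \<delta>] by blast
  define T' where "T' = max T t"
  have "open (path \<delta> ` {t<..})"
    by (rule open_path_image) (use \<delta>(2) t in \<open>auto simp: unbounded_def\<close>)
  moreover have "open (insert (tip \<delta>) (tail (tip \<delta>) ` {T' + c<..}))"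
    using tailD(3)[OF tip(1)[OF \<delta>]] cT by (auto simp: T'_def)
  moreover have "insert (tip \<delta>) (path \<delta> ` {t<..}) = path \<delta> ` {t<..} \<union> insert (tip \<delta>) (tail (tip \<delta>) ` {T' + c<..})"
  proof -
    have "tail (tip \<delta>) u \<in> path \<delta> ` {t<..}" if "T' + c < u" for u
    proof -
      have "path \<delta> (u - c) = tail (tip \<delta>) u" "u - c > t" using cT(3)[rule_format, of "u - c"] that by (auto simp: T'_def)
      then show ?thesis by (metis greaterThan_iff imageI)
    qed
    then show ?thesis by auto
  qed
  ultimately show ?thesis by (metis open_Un)
qed

text \<open>The closed segment is compact, hence closed, and the open segment is open. So the two
  points separate the open segment from the start vertex.\<close>

lemma cut_set_two:
  assumes \<delta>: "\<delta> \<in> darts" and t: "t1 \<in> dom \<delta>" "t2 \<in> dom \<delta>" "t1 < t2"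
  shows "cut_set {path \<delta> t1, path \<delta> t2}"
proof -
  have sub: "{t1..t2} \<subseteq> dom \<delta>" using mem_is_interval_1_I[OF dom_interval t(1,2)] by auto
  define U where "U = path \<delta> ` {t1<..<t2}"
  define V where "V = - (path \<delta> ` {t1..t2})"
  have U: "open U" unfolding U_def by (rule open_path_image) (use sub in auto)
  have "compact (path \<delta> ` {t1..t2})"
    by (intro compact_continuous_image continuous_on_subset[OF geo_continuous[OF geo_path] sub]) simp
  then have V: "open V" unfolding V_def by (simp add: compact_imp_closed open_Compl)
  have dis: "U \<inter> V \<inter> (UNIV - {path \<delta> t1, path \<delta> t2}) = {}" unfolding U_def V_def by auto
  have cov: "UNIV - {path \<delta> t1, path \<delta> t2} \<subseteq> U \<union> V"
  proof
    fix x assume x: "x \<in> UNIV - {path \<delta> t1, path \<delta> t2}"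
    show "x \<in> U \<union> V"
    proof (cases "x \<in> path \<delta> ` {t1..t2}")
      case True
      then obtain t where "t1 \<le> t" "t \<le> t2" "x = path \<delta> t" by auto
      then show ?thesis using x unfolding U_def by (cases "t = t1 \<or> t = t2") auto
    qed (simp add: V_def)
  qed
  define m where "m = (t1 + t2) / 2"
  have m: "m \<in> {t1<..<t2}" "m \<in> dom \<delta>" using t(3) sub by (auto simp: m_def)
  then have "path \<delta> m \<notin> {path \<delta> t1, path \<delta> t2}" using path_inj[OF \<delta> m(2)] t by auto
  then have "path \<delta> m \<in> U \<inter> (UNIV - {path \<delta> t1, path \<delta> t2})" using m unfolding U_def by simp
  then have "U \<inter> (UNIV - {path \<delta> t1, path \<delta> t2}) \<noteq> {}" by (metis empty_iff)
  moreover have "fst \<delta> \<notin> path \<delta> ` {t1..t2}" by (rule B_notin_path[OF dartsD(1)[OF \<delta>] sub])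
  then have "fst \<delta> \<in> V \<inter> (UNIV - {path \<delta> t1, path \<delta> t2})"
    using t(3) unfolding V_def by auto
  then have "V \<inter> (UNIV - {path \<delta> t1, path \<delta> t2}) \<noteq> {}" by (metis empty_iff)
  ultimately show ?thesis unfolding cut_set_def using connectedD[OF _ U V dis cov] by (rule_tac notI) simp
qed

text \<open>The part of the edge beyond the point, together with the end, is separated from the
  start vertex. So a single chip inside an unbounded edge already supports a smooth cut set.\<close>

lemma cut_set_one:
  assumes \<delta>: "\<delta> \<in> darts" "unbounded \<delta>" and t: "t \<in> dom \<delta>"
  shows "cut_set {path \<delta> t}"
proof -
  have t0: "0 < t" by (rule dom_pos[OF t])
  have sub: "{t..} \<subseteq> dom \<delta>" unfolding \<delta>(2)[unfolded unbounded_def] using t0 by auto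
  define U where "U = insert (tip \<delta>) (path \<delta> ` {t<..})"
  define V where "V = - insert (tip \<delta>) (path \<delta> ` {t..})"
  have U: "open U" unfolding U_def by (rule open_path_end[OF \<delta>]) (use t0 in simp)
  have "compact (insert (tip \<delta>) (path \<delta> ` {t..}))"
    by (rule compact_ray[OF continuous_on_subset[OF geo_continuous[OF geo_path] sub] tip_limit[OF \<delta>]])
  then have V: "open V" unfolding V_def by (intro open_Compl compact_imp_closed)
  have dis: "U \<inter> V \<inter> (UNIV - {path \<delta> t}) = {}" unfolding U_def V_def by auto
  have cov: "UNIV - {path \<delta> t} \<subseteq> U \<union> V"
  proof
    fix x assume x: "x \<in> UNIV - {path \<delta> t}"
    show "x \<in> U \<union> V"
    proof (cases "x \<in> path \<delta> ` {t..}")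
      case True
      then obtain u where "t \<le> u" "x = path \<delta> u" by auto
      then show ?thesis using x unfolding U_def by (cases "u = t") auto
    qed (auto simp: U_def V_def)
  qed
  have tI: "tip \<delta> \<in> I" by (rule tip(1)[OF \<delta>])
  then have "tip \<delta> \<in> U \<inter> (UNIV - {path \<delta> t})" using path_notin_I[OF t] unfolding U_def by auto
  then have "U \<inter> (UNIV - {path \<delta> t}) \<noteq> {}" by (metis empty_iff)
  moreover have "fst \<delta> \<notin> path \<delta> ` {t..}" by (rule B_notin_path[OF dartsD(1)[OF \<delta>(1)] sub])
  then have "fst \<delta> \<in> V \<inter> (UNIV - {path \<delta> t})"
    using dartsD(2)[OF \<delta>(1)] tI unfolding V_def by auto
  then have "V \<inter> (UNIV - {path \<delta> t}) \<noteq> {}" by (metis empty_iff)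
  ultimately show ?thesis unfolding cut_set_def using connectedD[OF _ U V dis cov] by (rule_tac notI) simp
qed

text \<open>Otherwise the neighbourhoods \<open>N Q\<close> and \<open>N (B - I - Q)\<close>, formed by the darts starting in the
  given set up to their first point in \<open>A\<close>, would separate \<open>UNIV - A\<close>.\<close>

lemma connecting_dart:
  assumes A: "finite A" "A \<inter> B = {}" "connected (UNIV - A)"
    and once: "\<And>\<delta> t u. \<delta> \<in> darts \<Longrightarrow> t \<in> dom \<delta> \<Longrightarrow> u \<in> dom \<delta> \<Longrightarrow> path \<delta> t \<in> A \<Longrightarrow> path \<delta> u \<in> A \<Longrightarrow> t = u"
    and none: "\<And>\<delta> t. \<delta> \<in> darts \<Longrightarrow> unbounded \<delta> \<Longrightarrow> t \<in> dom \<delta> \<Longrightarrow> path \<delta> t \<notin> A"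
    and Q: "Q \<subseteq> B - I" "Q \<noteq> {}" "Q \<noteq> B - I"
  shows "\<exists>\<delta>\<in>darts. \<not> unbounded \<delta> \<and> (\<forall>t\<in>dom \<delta>. path \<delta> t \<notin> A) \<and> fst \<delta> \<in> Q \<and> fst (rev \<delta>) \<notin> Q"
proof (rule ccontr)
  assume no: "\<not> ?thesis"
  \<comment> \<open>The part of a dart before its first point of \<open>A\<close>; it is the whole
    dart if there is none.\<close>
  define half where "half \<delta> = {t\<in>dom \<delta>. \<forall>u\<in>dom \<delta>. u \<le> t \<longrightarrow> path \<delta> u \<notin> A}" for \<delta>
  define N where "N R = R \<union> (\<Union>\<delta>\<in>{\<delta>\<in>darts. fst \<delta> \<in> R}. path \<delta> ` half \<delta>) \<union>
      tip ` {\<delta>\<in>darts. unbounded \<delta> \<and> fst \<delta> \<in> R}" for R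
  have half_none: "half \<delta> = dom \<delta>" if "\<forall>t\<in>dom \<delta>. path \<delta> t \<notin> A" for \<delta> using that unfolding half_def by blast
  have half_break: "half \<delta> = {0<..<t0}" if "\<delta> \<in> darts" "t0 \<in> dom \<delta>" "path \<delta> t0 \<in> A" for \<delta> t0
  proof (intro set_eqI iffI)
    fix t assume "t \<in> half \<delta>"
    then show "t \<in> {0<..<t0}" using that dom_pos[of t \<delta>] unfolding half_def by force
  next
    fix t assume t: "t \<in> {0<..<t0}"
    have "path \<delta> u \<notin> A" if "u \<in> dom \<delta>" "u \<le> t" for u
      using once[OF \<open>\<delta> \<in> darts\<close> that(1) \<open>t0 \<in> dom \<delta>\<close>] \<open>path \<delta> t0 \<in> A\<close> that t by auto
    then show "t \<in> half \<delta>" using dom_down[OF that(2), of t] t unfolding half_def by auto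
  qed
  have half_open: "open (half \<delta>)" if "\<delta> \<in> darts" for \<delta>
    using half_none[of \<delta>] half_break[OF that] open_dom[of \<delta>] by (cases "\<forall>t\<in>dom \<delta>. path \<delta> t \<notin> A") auto
  have half_sub: "half \<delta> \<subseteq> dom \<delta>" for \<delta> unfolding half_def by blast
  have open_N: "open (N R)" if R: "R \<subseteq> B - I" for R
  proof (subst open_subopen, intro ballI)
    fix y assume "y \<in> N R"
    then consider "y \<in> R" | \<delta> where "\<delta> \<in> darts" "fst \<delta> \<in> R" "y \<in> path \<delta> ` half \<delta>"
      | \<delta> where "\<delta> \<in> darts" "unbounded \<delta>" "fst \<delta> \<in> R" "y = tip \<delta>" unfolding N_def by blast
    then show "\<exists>T. open T \<and> y \<in> T \<and> T \<subseteq> N R"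
    proof cases
      case 1
      then have y: "y \<in> B" "y \<notin> I" using R by auto
      obtain e1 where e1: "0 < e1" "e1 \<le> rad y"
        "\<forall>i<val y. \<forall>t. 0 < t \<longrightarrow> t < e1 \<longrightarrow> t \<in> dom (y, i) \<and> path (y, i) t = arm y i t"
        by (rule arms_are_paths[OF y])
      obtain e2 where e2: "0 < e2" "e2 \<le> rad y" "\<forall>z. z \<notin> I \<longrightarrow> d y z < e2 \<longrightarrow> z \<noteq> y \<longrightarrow> z \<notin> A"
        "\<forall>i<val y. \<forall>t. 0 < t \<longrightarrow> t < e2 \<longrightarrow> arm y i t \<notin> A \<and> arm y i t \<noteq> y"
        by (rule arm_avoids[OF y(2) A(1)])
      define e where "e = min e1 e2"
      have e: "0 < e" "e \<le> e1" "e \<le> e2" using e1 e2 by (auto simp: e_def)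
      have "{z. z \<notin> I \<and> d y z < e} \<subseteq> N R"
      proof
        fix z assume z: "z \<in> {z. z \<notin> I \<and> d y z < e}"
        then obtain j r where j: "j < val y" "0 \<le> r" "r < rad y" "z = arm y j r"
          using mstarD(7)[OF star[OF y(2)], of z] e e1(2) by auto
        have r: "r < e" using mstar_dist0[OF star[OF y(2)] j(1-3)] j(4) z by simp
        show "z \<in> N R"
        proof (cases "r = 0")
          case True then show ?thesis using mstarD(4)[OF star[OF y(2)] j(1)] 1 j unfolding N_def by simp
        next
          case False
          then have r0: "0 < r" using j by simp
          have "path (y, j) u \<notin> A" if "u \<in> dom (y, j)" "u \<le> r" for u
          proof -
            have u: "0 < u" "u < e1" "u < e2" using dom_pos[OF that(1)] that(2) r e by auto
            then have "path (y, j) u = arm y j u" using e1(3) j(1) by blast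
            then show ?thesis using e2(4) j(1) u by simp
          qed
          moreover have "r \<in> dom (y, j)" "z = path (y, j) r" using e1(3) j r r0 e by auto
          ultimately have "z \<in> path (y, j) ` half (y, j)" unfolding half_def by blast
          moreover have "(y, j) \<in> darts" using y j by (auto simp: darts_def)
          ultimately show ?thesis using 1 unfolding N_def by force
        qed
      qed
      then show ?thesis using open_ball[OF y(2)] d_self[OF y(2)] y(2) e
        by (intro exI[of _ "{z. z \<notin> I \<and> d y z < e}"]) auto
    next
      case 2
      have "open (path \<delta> ` half \<delta>)" by (rule open_path_image[OF half_sub half_open[OF 2(1)]])
      then show ?thesis using 2 unfolding N_def by (intro exI[of _ "path \<delta> ` half \<delta>"]) blast
    next
      case 3
      have "half \<delta> = {0<..}" using half_none[of \<delta>] none[OF 3(1,2)] 3(2) by (simp add: unbounded_def)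
      then have "insert (tip \<delta>) (path \<delta> ` {0<..}) \<subseteq> N R" using 3 unfolding N_def by blast
      then show ?thesis using open_path_end[OF 3(1,2), of 0] 3(4)
        by (intro exI[of _ "insert (tip \<delta>) (path \<delta> ` {0<..})"]) simp
    qed
  qed
  let ?Q' = "B - I - Q"

  \<comment> \<open>A common point lies on a dart and on its reverse. If the edge avoids
    \<open>A\<close>, the negated conclusion keeps its far end in \<open>Q\<close>; otherwise the
    two halves lie on different sides of the point of \<open>A\<close>.\<close>
  have sep: "\<not> (path \<delta> t = path \<delta>' u)" if \<delta>: "\<delta> \<in> darts" "fst \<delta> \<in> Q" "t \<in> half \<delta>"
    and \<delta>': "\<delta>' \<in> darts" "fst \<delta>' \<in> ?Q'" "u \<in> half \<delta>'" for \<delta> \<delta>' t u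
  proof
    assume eq: "path \<delta> t = path \<delta>' u"
    have td: "t \<in> dom \<delta>" "u \<in> dom \<delta>'" by (rule subsetD[OF half_sub \<delta>(3)], rule subsetD[OF half_sub \<delta>'(3)])
    have "\<delta>' \<noteq> \<delta>" using \<delta>(2) \<delta>'(2) by auto
    then have r: "\<not> unbounded \<delta>" "\<delta>' = rev \<delta>" "u = len \<delta> - t" using path_rep[OF \<delta>(1) \<delta>'(1) td eq] by auto
    note b = bounded[OF \<delta>(1) r(1)]
    show False
    proof (cases "\<forall>t\<in>dom \<delta>. path \<delta> t \<notin> A")
      case True
      then have "fst (rev \<delta>) \<in> Q" using no \<delta>(1,2) r(1) by blast
      then show False using r(2) \<delta>'(2) by simp
    next
      case False
      then obtain t0 where t0: "t0 \<in> dom \<delta>" "path \<delta> t0 \<in> A" by blast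
      have l: "0 < t0" "t0 < len \<delta>" using t0(1) b(2) by auto
      have t0': "len \<delta> - t0 \<in> dom (rev \<delta>)" unfolding b(5) using l by simp
      have "path (rev \<delta>) (len \<delta> - t0) \<in> A" using b(6)[OF l] t0(2) by simp
      then have "u < len \<delta> - t0" using half_break[OF b(3) t0'] \<delta>'(3) r(2) by simp
      moreover have "t < t0" using half_break[OF \<delta>(1) t0] \<delta>(3) by simp
      ultimately show False using r(3) by simp
    qed
  qed
  have dis: "N Q \<inter> N ?Q' = {}"
  proof (rule ccontr)
    assume "N Q \<inter> N ?Q' \<noteq> {}"
    then obtain x where x: "x \<in> N Q" "x \<in> N ?Q'" by blast
    have pB: "path \<delta> t \<notin> B" if "t \<in> half \<delta>" for \<delta> t by (rule path_notin_B[OF subsetD[OF half_sub that]])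
    from x(1) consider "x \<in> Q" | \<delta> t where "\<delta> \<in> darts" "fst \<delta> \<in> Q" "t \<in> half \<delta>" "x = path \<delta> t"
      | \<delta> where "\<delta> \<in> darts" "unbounded \<delta>" "fst \<delta> \<in> Q" "x = tip \<delta>" unfolding N_def by blast
    note case1 = this
    from x(2) consider "x \<in> ?Q'" | \<delta> t where "\<delta> \<in> darts" "fst \<delta> \<in> ?Q'" "t \<in> half \<delta>" "x = path \<delta> t"
      | \<delta> where "\<delta> \<in> darts" "unbounded \<delta>" "fst \<delta> \<in> ?Q'" "x = tip \<delta>" unfolding N_def by blast
    then show False
    proof cases
      case 1
      note c1 = this
      from case1 show False
      proof cases
        case (2 \<delta> t) then show False using c1 pB[OF 2(3)] by auto
      next
        case (3 \<delta>) then show False using c1 tip(1)[OF 3(1,2)] by auto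
      qed (use c1 in auto)
    next
      case (2 \<delta> t)
      note c2 = this
      from case1 show False
      proof cases
        case 1 then show False using c2(4) pB[OF c2(3)] Q(1) by auto
      next
        case (2 \<delta>' t')
        then show False using sep[OF 2(1-3) c2(1-3)] c2(4) by simp
      next
        case (3 \<delta>')
        then show False using c2 pB[OF c2(3)] tip(1)[OF 3(1,2)] I_B by auto
      qed
    next
      case (3 \<delta>)
      note c3 = this
      have xI: "x \<in> I" using tip(1)[OF 3(1,2)] 3(4) by simp
      from case1 show False
      proof cases
        case 1 then show False using xI Q(1) by auto
      next
        case (2 \<delta>' t')
        then show False using pB[OF 2(3)] xI I_B by auto
      next
        case (3 \<delta>')
        have "tip \<delta>' = tip \<delta>" using 3(4) c3(4) by simp
        then have "\<delta>' = \<delta>" by (rule tip_inj[OF 3(1,2) c3(1,2)])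
        then show False using 3(3) c3(3) by simp
      qed
    qed
  qed
  have cov: "UNIV - A \<subseteq> N Q \<union> N ?Q'"
  proof
    fix x assume x: "x \<in> UNIV - A"
    have src: "fst \<delta> \<in> Q \<or> fst \<delta> \<in> ?Q'" if "\<delta> \<in> darts" for \<delta> using dartsD[OF that] by blast
    consider "x \<in> I" | "x \<in> B" "x \<notin> I" | "x \<notin> B" by blast
    then show "x \<in> N Q \<union> N ?Q'"
    proof cases
      case 1
      then obtain \<delta> where "\<delta> \<in> darts" "unbounded \<delta>" "tip \<delta> = x" by (rule tip_surj)
      then show ?thesis using src[of \<delta>] unfolding N_def by blast
    next
      case 2
      then show ?thesis unfolding N_def by blast
    next
      case 3
      then obtain \<delta> t where t: "\<delta> \<in> darts" "t \<in> dom \<delta>" "x = path \<delta> t" using cover(1) by blast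
      \<comment> \<open>A point beyond the break of its dart lies before the break of the reverse
        dart.\<close>
      have "\<exists>\<delta>'\<in>darts. x \<in> path \<delta>' ` half \<delta>'"
      proof (cases "\<forall>t\<in>dom \<delta>. path \<delta> t \<notin> A")
        case True
        then show ?thesis using half_none t by blast
      next
        case False
        then obtain t0 where t0: "t0 \<in> dom \<delta>" "path \<delta> t0 \<in> A" by blast
        have b': "\<not> unbounded \<delta>" using none[OF t(1) _ t0(1)] t0(2) by blast
        note b = bounded[OF t(1) b']
        have l: "0 < t0" "t0 < len \<delta>" using t0(1) b(2) by auto
        have "t \<noteq> t0" using x t t0 by auto
        then consider "t < t0" | "t0 < t" by linarith
        then show ?thesis
        proof cases
          case 1
          then have "t \<in> half \<delta>" using half_break[OF t(1) t0] dom_pos[OF t(2)] by simp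
          then show ?thesis using t by blast
        next
          case 2
          have t0': "len \<delta> - t0 \<in> dom (rev \<delta>)" unfolding b(5) using l by simp
          have A': "path (rev \<delta>) (len \<delta> - t0) \<in> A" using b(6)[OF l] t0(2) by simp
          have tl: "0 < t" "t < len \<delta>" using t(2) b(2) by auto
          then have "len \<delta> - t \<in> half (rev \<delta>)" using half_break[OF b(3) t0' A'] 2 by simp
          then show ?thesis using b(3) b(6)[OF tl] t(3) by blast
        qed
      qed
      then show ?thesis using src unfolding N_def by blast
    qed
  qed
  have "open (N Q)" "open (N ?Q')" using open_N Q(1) by auto
  then have "N Q \<inter> (UNIV - A) = {} \<or> N ?Q' \<inter> (UNIV - A) = {}"
    using connectedD[OF A(3), of "N Q" "N ?Q'"] dis cov by blast
  moreover have "Q \<subseteq> N Q \<inter> (UNIV - A)" "?Q' \<subseteq> N ?Q' \<inter> (UNIV - A)" using A(2) Q(1) unfolding N_def by auto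
  ultimately show False using Q by blast
qed

end

section \<open>Functions whose chips support no smooth cut set\<close>

locale free_model = model +
  fixes D :: "'a \<Rightarrow> int" and f :: "'a \<Rightarrow> ereal"
  assumes free: "f \<in> smooth_cut_free d I D" and D_B: "supp D \<subseteq> B"
begin

lemma f_germs: "germs f"
  using free by (simp add: smooth_cut_free_def Rset_def rational_iff_germs)

lemma D_out: "x \<notin> B \<Longrightarrow> D x = 0"
  using D_B by (auto simp: supp_def)

lemma ord_nonneg: "x \<notin> B \<Longrightarrow> 0 \<le> ord_at d I x f"
proof -
  assume "x \<notin> B"
  moreover have "0 \<le> D x + ord_at d I x f"
    using free by (simp add: smooth_cut_free_def Rset_def effective_def div_add_def princ_div_def)
  ultimately show ?thesis using D_out by simp
qed

text \<open>Off \<open>B\<close> every point has valence 2 and \<open>D\<close> vanishes, so break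
  points there carry chips, and a cut set consisting of them would be smooth.\<close>

lemma breaks_no_cut:
  assumes A: "\<And>x. x \<in> A \<Longrightarrow> x \<notin> B \<and> ord_at d I x f \<noteq> 0"
  shows "\<not> cut_set A"
proof
  assume "cut_set A"
  moreover have "valence d I x = 2" if "x \<in> A" for x
  proof -
    have "x \<notin> B" using A[OF that] by simp
    then have "x \<notin> I" "val x = 2" using I_B val_B by auto
    then show ?thesis by (simp add: valence_val)
  qed
  ultimately have "smooth_cut_set d I A" by (simp add: smooth_cut_set_def)
  moreover have "A \<subseteq> supp (div_add D (princ_div d I f))"
  proof
    fix x assume "x \<in> A"
    then show "x \<in> supp (div_add D (princ_div d I f))"
      using A[of x] D_out[of x] by (simp add: supp_def div_add_def princ_div_def)
  qed
  ultimately have "\<exists>A. smooth_cut_set d I A \<and> A \<subseteq> supp (div_add D (princ_div d I f))" by (intro exI conjI)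
  then show False using free unfolding smooth_cut_free_def by blast
qed

lemma unbounded_flat:
  assumes \<delta>: "\<delta> \<in> darts" "unbounded \<delta>"
  shows "flat f \<delta>"
  unfolding flat_def
proof (rule ballI, rule ccontr)
  fix t assume t: "t \<in> dom \<delta>" and o: "ord_at d I (path \<delta> t) f \<noteq> 0"
  have "\<not> cut_set {path \<delta> t}" by (rule breaks_no_cut) (use o path_notin_B[OF t] in simp)
  then show False using cut_set_one[OF \<delta> t] by simp
qed

lemma break_unique:
  assumes \<delta>: "\<delta> \<in> darts" and t: "t \<in> dom \<delta>" "u \<in> dom \<delta>"
    and o: "ord_at d I (path \<delta> t) f \<noteq> 0" "ord_at d I (path \<delta> u) f \<noteq> 0"
  shows "t = u"
proof -
  have "\<not> cut_set {path \<delta> t, path \<delta> u}" "\<not> cut_set {path \<delta> u, path \<delta> t}"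
    by (rule breaks_no_cut; use o path_notin_B[OF t(1)] path_notin_B[OF t(2)] in auto)+
  then show ?thesis using cut_set_two[OF \<delta> t] cut_set_two[OF \<delta> t(2,1)] by (cases "t < u"; cases "u < t") auto
qed

text \<open>At a break point the order is \<open>- (s + s')\<close>, and it is positive because
  \<open>D\<close> vanishes there. So the single possible break is convex and the function is the
  maximum of its two affine pieces; end slopes that cancel leave no room for a break.\<close>

lemma bounded_shape:
  assumes \<delta>: "\<delta> \<in> darts" "\<not> unbounded \<delta>"
  shows "t \<in> dom \<delta> \<Longrightarrow> fv f (path \<delta> t) =
      max (fv f (fst \<delta>) + of_int (dsl f \<delta>) * t) (fv f (fst (rev \<delta>)) + of_int (dsl f (rev \<delta>)) * (len \<delta> - t))"
    and "dsl f \<delta> + dsl f (rev \<delta>) = 0 \<Longrightarrow> flat f \<delta>"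
proof -
  note b = bounded[OF \<delta>]
  have "(\<forall>t\<in>dom \<delta>. fv f (path \<delta> t) =
      max (fv f (fst \<delta>) + of_int (dsl f \<delta>) * t) (fv f (fst (rev \<delta>)) + of_int (dsl f (rev \<delta>)) * (len \<delta> - t))) \<and>
    (dsl f \<delta> + dsl f (rev \<delta>) = 0 \<longrightarrow> flat f \<delta>)"
  proof (cases "flat f \<delta>")
    case True
    note fb = flat_bounded[OF f_germs \<delta> True]
    show ?thesis
    proof (intro conjI ballI impI)
      fix t assume t: "t \<in> dom \<delta>"
      show "fv f (path \<delta> t) =
        max (fv f (fst \<delta>) + of_int (dsl f \<delta>) * t) (fv f (fst (rev \<delta>)) + of_int (dsl f (rev \<delta>)) * (len \<delta> - t))"
        unfolding fb flat_affine[OF f_germs \<delta>(1) True t] by (simp add: algebra_simps)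
    qed (rule True)
  next
    case False
    then obtain t0 where t0: "t0 \<in> dom \<delta>" "ord_at d I (path \<delta> t0) f \<noteq> 0" unfolding flat_def by blast
    have l: "0 < t0" "t0 < len \<delta>" using t0(1) b(2) by auto
    have other: "ord_at d I (path \<delta> u) f = 0" if "u \<in> dom \<delta>" "u \<noteq> t0" for u
      using break_unique[OF \<delta>(1) that(1) t0(1) _ t0(2)] that(2) by auto
    define s s' where "s = dsl f \<delta>" and "s' = dsl f (rev \<delta>)"
    have left: "fv f (path \<delta> t) = fv f (fst \<delta>) + of_int s * t" if "0 < t" "t \<le> t0" for t
      unfolding s_def
    proof (rule dart_affine[OF f_germs \<delta>(1) t0(1) _ that])
      fix u assume "0 < u" "u < t0"
      then show "ord_at d I (path \<delta> u) f = 0" using other[of u] dom_down[OF t0(1), of u] by simp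
    qed
    have t0': "len \<delta> - t0 \<in> dom (rev \<delta>)" unfolding b(5) using l by simp
    have right: "fv f (path \<delta> t) = fv f (fst (rev \<delta>)) + of_int s' * (len \<delta> - t)" if "t0 \<le> t" "t < len \<delta>" for t
    proof -
      have tt: "0 < len \<delta> - t" "len \<delta> - t \<le> len \<delta> - t0" using that by auto
      have "fv f (path (rev \<delta>) (len \<delta> - t)) = fv f (fst (rev \<delta>)) + of_int s' * (len \<delta> - t)"
        unfolding s'_def
      proof (rule dart_affine[OF f_germs b(3) t0' _ tt])
        fix u assume u: "0 < u" "u < len \<delta> - t0"
        then have "path \<delta> (len \<delta> - u) = path (rev \<delta>) u" using b(6)[of "len \<delta> - u"] l by simp
        moreover have "len \<delta> - u \<in> dom \<delta>" unfolding b(2) using u l by simp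
        ultimately show "ord_at d I (path (rev \<delta>) u) f = 0" using other[of "len \<delta> - u"] u by simp
      qed
      then show ?thesis using b(6)[of t] that l by simp
    qed
    obtain e where e: "0 < e" "{t0-e<..<t0+e} \<subseteq> dom \<delta>" "mline (path \<delta> t0) e (\<lambda>s. path \<delta> (t0 + s))"
      by (rule geoE[OF geo_path t0(1)])
    have "ord_at d I (path \<delta> t0) f = (- s') + (- s)"
    proof (rule ord_line[OF f_germs e(3), of "min t0 (len \<delta> - t0)"]; (intro allI impI)?)
      fix v assume v: "0 < v" "v < min t0 (len \<delta> - t0)"
      show "fv f (path \<delta> (t0 + v)) = fv f (path \<delta> t0) + of_int (- s') * v"
        using right[of "t0 + v"] right[of t0] v l by (simp add: algebra_simps)
      show "fv f (path \<delta> (t0 + - v)) = fv f (path \<delta> t0) + of_int (- s) * v"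
        using left[of "t0 - v"] left[of t0] v l by (simp add: algebra_simps)
    qed (use l in simp)
    then have neg: "s + s' < 0" using ord_nonneg[OF path_notin_B[OF t0(1)]] t0(2) by simp
    have meet: "fv f (fst \<delta>) + of_int s * t0 = fv f (fst (rev \<delta>)) + of_int s' * (len \<delta> - t0)"
      using left[of t0] right[of t0] l by simp
    have dif: "(fv f (fst \<delta>) + of_int s * t) - (fv f (fst (rev \<delta>)) + of_int s' * (len \<delta> - t)) =
        of_int (s + s') * (t - t0)" for t
      using meet by (simp add: algebra_simps)
    show ?thesis
    proof (intro conjI ballI impI)
      fix t assume t: "t \<in> dom \<delta>"
      then have tl: "0 < t" "t < len \<delta>" using b(2) by auto
      have "fv f (path \<delta> t) = max (fv f (fst \<delta>) + of_int s * t) (fv f (fst (rev \<delta>)) + of_int s' * (len \<delta> - t))"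
      proof (cases "t \<le> t0")
        case True
        then have "0 \<le> real_of_int (s + s') * (t - t0)" using neg by (intro mult_nonpos_nonpos) auto
        then show ?thesis using left[OF tl(1) True] dif[of t] by (simp add: max_def)
      next
        case False
        then have "real_of_int (s + s') * (t - t0) \<le> 0" using neg by (intro mult_nonpos_nonneg) auto
        then show ?thesis using right[of t] tl False dif[of t] by (simp add: max_def)
      qed
      then show "fv f (path \<delta> t) =
        max (fv f (fst \<delta>) + of_int (dsl f \<delta>) * t) (fv f (fst (rev \<delta>)) + of_int (dsl f (rev \<delta>)) * (len \<delta> - t))"
        by (simp add: s_def s'_def)
    next
      assume "dsl f \<delta> + dsl f (rev \<delta>) = 0"
      then show "flat f \<delta>" using neg by (simp add: s_def s'_def)
    qed
  qed
  then show "t \<in> dom \<delta> \<Longrightarrow> fv f (path \<delta> t) =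
      max (fv f (fst \<delta>) + of_int (dsl f \<delta>) * t) (fv f (fst (rev \<delta>)) + of_int (dsl f (rev \<delta>)) * (len \<delta> - t))"
    "dsl f \<delta> + dsl f (rev \<delta>) = 0 \<Longrightarrow> flat f \<delta>" by auto
qed

end

text \<open>The constant is fixed at one vertex. If the set \<open>Q\<close> of vertices where it is
  right were not all of \<open>B - I\<close>, an edge without breaks would lead out of
  \<open>Q\<close>, but along it equal slopes transport the constant. The shape of each edge then
  settles the remaining points.\<close>

lemma (in model) same_slopes:
  assumes f: "free_model d I B D f" and g: "free_model d I B D g"
    and eq: "\<And>\<delta>. \<delta> \<in> darts \<Longrightarrow> dsl f \<delta> = dsl g \<delta>"
  shows "\<exists>c. g = trop_scale c f"
proof -
  interpret F: free_model d I B D f by (rule f)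
  interpret G: free_model d I B D g by (rule g)
  obtain w0 where w0: "w0 \<in> B" "w0 \<notin> I" using B_I by blast
  define c where "c = fv g w0 - fv f w0"
  define Q where "Q = {w\<in>B - I. fv g w = fv f w + c}"
  have QB: "Q = B - I"
  proof (rule ccontr)
    assume ne: "Q \<noteq> B - I"
    let ?A = "{x. x \<notin> B \<and> ord_at d I x f \<noteq> 0}"
    have fin: "finite ?A" using finite_ord[OF F.f_germs] by (rule rev_finite_subset) auto
    have con: "connected (UNIV - ?A)" using F.breaks_no_cut[of ?A] by (simp add: cut_set_def)
    have "\<exists>\<delta>\<in>darts. \<not> unbounded \<delta> \<and> (\<forall>t\<in>dom \<delta>. path \<delta> t \<notin> ?A) \<and> fst \<delta> \<in> Q \<and> fst (rev \<delta>) \<notin> Q"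
    proof (rule connecting_dart[OF fin _ con _ _ _ _ ne])
      show "?A \<inter> B = {}" by blast
      show "t = u" if "\<delta> \<in> darts" "t \<in> dom \<delta>" "u \<in> dom \<delta>" "path \<delta> t \<in> ?A" "path \<delta> u \<in> ?A" for \<delta> t u
        using F.break_unique[OF that(1-3)] that(4,5) by simp
      show "path \<delta> t \<notin> ?A" if "\<delta> \<in> darts" "unbounded \<delta>" "t \<in> dom \<delta>" for \<delta> t
        using F.unbounded_flat[OF that(1,2)] that(3) unfolding flat_def by simp
      show "Q \<subseteq> B - I" unfolding Q_def by blast
      have "w0 \<in> Q" using w0 unfolding Q_def c_def by simp
      then show "Q \<noteq> {}" by blast
    qed
    then obtain \<delta> where \<delta>: "\<delta> \<in> darts" "\<not> unbounded \<delta>" "\<forall>t\<in>dom \<delta>. path \<delta> t \<notin> ?A" "fst \<delta> \<in> Q" "fst (rev \<delta>) \<notin> Q"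
      by blast
    note b = bounded[OF \<delta>(1,2)]
    have ff: "flat f \<delta>"
      unfolding flat_def
    proof
      fix t assume t: "t \<in> dom \<delta>"
      show "ord_at d I (path \<delta> t) f = 0" using bspec[OF \<delta>(3) t] path_notin_B[OF t] by simp
    qed
    note f1 = flat_bounded[OF F.f_germs \<delta>(1,2) ff]
    \<comment> \<open>The end slopes of this edge cancel for \<open>f\<close>, hence also for
      \<open>g\<close>, so \<open>g\<close> has no break there either.\<close>
    have gf: "flat g \<delta>" by (rule G.bounded_shape(2)[OF \<delta>(1,2)]) (use f1(1) eq[OF \<delta>(1)] eq[OF b(3)] in simp)
    note g1 = flat_bounded[OF G.f_germs \<delta>(1,2) gf]
    have "fv g (fst \<delta>) = fv f (fst \<delta>) + c" using \<delta>(4) unfolding Q_def by simp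
    then have "fv g (fst (rev \<delta>)) = fv f (fst (rev \<delta>)) + c" unfolding f1(2) g1(2) using eq[OF \<delta>(1)] by simp
    then have "fst (rev \<delta>) \<in> Q" using dartsD(1,2)[OF b(3)] unfolding Q_def by simp
    then show False using \<delta>(5) by simp
  qed
  have vert: "fv g w = fv f w + c" if "w \<in> B" "w \<notin> I" for w
  proof -
    have "w \<in> Q" using that QB by simp
    then show ?thesis by (simp add: Q_def)
  qed
  have path_eq: "fv g (path \<delta> t) = fv f (path \<delta> t) + c" if \<delta>: "\<delta> \<in> darts" and t: "t \<in> dom \<delta>" for \<delta> t
  proof -
    have src: "fv g (fst \<delta>) = fv f (fst \<delta>) + c" using vert dartsD[OF \<delta>] by blast
    show ?thesis
    proof (cases "unbounded \<delta>")
      case True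
      show ?thesis
        unfolding flat_affine[OF F.f_germs \<delta> F.unbounded_flat[OF \<delta> True] t]
          flat_affine[OF G.f_germs \<delta> G.unbounded_flat[OF \<delta> True] t] using src eq[OF \<delta>] by simp
    next
      case False
      note b = bounded[OF \<delta> False]
      have tgt: "fv g (fst (rev \<delta>)) = fv f (fst (rev \<delta>)) + c" using vert dartsD[OF b(3)] by blast
      show ?thesis
        unfolding F.bounded_shape(1)[OF \<delta> False t] G.bounded_shape(1)[OF \<delta> False t] src tgt eq[OF \<delta>] eq[OF b(3)]
        by (simp add: max_def)
    qed
  qed
  have "g x = trop_scale c f x" for x
  proof (cases "x \<in> I")
    case True
    then obtain \<delta> where \<delta>: "\<delta> \<in> darts" "unbounded \<delta>" "tip \<delta> = x" by (rule tip_surj)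
    have src: "fv g (fst \<delta>) = fv f (fst \<delta>) + c" using vert dartsD[OF \<delta>(1)] by blast
    have "g x = endval (fv f (fst \<delta>) + c) (- dsl f \<delta>)"
      using flat_unbounded(2)[OF G.f_germs \<delta>(1,2) G.unbounded_flat[OF \<delta>(1,2)]] \<delta>(3) src eq[OF \<delta>(1)] by simp
    moreover have "f x = endval (fv f (fst \<delta>)) (- dsl f \<delta>)"
      using flat_unbounded(2)[OF F.f_germs \<delta>(1,2) F.unbounded_flat[OF \<delta>(1,2)]] \<delta>(3) by simp
    ultimately show ?thesis by (simp add: trop_scale_def endval_def add.commute)
  next
    case False
    have "fv g x = fv f x + c"
    proof (cases "x \<in> B")
      case True then show ?thesis using vert False by simp
    next
      case nB: False
      obtain \<delta> where \<delta>: "\<delta> \<in> darts" "x \<in> path \<delta> ` dom \<delta>" using cover(1)[OF nB] by (elim bexE)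
      obtain t where t: "t \<in> dom \<delta>" "x = path \<delta> t" using \<delta>(2) by (elim imageE)
      show ?thesis unfolding t(2) by (rule path_eq[OF \<delta>(1) t(1)])
    qed
    then show ?thesis
      using germs_finite[OF G.f_germs False] germs_finite[OF F.f_germs False]
      by (metis add.commute plus_ereal.simps(1) trop_scale_def)
  qed
  then show ?thesis by (intro exI[of _ c] ext)
qed

context trop_curve
begin

text \<open>The vertex set depends on \<open>D\<close> only, so every \<open>f\<close> in
  \<open>S\<close> is encoded by its slopes on the same finite set of darts. These are integers
  between \<open>- K\<close> and \<open>K\<close>, and functions with the same code differ by a
  constant.\<close>

lemma smooth_cut_free_finite:
  assumes D: "divisor D" and S: "S = smooth_cut_free d I D"
  shows "finite (S // scaling_rel S)"
proof (cases "S = {}")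
  case False
  have fD: "finite (supp D)" using D by (simp add: divisor_def)
  \<comment> \<open>A point off \<open>I\<close> exists: the type is nonempty, and an end has a tail
    of finite points.\<close>
  obtain x :: 'a where x: "x \<notin> I"
  proof (cases "I = {}")
    case False
    then obtain p where "p \<in> I" by blast
    then have "tail p 0 \<notin> I" by (intro tailD(5)) auto
    then show ?thesis by (rule that)
  qed (use that in blast)
  interpret m: model d I "I \<union> {y. y \<notin> I \<and> val y \<noteq> 2} \<union> insert x (supp D)"
    by (rule model_exists[OF fD x])
  define K where "K = (\<Sum>x\<in>supp D. \<bar>D x\<bar>)"
  define code where "code f = (\<lambda>\<delta>\<in>m.darts. m.dsl f \<delta>)" for f
  have fm: "free_model d I (I \<union> {y. y \<notin> I \<and> val y \<noteq> 2} \<union> insert x (supp D)) D f" if "f \<in> S" for f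
    using that by unfold_locales (auto simp: S)
  have range: "code f \<in> (m.darts \<rightarrow>\<^sub>E {-K..K})" if "f \<in> S" for f
  proof -
    have "f \<in> Rset d I D" using that by (simp add: S smooth_cut_free_def)
    then have "\<bar>m.dsl f \<delta>\<bar> \<le> K" if "\<delta> \<in> m.darts" for \<delta>
      unfolding m.dsl_def K_def by (rule slope_bound[OF _ D]) (use m.dartsD[OF that] in auto)
    then show ?thesis unfolding code_def by (auto simp: abs_le_iff PiE_iff minus_le_iff)
  qed
  then have "code ` S \<subseteq> (m.darts \<rightarrow>\<^sub>E {-K..K})" by blast
  then have finc: "finite (code ` S)"
    by (rule finite_subset) (rule finite_PiE[OF m.finite_darts], simp)
  have scale: "\<exists>c. g = trop_scale c f" if "f \<in> S" "g \<in> S" "code f = code g" for f g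
  proof (rule m.same_slopes[OF fm[OF that(1)] fm[OF that(2)]])
    fix \<delta> assume "\<delta> \<in> m.darts"
    then show "m.dsl f \<delta> = m.dsl g \<delta>" using fun_cong[OF that(3), of \<delta>] by (simp add: code_def)
  qed
  have cls: "scaling_rel S `` {f} = {g\<in>S. \<exists>a. g = trop_scale a f}" if "f \<in> S" for f
    using that by (auto simp: scaling_rel_def)
  have tt: "trop_scale a (trop_scale b f) = trop_scale (a + b) f" for a b f
  proof
    fix y show "trop_scale a (trop_scale b f) y = trop_scale (a + b) f y"
      by (cases "f y") (auto simp: trop_scale_def)
  qed
  have same: "scaling_rel S `` {f} = scaling_rel S `` {g}" if fg: "f \<in> S" "g \<in> S" "code f = code g" for f g
  proof -
    obtain b where b: "g = trop_scale b f" using scale[OF fg] by blast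
    obtain b' where b': "f = trop_scale b' g" using scale[OF fg(2,1)] fg(3) by metis
    show ?thesis unfolding cls[OF fg(1)] cls[OF fg(2)]
    proof (intro equalityI subsetI)
      fix h assume "h \<in> {h\<in>S. \<exists>a. h = trop_scale a f}"
      then obtain a where "h \<in> S" "h = trop_scale a f" by blast
      then have "h = trop_scale (a + b') g" using b' tt by metis
      then show "h \<in> {h\<in>S. \<exists>a. h = trop_scale a g}" using \<open>h \<in> S\<close> by blast
    next
      fix h assume "h \<in> {h\<in>S. \<exists>a. h = trop_scale a g}"
      then obtain a where "h \<in> S" "h = trop_scale a g" by blast
      then have "h = trop_scale (a + b) f" using b tt by metis
      then show "h \<in> {h\<in>S. \<exists>a. h = trop_scale a f}" using \<open>h \<in> S\<close> by blast
    qed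
  qed
  define pick where "pick \<phi> = (SOME f. f \<in> S \<and> code f = \<phi>)" for \<phi>
  have "S // scaling_rel S \<subseteq> (\<lambda>\<phi>. scaling_rel S `` {pick \<phi>}) ` code ` S"
  proof
    fix X assume "X \<in> S // scaling_rel S"
    then obtain f where f: "f \<in> S" "X = scaling_rel S `` {f}" by (rule quotientE)
    have "pick (code f) \<in> S \<and> code (pick (code f)) = code f"
      unfolding pick_def by (rule someI[of _ f]) (use f in simp)
    then have "X = scaling_rel S `` {pick (code f)}" using same[OF f(1), of "pick (code f)"] f(2) by simp
    then show "X \<in> (\<lambda>\<phi>. scaling_rel S `` {pick \<phi>}) ` code ` S" using f(1) by blast
  qed
  then show ?thesis using finc by (meson finite_imageI finite_subset)
qed (simp add: quotient_def)

end

section \<open>Firing chips\<close>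

context model
begin

text \<open>\<open>u\<close> prescribes the values on dart coordinates, \<open>\<sigma>\<close> the
  slopes at vertices, \<open>a\<close> and \<open>b\<close> the outgoing slopes forwards and
  backwards inside an edge, and \<open>m\<close> the orders at infinity. By \<open>sym\<close> the
  two coordinates of a point on a bounded edge give the same value.\<close>

lemma build_germs:
  fixes u :: "'a \<times> nat \<Rightarrow> real \<Rightarrow> real" and vert :: "'a \<Rightarrow> ereal"
    and \<sigma> m :: "'a \<times> nat \<Rightarrow> int" and a b :: "'a \<times> nat \<Rightarrow> real \<Rightarrow> int"
  assumes vert: "\<And>x. x \<in> B \<Longrightarrow> x \<notin> I \<Longrightarrow> \<bar>vert x\<bar> \<noteq> \<infinity>"
    and sym: "\<And>\<delta> t. \<delta> \<in> darts \<Longrightarrow> \<not> unbounded \<delta> \<Longrightarrow> t \<in> dom \<delta> \<Longrightarrow> u (rev \<delta>) (len \<delta> - t) = u \<delta> t"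
    and start: "\<And>\<delta>. \<delta> \<in> darts \<Longrightarrow> \<exists>e>0. \<forall>t. 0 < t \<longrightarrow> t < e \<longrightarrow> u \<delta> t = fv vert (fst \<delta>) + of_int (\<sigma> \<delta>) * t"
    and mid: "\<And>\<delta> t. \<delta> \<in> darts \<Longrightarrow> t \<in> dom \<delta> \<Longrightarrow> \<exists>e>0. \<forall>r. 0 < r \<longrightarrow> r < e \<longrightarrow>
        u \<delta> (t + r) = u \<delta> t + of_int (a \<delta> t) * r \<and> u \<delta> (t - r) = u \<delta> t + of_int (b \<delta> t) * r"
    and far: "\<And>\<delta>. \<delta> \<in> darts \<Longrightarrow> unbounded \<delta> \<Longrightarrow>
        \<exists>T k. (\<forall>w>T. u \<delta> w = k - of_int (m \<delta>) * w) \<and> vert (tip \<delta>) = endval k (m \<delta>)"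
  obtains h where "germs h" "\<forall>x\<in>B. h x = vert x" "\<forall>\<delta>\<in>darts. \<forall>t\<in>dom \<delta>. h (path \<delta> t) = ereal (u \<delta> t)"
    "\<forall>x\<in>B - I. ord_at d I x h = (\<Sum>i<val x. \<sigma> (x, i))"
    "\<forall>\<delta>\<in>darts. \<forall>t\<in>dom \<delta>. ord_at d I (path \<delta> t) h = a \<delta> t + b \<delta> t"
    "\<forall>\<delta>\<in>darts. unbounded \<delta> \<longrightarrow> ord_at d I (tip \<delta>) h = m \<delta>"
proof -
  define h where "h x = (if x \<in> B then vert x
    else ereal (SOME v. \<exists>\<delta>\<in>darts. \<exists>t\<in>dom \<delta>. x = path \<delta> t \<and> v = u \<delta> t))" for x
  have hp: "h (path \<delta> t) = ereal (u \<delta> t)" if \<delta>: "\<delta> \<in> darts" and t: "t \<in> dom \<delta>" for \<delta> t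
  proof -
    have "(SOME v. \<exists>\<delta>'\<in>darts. \<exists>t'\<in>dom \<delta>'. path \<delta> t = path \<delta>' t' \<and> v = u \<delta>' t') = u \<delta> t"
    proof (rule some_equality)
      show "\<exists>\<delta>'\<in>darts. \<exists>t'\<in>dom \<delta>'. path \<delta> t = path \<delta>' t' \<and> u \<delta> t = u \<delta>' t'"
        using \<delta> t by (intro bexI[of _ \<delta>] bexI[of _ t]) auto
    next
      fix v assume "\<exists>\<delta>'\<in>darts. \<exists>t'\<in>dom \<delta>'. path \<delta> t = path \<delta>' t' \<and> v = u \<delta>' t'"
      then obtain \<delta>' t' where v: "\<delta>' \<in> darts" "t' \<in> dom \<delta>'" "path \<delta> t = path \<delta>' t'" "v = u \<delta>' t'"
        by (elim bexE conjE)
      from path_rep[OF \<delta> v(1) t v(2,3)] show "v = u \<delta> t"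
      proof (elim disjE conjE)
        assume "\<not> unbounded \<delta>" "\<delta>' = rev \<delta>" "t' = len \<delta> - t"
        then show ?thesis using sym[OF \<delta> _ t] v(4) by simp
      qed (use v(4) in simp)
    qed
    then show ?thesis using path_notin_B[OF t] by (simp add: h_def)
  qed
  have hB: "h x = vert x" if "x \<in> B" for x using that by (simp add: h_def)
  have fin: "\<bar>h x\<bar> \<noteq> \<infinity>" if "x \<notin> I" for x using vert[of x] that by (simp add: h_def)
  have start_slope: "slope h (fst \<delta>) (snd \<delta>) (\<sigma> \<delta>)" if \<delta>: "\<delta> \<in> darts" for \<delta>
  proof -
    obtain e1 where e1: "0 < e1" "e1 \<le> rad (fst \<delta>)" "\<forall>t. 0 < t \<longrightarrow> t < e1 \<longrightarrow> t \<in> dom \<delta>"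
      "\<forall>t. 0 < t \<longrightarrow> t < e1 \<longrightarrow> path \<delta> t = arm (fst \<delta>) (snd \<delta>) t"
      "\<forall>t. 0 < t \<longrightarrow> t < e1 \<longrightarrow> d (fst \<delta>) (path \<delta> t) = t" by (rule path_start[OF \<delta>])
    obtain e2 where e2: "0 < e2" "\<forall>t. 0 < t \<longrightarrow> t < e2 \<longrightarrow> u \<delta> t = fv vert (fst \<delta>) + of_int (\<sigma> \<delta>) * t"
      using start[OF \<delta>] by (elim exE conjE)
    show ?thesis
    proof (rule slopeI[of h "fst \<delta>" "min e1 e2"])
      show "\<forall>t>0. t < min e1 e2 \<longrightarrow> h (arm (fst \<delta>) (snd \<delta>) t) = ereal (fv h (fst \<delta>) + of_int (\<sigma> \<delta>) * t)"
      proof (intro allI impI)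
        fix t assume t: "0 < t" "t < min e1 e2"
        then have "h (path \<delta> t) = ereal (u \<delta> t)" using hp[OF \<delta>] e1(3) by simp
        then show "h (arm (fst \<delta>) (snd \<delta>) t) = ereal (fv h (fst \<delta>) + of_int (\<sigma> \<delta>) * t)"
          using e1(4) e2(2) t hB[OF dartsD(1)[OF \<delta>]] by simp
      qed
    qed (use fin[OF dartsD(2)[OF \<delta>]] e1(1) e2(1) in auto)
  qed
  have mid_line: "\<exists>e>0. mline (path \<delta> t) e (\<lambda>r. path \<delta> (t + r)) \<and>
      (\<forall>r. 0 < r \<longrightarrow> r < e \<longrightarrow> fv h (path \<delta> (t + r)) = fv h (path \<delta> t) + of_int (a \<delta> t) * r) \<and>
      (\<forall>r. 0 < r \<longrightarrow> r < e \<longrightarrow> fv h (path \<delta> (t + - r)) = fv h (path \<delta> t) + of_int (b \<delta> t) * r)"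
    if \<delta>: "\<delta> \<in> darts" and t: "t \<in> dom \<delta>" for \<delta> t
  proof -
    obtain e1 where e1: "0 < e1" "{t-e1<..<t+e1} \<subseteq> dom \<delta>" "mline (path \<delta> t) e1 (\<lambda>s. path \<delta> (t + s))"
      by (rule geoE[OF geo_path t])
    obtain e2 where e2: "0 < e2" "\<forall>r. 0 < r \<longrightarrow> r < e2 \<longrightarrow>
        u \<delta> (t + r) = u \<delta> t + of_int (a \<delta> t) * r \<and> u \<delta> (t - r) = u \<delta> t + of_int (b \<delta> t) * r"
      using mid[OF \<delta> t] by (elim exE conjE)
    define e where "e = min e1 e2"
    have e: "0 < e" "e \<le> e1" "e \<le> e2" using e1(1) e2(1) by (auto simp: e_def)
    have in_dom: "t + r \<in> dom \<delta>" if "\<bar>r\<bar> < e" for r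
      using e1(2) e that by (auto simp: subset_iff abs_less_iff)
    show ?thesis
    proof (intro exI[of _ e] conjI allI impI)
      show "mline (path \<delta> t) e (\<lambda>r. path \<delta> (t + r))" by (rule mline_mono[OF e1(3) e(1,2)])
      fix r assume r: "0 < r" "r < e"
      show "fv h (path \<delta> (t + r)) = fv h (path \<delta> t) + of_int (a \<delta> t) * r"
        using hp[OF \<delta> t] hp[OF \<delta> in_dom[of r]] e2(2) r e by simp
      show "fv h (path \<delta> (t + - r)) = fv h (path \<delta> t) + of_int (b \<delta> t) * r"
        using hp[OF \<delta> t] hp[OF \<delta> in_dom[of "- r"]] e2(2) r e by simp
    qed (rule e(1))
  qed
  have end_g: "\<exists>c. end_germ h (tip \<delta>) c (m \<delta>)" if \<delta>: "\<delta> \<in> darts" "unbounded \<delta>" for \<delta>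
  proof -
    obtain T k where T: "\<forall>w>T. u \<delta> w = k - of_int (m \<delta>) * w" "vert (tip \<delta>) = endval k (m \<delta>)"
      using far[OF \<delta>] by (elim exE conjE)
    obtain c T' where cT: "0 \<le> T'" "0 \<le> T' + c" "\<forall>w>T'. path \<delta> w = tail (tip \<delta>) (w + c)" using tip(2)[OF \<delta>] by blast
    have "h (tail (tip \<delta>) t) = ereal (k + of_int (m \<delta>) * c - of_int (m \<delta>) * t)" if t: "max T T' + c < t" for t
    proof -
      have w: "T < t - c" "T' < t - c" using t by auto
      then have "t - c \<in> dom \<delta>" using cT(1) \<delta>(2) by (simp add: unbounded_def)
      then have "h (path \<delta> (t - c)) = ereal (u \<delta> (t - c))" by (rule hp[OF \<delta>(1)])
      then show ?thesis using T(1)[rule_format, OF w(1)] cT(3)[rule_format, OF w(2)] by (simp add: algebra_simps)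
    qed
    then have "\<forall>\<^sub>F t in at_top. h (tail (tip \<delta>) t) = ereal (k + of_int (m \<delta>) * c - of_int (m \<delta>) * t)"
      by (rule eventually_mono[OF eventually_gt_at_top])
    moreover have "h (tip \<delta>) = endval (k + of_int (m \<delta>) * c) (m \<delta>)"
      using hB[of "tip \<delta>"] tip(1)[OF \<delta>] I_B T(2) by (auto simp: endval_def)
    ultimately show ?thesis unfolding end_germ_def by (intro exI conjI)
  qed
  have g: "germs h"
    unfolding germs_def
  proof (intro conjI allI impI ballI)
    fix p assume "p \<in> I"
    then obtain \<delta> where "\<delta> \<in> darts" "unbounded \<delta>" "tip \<delta> = p" by (rule tip_surj)
    then show "\<exists>c m. end_germ h p c m" using end_g by metis
  next
    fix x i assume x: "x \<notin> I" and i: "i < val x"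
    show "\<exists>s. slope h x i s"
    proof (cases "x \<in> B")
      case True
      have "(x, i) \<in> darts" using x i True by (simp add: darts_def)
      from start_slope[OF this] show ?thesis by auto
    next
      case False
      obtain \<delta> where \<delta>: "\<delta> \<in> darts" "x \<in> path \<delta> ` dom \<delta>" using cover(1)[OF False] by (elim bexE)
      obtain t where t: "t \<in> dom \<delta>" "x = path \<delta> t" using \<delta>(2) by (elim imageE)
      obtain e where e: "0 < e" "mline (path \<delta> t) e (\<lambda>r. path \<delta> (t + r))"
        "\<forall>r. 0 < r \<longrightarrow> r < e \<longrightarrow> fv h (path \<delta> (t + r)) = fv h (path \<delta> t) + of_int (a \<delta> t) * r"
        "\<forall>r. 0 < r \<longrightarrow> r < e \<longrightarrow> fv h (path \<delta> (t + - r)) = fv h (path \<delta> t) + of_int (b \<delta> t) * r"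
        using mid_line[OF \<delta>(1) t(1)] by (elim exE conjE)
      have "i = 0 \<or> i = 1" using i val_B[OF False] by auto
      then show ?thesis using line_slopes[OF fin e(2,1,3,4)] t(2) by auto
    qed
  qed (rule fin)
  show ?thesis
  proof (rule that[OF g]; intro ballI impI)
    show "h x = vert x" if "x \<in> B" for x by (rule hB[OF that])
    show "h (path \<delta> t) = ereal (u \<delta> t)" if "\<delta> \<in> darts" "t \<in> dom \<delta>" for \<delta> t by (rule hp[OF that])
    show "ord_at d I (tip \<delta>) h = m \<delta>" if "\<delta> \<in> darts" "unbounded \<delta>" for \<delta>
      using end_g[OF that] ord_end_germ[OF tip(1)[OF that]] by blast
    show "ord_at d I x h = (\<Sum>i<val x. \<sigma> (x, i))" if x: "x \<in> B - I" for x
    proof -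
      have "sl h x i = \<sigma> (x, i)" if i: "i < val x" for i
      proof -
        have "(x, i) \<in> darts" using x i by (simp add: darts_def)
        from start_slope[OF this] have "slope h x i (\<sigma> (x, i))" by simp
        then show ?thesis using sl_eq[of h x] fin x by simp
      qed
      then show ?thesis using ord_at_finite[OF g, of x] x by simp
    qed
    show "ord_at d I (path \<delta> t) h = a \<delta> t + b \<delta> t" if \<delta>: "\<delta> \<in> darts" and t: "t \<in> dom \<delta>" for \<delta> t
    proof -
      obtain e where e: "0 < e" "mline (path \<delta> t) e (\<lambda>r. path \<delta> (t + r))"
        "\<forall>r. 0 < r \<longrightarrow> r < e \<longrightarrow> fv h (path \<delta> (t + r)) = fv h (path \<delta> t) + of_int (a \<delta> t) * r"
        "\<forall>r. 0 < r \<longrightarrow> r < e \<longrightarrow> fv h (path \<delta> (t + - r)) = fv h (path \<delta> t) + of_int (b \<delta> t) * r"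
        using mid_line[OF \<delta> t] by (elim exE conjE)
      show ?thesis by (rule ord_line[OF g e(2,1,3,4)])
    qed
  qed
qed

end

context trop_curve
begin

text \<open>Its cardinality is the measure of the induction. Ends are excluded explicitly, as
  \<open>val\<close> is unspecified there.\<close>

definition smooth_support :: "('a \<Rightarrow> int) \<Rightarrow> 'a set" where
  "smooth_support E = {x. x \<notin> I \<and> val x = 2 \<and> E x \<noteq> 0}"

end

locale firing = model +
  fixes E :: "'a \<Rightarrow> int" and A U1 U2 :: "'a set"
  assumes E_nonneg: "0 \<le> E x" and E_fin: "finite (supp E)"
    and E_B: "x \<in> B \<Longrightarrow> x \<notin> I \<Longrightarrow> val x = 2 \<Longrightarrow> E x \<noteq> 0"
    and A_B: "A \<subseteq> B" and A_smooth: "A \<subseteq> smooth_support E" and A_ne: "A \<noteq> {}"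
    and U_open: "open U1" "open U2" and U_disj: "U1 \<inter> U2 = {}" and U_cover: "U1 \<union> U2 = - A"
    and U_ne: "U1 \<noteq> {}" "U2 \<noteq> {}"
    and A_min: "a \<in> A \<Longrightarrow> \<not> cut_set (A - {a})"
begin

text \<open>A dart is connected and avoids \<open>A\<close>, so one that is not on this side lies in
  \<open>U1\<close> (\<open>side_or\<close>).\<close>

definition side :: "'a \<times> nat \<Rightarrow> bool" where
  "side \<delta> \<longleftrightarrow> path \<delta> ` dom \<delta> \<subseteq> U2"

lemma A_D: "a \<in> A \<Longrightarrow> a \<notin> I" "a \<in> A \<Longrightarrow> val a = 2" "a \<in> A \<Longrightarrow> 0 < E a"
  using A_smooth E_nonneg[of a] by (auto simp: smooth_support_def)

lemma side_or: "path \<delta> ` dom \<delta> \<subseteq> U1 \<or> side \<delta>"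
proof -
  have "connected (path \<delta> ` dom \<delta>)"
    by (intro connected_continuous_image geo_continuous[OF geo_path] is_interval_connected dom_interval)
  moreover have "path \<delta> ` dom \<delta> \<subseteq> U1 \<union> U2"
  proof
    fix x assume "x \<in> path \<delta> ` dom \<delta>"
    then obtain t where "t \<in> dom \<delta>" "x = path \<delta> t" by (elim imageE)
    then have "x \<notin> A" using path_notin_B A_B by blast
    then show "x \<in> U1 \<union> U2" using U_cover by blast
  qed
  ultimately have "U1 \<inter> path \<delta> ` dom \<delta> = {} \<or> U2 \<inter> path \<delta> ` dom \<delta> = {}"
    using connectedD[OF _ U_open, of "path \<delta> ` dom \<delta>"] U_disj by blast
  then show ?thesis using \<open>path \<delta> ` dom \<delta> \<subseteq> U1 \<union> U2\<close> unfolding side_def by blast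
qed

lemma side_point: "t \<in> dom \<delta> \<Longrightarrow> path \<delta> t \<in> U2 \<longleftrightarrow> side \<delta>"
proof -
  assume "t \<in> dom \<delta>"
  then have "path \<delta> t \<in> path \<delta> ` dom \<delta>" by (rule imageI)
  then show ?thesis using side_or[of \<delta>] U_disj unfolding side_def by blast
qed

lemma side_rev: "\<delta> \<in> darts \<Longrightarrow> \<not> unbounded \<delta> \<Longrightarrow> side (rev \<delta>) \<longleftrightarrow> side \<delta>"
proof -
  assume \<delta>: "\<delta> \<in> darts" "\<not> unbounded \<delta>"
  note b = bounded[OF \<delta>]
  define t where "t = len \<delta> / 2"
  have t: "0 < t" "t < len \<delta>" "len \<delta> - t = t" using b(1) by (auto simp: t_def)
  have "t \<in> dom \<delta>" "t \<in> dom (rev \<delta>)" unfolding b(2,5) using t by auto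
  then show ?thesis using side_point b(6)[OF t(1,2)] t(3) by metis
qed

lemma start_near:
  assumes "\<delta> \<in> darts" "open U" "fst \<delta> \<in> U"
  obtains t where "t \<in> dom \<delta>" "path \<delta> t \<in> U"
proof -
  obtain r where r: "0 < r" "\<forall>y. y \<notin> I \<longrightarrow> d (fst \<delta>) y < r \<longrightarrow> y \<in> U"
    using ball_in_open[OF assms(2,3) dartsD(2)[OF assms(1)]] by blast
  obtain e where e: "0 < e" "e \<le> rad (fst \<delta>)" "\<forall>t. 0 < t \<longrightarrow> t < e \<longrightarrow> t \<in> dom \<delta>"
    "\<forall>t. 0 < t \<longrightarrow> t < e \<longrightarrow> path \<delta> t = arm (fst \<delta>) (snd \<delta>) t"
    "\<forall>t. 0 < t \<longrightarrow> t < e \<longrightarrow> d (fst \<delta>) (path \<delta> t) = t" by (rule path_start[OF assms(1)])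
  define t where "t = min r e / 2"
  have t: "0 < t" "t < r" "t < e" using r e by (auto simp: t_def)
  then have "t \<in> dom \<delta>" "d (fst \<delta>) (path \<delta> t) < r" using e by auto
  then show ?thesis using that r(2) path_notin_I by blast
qed

lemma side_src: "\<delta> \<in> darts \<Longrightarrow> fst \<delta> \<in> U2 \<Longrightarrow> side \<delta>" "\<delta> \<in> darts \<Longrightarrow> fst \<delta> \<in> U1 \<Longrightarrow> \<not> side \<delta>"
proof -
  assume \<delta>: "\<delta> \<in> darts"
  show "side \<delta>" if U: "fst \<delta> \<in> U2"
  proof -
    obtain t where "t \<in> dom \<delta>" "path \<delta> t \<in> U2" by (rule start_near[OF \<delta> U_open(2) U])
    then show ?thesis using side_point by blast
  qed
  show "\<not> side \<delta>" if U: "fst \<delta> \<in> U1"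
  proof -
    obtain t where "t \<in> dom \<delta>" "path \<delta> t \<in> U1" by (rule start_near[OF \<delta> U_open(1) U])
    then show ?thesis using side_point[of t \<delta>] U_disj by blast
  qed
qed

lemma side_tip: assumes \<delta>: "\<delta> \<in> darts" "unbounded \<delta>" shows "tip \<delta> \<in> U2 \<longleftrightarrow> side \<delta>"
proof -
  have ev: "\<exists>t\<in>dom \<delta>. path \<delta> t \<in> U" if "open U" "tip \<delta> \<in> U" for U
  proof -
    have "\<forall>\<^sub>F t in at_top. path \<delta> t \<in> U" by (rule topological_tendstoD[OF tip_limit[OF \<delta>] that])
    then obtain T where "\<forall>t\<ge>T. path \<delta> t \<in> U" by (auto simp: eventually_at_top_linorder)
    then have "path \<delta> (max T 1) \<in> U" "max T 1 \<in> dom \<delta>" using \<delta>(2) by (auto simp: unbounded_def)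
    then show ?thesis by (intro bexI)
  qed
  have "tip \<delta> \<notin> A" using tip(1)[OF \<delta>] A_D(1) by blast
  then have "tip \<delta> \<in> U1 \<or> tip \<delta> \<in> U2" using U_cover by blast
  then show ?thesis
  proof
    assume t: "tip \<delta> \<in> U1"
    then obtain t where "t \<in> dom \<delta>" "path \<delta> t \<in> U1" using ev[OF U_open(1)] by blast
    then have "\<not> side \<delta>" using side_point[of t \<delta>] U_disj by blast
    then show ?thesis using t U_disj by blast
  next
    assume t: "tip \<delta> \<in> U2"
    then obtain t where "t \<in> dom \<delta>" "path \<delta> t \<in> U2" using ev[OF U_open(2)] by blast
    then show ?thesis using side_point t by blast
  qed
qed

text \<open>Near \<open>v\<close> the curve consists of \<open>v\<close> and the initial pieces of
  its darts.\<close>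

lemma open_insert_vertex:
  assumes v: "v \<in> B" "v \<notin> I" and W: "open W" "\<forall>i<val v. path (v, i) ` dom (v, i) \<subseteq> W"
  shows "open (insert v W)"
proof -
  obtain e where e: "0 < e" "e \<le> rad v"
    "\<forall>i<val v. \<forall>t. 0 < t \<longrightarrow> t < e \<longrightarrow> t \<in> dom (v, i) \<and> path (v, i) t = arm v i t"
    by (rule arms_are_paths[OF v])
  let ?O = "{z. z \<notin> I \<and> d v z < e}"
  have "?O \<subseteq> insert v W"
  proof
    fix z assume z: "z \<in> ?O"
    then obtain j r where j: "j < val v" "0 \<le> r" "r < rad v" "z = arm v j r"
      using mstarD(7)[OF star[OF v(2)], of z] e(2) by auto
    have r: "r < e" using mstar_dist0[OF star[OF v(2)] j(1-3)] j(4) z by simp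
    show "z \<in> insert v W"
    proof (cases "r = 0")
      case True then show ?thesis using mstarD(4)[OF star[OF v(2)] j(1)] j(4) by simp
    next
      case False
      then have "r \<in> dom (v, j)" "z = path (v, j) r" using e(3) j r by auto
      then have "z \<in> path (v, j) ` dom (v, j)" by blast
      then show ?thesis using W(2) j(1) by blast
    qed
  qed
  moreover have "v \<in> ?O" using v(2) d_self e(1) by simp
  ultimately have "insert v W = ?O \<union> W" by blast
  then show ?thesis using open_ball[OF v(2)] W(1) by (metis open_Un)
qed

text \<open>Minimality of \<open>A\<close> enters only here: if both arms at \<open>a\<close> pointed to the same side, then
  \<open>A - {a}\<close> would still be a cut set.\<close>

lemma A_one: assumes a: "a \<in> A" shows "side (a, 0) \<noteq> side (a, 1)"
proof
  assume eq: "side (a, 0) = side (a, 1)"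
  have aB: "a \<in> B" "a \<notin> I" "val a = 2" using a A_B A_D by auto
  have arms: "\<forall>i<val a. side (a, i) = side (a, 0)"
    using eq by (auto simp: aB(3) less_2_cases_iff)
  have cut: "cut_set (A - {a})" if W: "W \<union> W' = - A" "W \<inter> W' = {}" "open W" "open W'" "W \<noteq> {}" "W' \<noteq> {}"
    "\<forall>i<val a. path (a, i) ` dom (a, i) \<subseteq> W" for W W'
  proof -
    have o: "open (insert a W)" by (rule open_insert_vertex[OF aB(1,2) W(3,7)])
    show ?thesis
      unfolding cut_set_def
    proof
      assume "connected (UNIV - (A - {a}))"
      then have "insert a W \<inter> (UNIV - (A - {a})) = {} \<or> W' \<inter> (UNIV - (A - {a})) = {}"
        by (rule connectedD[OF _ o W(4)]) (use W(1,2) a in blast)+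
      then show False using W(1,5,6) by blast
    qed
  qed
  show False
  proof (cases "side (a, 0)")
    case True
    have "cut_set (A - {a})"
      by (rule cut[of U2 U1]) (use U_cover U_disj U_open U_ne arms True in \<open>auto simp: side_def\<close>)
    then show False using A_min[OF a] by simp
  next
    case False
    have "\<forall>i<val a. path (a, i) ` dom (a, i) \<subseteq> U1" using arms False side_or by metis
    then have "cut_set (A - {a})"
      by (intro cut[of U1 U2]) (use U_cover U_disj U_open U_ne in auto)
    then show False using A_min[OF a] by simp
  qed
qed

text \<open>The darts along which chips leave \<open>A\<close> when the closure of \<open>U1\<close>
  is fired. By \<open>A_one\<close> there is exactly one at each point of \<open>A\<close>.\<close>

definition act :: "('a \<times> nat) set" where
  "act = {\<delta>\<in>darts. fst \<delta> \<in> A \<and> side \<delta>}"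

definition s :: "'a \<times> nat \<Rightarrow> int" where
  "s \<delta> = E (fst \<delta>)"

lemma act_D: "\<delta> \<in> act \<Longrightarrow> \<delta> \<in> darts" "\<delta> \<in> act \<Longrightarrow> fst \<delta> \<in> A" "\<delta> \<in> act \<Longrightarrow> side \<delta>" "\<delta> \<in> act \<Longrightarrow> 0 < s \<delta>"
  using A_D(3) by (auto simp: act_def s_def)

lemma finite_act: "finite act"
  using finite_darts by (simp add: act_def)

lemma act_inj: "inj_on fst act"
proof (rule inj_onI)
  fix \<delta> \<delta>' assume x: "\<delta> \<in> act" "\<delta>' \<in> act" "fst \<delta> = fst \<delta>'"
  obtain a i j where ij: "\<delta> = (a, i)" "\<delta>' = (a, j)" using x(3) by (metis prod.collapse)
  have a: "a \<in> A" using act_D(2)[OF x(1)] ij by simp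
  have "i < 2" "j < 2" using dartsD(3)[OF act_D(1)[OF x(1)]] dartsD(3)[OF act_D(1)[OF x(2)]] ij A_D(2)[OF a] by auto
  then have "i = j" using A_one[OF a] act_D(3)[OF x(1)] act_D(3)[OF x(2)] ij by (auto simp: less_2_cases_iff)
  then show "\<delta> = \<delta>'" using ij by simp
qed

lemma act_image: "fst ` act = A"
proof (intro equalityI subsetI)
  fix a assume a: "a \<in> A"
  have d: "(a, 0) \<in> darts" "(a, 1) \<in> darts" using a A_B A_D(1,2)[OF a] by (auto simp: darts_def)
  from A_one[OF a] have "(a, 0) \<in> act \<or> (a, 1) \<in> act" using a d by (auto simp: act_def)
  then show "a \<in> fst ` act" by force
qed (use act_D(2) in auto)

lemma card_act: "card act = card A"
  using card_image[OF act_inj] act_image by simp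

lemma act_ne: "act \<noteq> {}"
  using act_image A_ne by auto

lemma finite_smooth_support: "finite (smooth_support E)"
  by (rule finite_subset[OF _ E_fin]) (auto simp: smooth_support_def supp_def)

text \<open>Adding such an \<open>h\<close> to \<open>f\<close> lowers \<open>f\<close> at most
  inside \<open>U2\<close>, keeps the divisor effective and decreases the measure.\<close>

definition fired :: "('a \<Rightarrow> ereal) \<Rightarrow> bool" where
  "fired h \<longleftrightarrow> germs h \<and> (\<forall>x. x \<notin> I \<longrightarrow> fv h x \<le> 0) \<and> (\<forall>x. x \<notin> I \<longrightarrow> x \<notin> U2 \<longrightarrow> fv h x = 0) \<and>
     (\<forall>x. 0 \<le> E x + ord_at d I x h) \<and>
     card (smooth_support (\<lambda>x. E x + ord_at d I x h)) < card (smooth_support E)"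

text \<open>If one of the clusters faces an unbounded edge, it is enough to send this cluster alone
  to infinity. No other chip moves, and its starting point leaves the smooth support.\<close>

lemma fire_to_infinity:
  assumes \<delta>: "\<delta> \<in> act" "unbounded \<delta>"
  shows "\<exists>h. fired h"
proof -
  note dd = act_D[OF \<delta>(1)]
  define vert :: "'a \<Rightarrow> ereal" where "vert x = (if x = tip \<delta> then - \<infinity> else 0)" for x
  define u where "u \<delta>' t = (if \<delta>' = \<delta> then - of_int (s \<delta>) * t else 0)" for \<delta>' and t :: real
  define \<sigma> where "\<sigma> \<delta>' = (if \<delta>' = \<delta> then - s \<delta> else 0)" for \<delta>'
  define m where "m \<delta>' = (if \<delta>' = \<delta> then s \<delta> else 0)" for \<delta>'
  define a b where "a \<delta>' t = (if \<delta>' = \<delta> then - s \<delta> else 0)" and "b \<delta>' t = (if \<delta>' = \<delta> then s \<delta> else 0)"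
    for \<delta>' and t :: real
  have tI: "tip \<delta> \<in> I" by (rule tip(1)[OF dd(1) \<delta>(2)])
  have fst_tip: "fst \<delta>' \<noteq> tip \<delta>" if "\<delta>' \<in> darts" for \<delta>' using dartsD(2)[OF that] tI by auto
  obtain h where h: "germs h" "\<forall>x\<in>B. h x = vert x" "\<forall>\<delta>\<in>darts. \<forall>t\<in>dom \<delta>. h (path \<delta> t) = ereal (u \<delta> t)"
    "\<forall>x\<in>B - I. ord_at d I x h = (\<Sum>i<val x. \<sigma> (x, i))"
    "\<forall>\<delta>\<in>darts. \<forall>t\<in>dom \<delta>. ord_at d I (path \<delta> t) h = a \<delta> t + b \<delta> t"
    "\<forall>\<delta>\<in>darts. unbounded \<delta> \<longrightarrow> ord_at d I (tip \<delta>) h = m \<delta>"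
  proof (rule build_germs[of vert u \<sigma> a b m])
    show "\<bar>vert x\<bar> \<noteq> \<infinity>" if "x \<in> B" "x \<notin> I" for x using that tI by (auto simp: vert_def)
    show "u (rev \<delta>') (len \<delta>' - t) = u \<delta>' t" if "\<delta>' \<in> darts" "\<not> unbounded \<delta>'" "t \<in> dom \<delta>'" for \<delta>' t
      using that \<delta>(2) bounded(8)[OF that(1,2)] by (auto simp: u_def)
    show "\<exists>e>0. \<forall>t. 0 < t \<longrightarrow> t < e \<longrightarrow> u \<delta>' t = fv vert (fst \<delta>') + of_int (\<sigma> \<delta>') * t" if "\<delta>' \<in> darts" for \<delta>'
      using fst_tip[OF that] by (intro exI[of _ 1]) (simp add: u_def \<sigma>_def vert_def)
    show "\<exists>e>0. \<forall>r. 0 < r \<longrightarrow> r < e \<longrightarrow>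
        u \<delta>' (t + r) = u \<delta>' t + of_int (a \<delta>' t) * r \<and> u \<delta>' (t - r) = u \<delta>' t + of_int (b \<delta>' t) * r" for \<delta>' t
      by (intro exI[of _ 1]) (simp add: u_def a_def b_def algebra_simps)
    show "\<exists>T k. (\<forall>w>T. u \<delta>' w = k - of_int (m \<delta>') * w) \<and> vert (tip \<delta>') = endval k (m \<delta>')"
      if "\<delta>' \<in> darts" "unbounded \<delta>'" for \<delta>'
      using tip_inj[OF that dd(1) \<delta>(2)] dd(4)
      by (intro exI[of _ 0]) (auto simp: u_def m_def vert_def endval_def zero_ereal_def)
  qed (rule that)
  have ordB: "ord_at d I x h = (if x = fst \<delta> then - s \<delta> else 0)" if x: "x \<in> B" "x \<notin> I" for x
  proof -
    have "ord_at d I x h = (\<Sum>i<val x. \<sigma> (x, i))" using h(4) x by simp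
    also have "\<dots> = (\<Sum>i<val x. if i = snd \<delta> \<and> x = fst \<delta> then - s \<delta> else 0)"
      by (rule sum.cong) (auto simp: \<sigma>_def prod_eq_iff)
    also have "\<dots> = (if x = fst \<delta> then - s \<delta> else 0)"
      using dartsD(3)[OF dd(1)] by (auto simp: sum.delta)
    finally show ?thesis .
  qed
  have ordP: "ord_at d I x h = 0" if x: "x \<notin> B" for x
  proof -
    obtain \<delta>' where \<delta>': "\<delta>' \<in> darts" "x \<in> path \<delta>' ` dom \<delta>'" using cover(1)[OF x] by (elim bexE)
    obtain t where t: "t \<in> dom \<delta>'" "x = path \<delta>' t" using \<delta>'(2) by (elim imageE)
    have "ord_at d I (path \<delta>' t) h = a \<delta>' t + b \<delta>' t" using h(5) \<delta>'(1) t(1) by simp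
    then show ?thesis unfolding t(2) by (simp add: a_def b_def)
  qed
  have ordI: "0 \<le> ord_at d I x h" if x: "x \<in> I" for x
  proof -
    obtain \<delta>' where "\<delta>' \<in> darts" "unbounded \<delta>'" "tip \<delta>' = x" by (rule tip_surj[OF x])
    then have "ord_at d I x h = m \<delta>'" using h(6) by auto
    then show ?thesis using dd(4) by (simp add: m_def)
  qed
  have nn: "0 \<le> E x + ord_at d I x h" for x
  proof (cases "x \<in> I")
    case False
    then show ?thesis using ordB[of x] ordP[of x] E_nonneg[of x] by (cases "x \<in> B") (auto simp: s_def)
  qed (use ordI E_nonneg[of x] in simp)
  have val_h: "fv h x \<le> 0 \<and> (x \<notin> U2 \<longrightarrow> fv h x = 0)" if x: "x \<notin> I" for x
  proof (cases "x \<in> B")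
    case True
    then have "h x = vert x" using h(2) by simp
    moreover have "x \<noteq> tip \<delta>" using x tI by auto
    ultimately show ?thesis by (simp add: vert_def)
  next
    case False
    obtain \<delta>' where \<delta>': "\<delta>' \<in> darts" "x \<in> path \<delta>' ` dom \<delta>'" using cover(1)[OF False] by (elim bexE)
    obtain t where t: "t \<in> dom \<delta>'" "x = path \<delta>' t" using \<delta>'(2) by (elim imageE)
    have hx: "h x = ereal (u \<delta>' t)" using h(3) \<delta>'(1) t by simp
    have t0: "0 < t" by (rule dom_pos[OF t(1)])
    show ?thesis
    proof (cases "\<delta>' = \<delta>")
      case True
      then have "x \<in> U2" using side_point[of t \<delta>] t dd(3) by simp
      moreover have "0 \<le> real_of_int (s \<delta>) * t" using dd(4) t0 by simp
      ultimately show ?thesis using hx True by (simp add: u_def)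
    qed (use hx in \<open>simp add: u_def\<close>)
  qed
  have "fst \<delta> \<in> smooth_support E" using A_smooth dd(2) by blast
  moreover have "smooth_support (\<lambda>x. E x + ord_at d I x h) \<subseteq> smooth_support E - {fst \<delta>}"
  proof
    fix x assume "x \<in> smooth_support (\<lambda>x. E x + ord_at d I x h)"
    then have x: "x \<notin> I" "val x = 2" "E x + ord_at d I x h \<noteq> 0" by (auto simp: smooth_support_def)
    have "x \<noteq> fst \<delta>" using x(1,3) ordB[of x] A_B dd(2) by (auto simp: s_def)
    moreover have "E x \<noteq> 0" using x ordB[of x] ordP[of x] calculation by (cases "x \<in> B") auto
    ultimately show "x \<in> smooth_support E - {fst \<delta>}" using x by (simp add: smooth_support_def)
  qed
  ultimately have "card (smooth_support (\<lambda>x. E x + ord_at d I x h)) < card (smooth_support E)"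
    by (intro psubset_card_mono[OF finite_smooth_support]) blast
  then show ?thesis using h(1) nn val_h unfolding fired_def by blast
qed

text \<open>A chip cluster of size \<open>s \<delta>\<close> moves along its dart at speed \<open>1 / s \<delta>\<close>. The time \<open>c\<close> is the
  first moment at which a cluster reaches the end of its dart or collides with another one, so
  that a point of the smooth support is lost.\<close>

lemma fire_until_collision:
  assumes bd: "\<And>\<delta>. \<delta> \<in> act \<Longrightarrow> \<not> unbounded \<delta>"
  shows "\<exists>h. fired h"
proof -
  define rv where "rv \<delta> \<longleftrightarrow> \<not> unbounded \<delta> \<and> rev \<delta> \<in> act" for \<delta>
  \<comment> \<open>The time until the edge is used up: its length divided by the speed of its
    cluster, increased by the speed of a cluster that comes from the other end.\<close>
  define r where "r \<delta> = len \<delta> / (1 / s \<delta> + (if rv \<delta> then 1 / s (rev \<delta>) else 0))" for \<delta>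
  define c where "c = Min (r ` act)"
  define reach where "reach \<delta> = c / s \<delta>" for \<delta>
  have rv_rev: "rv (rev \<delta>) \<longleftrightarrow> \<delta> \<in> act" if "\<delta> \<in> darts" "\<not> unbounded \<delta>" for \<delta>
    using bounded(8,9)[OF that] by (simp add: rv_def)
  have sp: "0 < real_of_int (s \<delta>)" if "\<delta> \<in> act" for \<delta> using act_D(4)[OF that] by simp
  have len_pos: "0 < len \<delta>" if "\<delta> \<in> act" for \<delta> by (rule bounded(1)[OF act_D(1)[OF that] bd[OF that]])
  have den: "0 < 1 / real_of_int (s \<delta>) + (if rv \<delta> then 1 / s (rev \<delta>) else 0)" if "\<delta> \<in> act" for \<delta>
    using sp[OF that] sp[of "rev \<delta>"] by (auto simp: rv_def intro!: add_pos_nonneg)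
  have r_pos: "0 < r \<delta>" if "\<delta> \<in> act" for \<delta> unfolding r_def using len_pos[OF that] den[OF that] by simp
  have c_in: "c \<in> r ` act" unfolding c_def using finite_act act_ne by (intro Min_in) auto
  then have c_pos: "0 < c" using r_pos by auto
  have c_le: "c \<le> r \<delta>" if "\<delta> \<in> act" for \<delta> unfolding c_def using finite_act that by (intro Min_le) auto
  have l_pos: "0 < reach \<delta>" if "\<delta> \<in> act" for \<delta> unfolding reach_def using c_pos sp[OF that] by simp
  have sl: "real_of_int (s \<delta>) * reach \<delta> = c" if "\<delta> \<in> act" for \<delta> unfolding reach_def using sp[OF that] by simp
  have l_sum: "reach \<delta> + (if rv \<delta> then reach (rev \<delta>) else 0) = c * (1 / real_of_int (s \<delta>) + (if rv \<delta> then 1 / s (rev \<delta>) else 0))" for \<delta>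
    by (simp add: reach_def algebra_simps)
  have l_le: "reach \<delta> + (if rv \<delta> then reach (rev \<delta>) else 0) \<le> len \<delta>" if "\<delta> \<in> act" for \<delta>
    unfolding l_sum using c_le[OF that] den[OF that] by (simp only: r_def pos_le_divide_eq)
  \<comment> \<open>A dart that attains the minimum: on it the cluster arrives at the end or
    collides, which accounts for the lost support point.\<close>
  obtain \<delta>0 where \<delta>0: "\<delta>0 \<in> act" "c = r \<delta>0" using c_in by (elim imageE)
  have l_eq: "reach \<delta>0 + (if rv \<delta>0 then reach (rev \<delta>0) else 0) = len \<delta>0"
  proof -
    have "x / y * y = x" if "0 < y" for x y :: real using that by simp
    from this[OF den[OF \<delta>0(1)]] show ?thesis unfolding l_sum \<delta>0(2) r_def .
  qed
  \<comment> \<open>\<open>lo\<close> and \<open>hi\<close> are the final positions on a dart of the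
    clusters from its start and from its far end; \<open>lo\<close> is 0 if no cluster starts
    there.\<close>
  define lo where "lo \<delta> = (if \<delta> \<in> act then reach \<delta> else 0)" for \<delta>
  define hi where "hi \<delta> = len \<delta> - reach (rev \<delta>)" for \<delta>
  have lo_hi: "lo \<delta> \<le> hi \<delta> \<and> hi \<delta> < len \<delta> \<and> real_of_int (s (rev \<delta>)) * (len \<delta> - hi \<delta>) = c" if \<delta>: "\<delta> \<in> darts" "rv \<delta>" for \<delta>
  proof -
    have b: "\<not> unbounded \<delta>" "rev \<delta> \<in> act" using \<delta>(2) by (auto simp: rv_def)
    have "lo \<delta> \<le> hi \<delta>"
    proof (cases "\<delta> \<in> act")
      case True then show ?thesis using l_le[OF True] \<delta>(2) by (simp add: lo_def hi_def)
    next
      case False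
      then have "\<not> rv (rev \<delta>)" using rv_rev[OF \<delta>(1) b(1)] by simp
      then show ?thesis using l_le[OF b(2)] False bounded(7)[OF \<delta>(1) b(1)] by (simp add: lo_def hi_def)
    qed
    then show ?thesis using l_pos[OF b(2)] sl[OF b(2)] by (simp add: hi_def)
  qed
  have lo_act: "lo \<delta> = reach \<delta>" "0 < lo \<delta>" "real_of_int (s \<delta>) * lo \<delta> = c" if "\<delta> \<in> act" for \<delta>
    using that l_pos[OF that] sl[OF that] by (simp_all add: lo_def)
  have lo0: "0 \<le> lo \<delta>" for \<delta> using l_pos[of \<delta>] by (auto simp: lo_def intro: less_imp_le)

  define vert :: "'a \<Rightarrow> ereal" where "vert x = (if x \<in> U2 then ereal (- c) else 0)" for x
  \<comment> \<open>On an edge in \<open>U2\<close> the profile falls from 0 to \<open>- c\<close>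
    at \<open>lo\<close> when a cluster starts there, stays at \<open>- c\<close> up to
    \<open>hi\<close>, and rises to 0 at a far end in \<open>A\<close>. The moved chips sit at the
    corners, and the speed \<open>1 / s\<close> brings all clusters to depth \<open>c\<close> at the
    same time.\<close>
  define u where "u \<delta> t = (if \<not> side \<delta> then 0 else if \<delta> \<in> act \<and> t < lo \<delta> then - of_int (s \<delta>) * t
      else if rv \<delta> \<and> hi \<delta> < t then - of_int (s (rev \<delta>)) * (len \<delta> - t) else - c)" for \<delta> and t :: real
  \<comment> \<open>If \<open>hi\<close> is 0, the cluster from the far end stops exactly at the
    start vertex of the dart, which then receives its chips.\<close>
  define \<sigma> where "\<sigma> \<delta> = (if \<not> side \<delta> then 0 else if \<delta> \<in> act then - s \<delta>
      else if rv \<delta> \<and> hi \<delta> = 0 then s (rev \<delta>) else 0)" for \<delta>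
  define a where "a \<delta> t = (if \<not> side \<delta> then 0 else if \<delta> \<in> act \<and> t < lo \<delta> then - s \<delta>
      else if rv \<delta> \<and> hi \<delta> \<le> t then s (rev \<delta>) else 0)" for \<delta> and t :: real
  define b where "b \<delta> t = (if \<not> side \<delta> then 0 else if \<delta> \<in> act \<and> t \<le> lo \<delta> then s \<delta>
      else if rv \<delta> \<and> hi \<delta> < t then - s (rev \<delta>) else 0)" for \<delta> and t :: real
  have src: "fst \<delta> \<in> A \<and> \<delta> \<in> act \<or> fst \<delta> \<in> U2 \<and> \<delta> \<notin> act" if "\<delta> \<in> darts" "side \<delta>" for \<delta>
  proof (cases "fst \<delta> \<in> A")
    case False
    then have "fst \<delta> \<in> U1 \<or> fst \<delta> \<in> U2" using U_cover by blast
    then have "fst \<delta> \<in> U2" using side_src(2)[OF that(1)] that(2) by blast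
    then show ?thesis using False act_D(2) by blast
  qed (use that in \<open>simp add: act_def\<close>)
  have src0: "fst \<delta> \<notin> U2" if "\<delta> \<in> darts" "\<not> side \<delta>" for \<delta> using side_src(1)[OF that(1)] that(2) by blast
  have AU: "x \<notin> U2" if "x \<in> A" for x using that U_cover by blast

  obtain h where h: "germs h" "\<forall>x\<in>B. h x = vert x" "\<forall>\<delta>\<in>darts. \<forall>t\<in>dom \<delta>. h (path \<delta> t) = ereal (u \<delta> t)"
    "\<forall>x\<in>B - I. ord_at d I x h = (\<Sum>i<val x. \<sigma> (x, i))"
    "\<forall>\<delta>\<in>darts. \<forall>t\<in>dom \<delta>. ord_at d I (path \<delta> t) h = a \<delta> t + b \<delta> t"
    "\<forall>\<delta>\<in>darts. unbounded \<delta> \<longrightarrow> ord_at d I (tip \<delta>) h = 0"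
  proof (rule build_germs[of vert u \<sigma> a b "\<lambda>_. 0"])
    show "\<bar>vert x\<bar> \<noteq> \<infinity>" for x by (simp add: vert_def)
  next
    fix \<delta> t assume \<delta>: "\<delta> \<in> darts" "\<not> unbounded \<delta>" and t: "t \<in> dom \<delta>"
    note bb = bounded[OF \<delta>]
    have sd: "side (rev \<delta>) \<longleftrightarrow> side \<delta>" by (rule side_rev[OF \<delta>])
    have r1: "rev \<delta> \<in> act \<longleftrightarrow> rv \<delta>" using \<delta>(2) by (simp add: rv_def)
    have r2: "rv (rev \<delta>) \<longleftrightarrow> \<delta> \<in> act" by (rule rv_rev[OF \<delta>])
    have lor: "lo (rev \<delta>) = len \<delta> - hi \<delta>" if "rv \<delta>" using that r1 by (simp add: lo_def hi_def)
    have hir: "hi (rev \<delta>) = len \<delta> - lo \<delta>" if "\<delta> \<in> act" using that bb(7,9) by (simp add: lo_def hi_def)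
    show "u (rev \<delta>) (len \<delta> - t) = u \<delta> t"
    proof (cases "\<delta> \<in> act \<and> t < lo \<delta>")
      case True
      then have "\<not> (rv \<delta> \<and> hi \<delta> < t)" using lo_hi[OF \<delta>(1)] by auto
      then show ?thesis using True sd r1 r2 lor hir bb(7,9) by (auto simp: u_def)
    next
      case False
      then show ?thesis using sd r1 r2 lor hir bb(7,9) by (auto simp: u_def)
    qed
  next
    fix \<delta> assume \<delta>: "\<delta> \<in> darts"
    show "\<exists>e>0. \<forall>t. 0 < t \<longrightarrow> t < e \<longrightarrow> u \<delta> t = fv vert (fst \<delta>) + of_int (\<sigma> \<delta>) * t"
    proof (cases "side \<delta>")
      case False
      then show ?thesis using src0[OF \<delta> False] by (intro exI[of _ 1]) (simp add: u_def \<sigma>_def vert_def)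
    next
      case True
      show ?thesis
      proof (cases "\<delta> \<in> act")
        case act: True
        have "fst \<delta> \<notin> U2" using act_D(2)[OF act] AU by blast
        then show ?thesis using True act lo_act[OF act]
          by (intro exI[of _ "lo \<delta>"]) (simp add: u_def \<sigma>_def vert_def)
      next
        case nact: False
        then have v: "fv vert (fst \<delta>) = - c" using src[OF \<delta> True] by (simp add: vert_def)
        show ?thesis
        proof (cases "rv \<delta>")
          case rv: True
          note lh = lo_hi[OF \<delta> rv]
          have hi0: "0 \<le> hi \<delta>" using lh lo0[of \<delta>] by simp
          show ?thesis
          proof (cases "hi \<delta> = 0")
            case h0: True
            have "- (real_of_int (s (rev \<delta>)) * (len \<delta> - t)) = - c + of_int (s (rev \<delta>)) * t" for t
              using lh h0 by (simp add: algebra_simps)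
            then show ?thesis using True nact rv h0 v by (intro exI[of _ 1]) (simp add: u_def \<sigma>_def)
          next
            case False
            then show ?thesis using True nact rv v hi0
              by (intro exI[of _ "hi \<delta>"]) (simp add: u_def \<sigma>_def)
          qed
        next
          case False
          then show ?thesis using True nact v by (intro exI[of _ 1]) (simp add: u_def \<sigma>_def)
        qed
      qed
    qed
  next
    fix \<delta> t assume \<delta>: "\<delta> \<in> darts" and t: "t \<in> dom \<delta>"
    have right: "\<exists>e>0. \<forall>r. 0 < r \<longrightarrow> r < e \<longrightarrow> u \<delta> (t + r) = u \<delta> t + of_int (a \<delta> t) * r"
    proof -
      consider "\<not> side \<delta>" | "side \<delta>" "\<delta> \<in> act" "t < lo \<delta>" | "side \<delta>" "\<not> (\<delta> \<in> act \<and> t < lo \<delta>)" "rv \<delta>" "hi \<delta> \<le> t"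
        | "side \<delta>" "\<not> (\<delta> \<in> act \<and> t < lo \<delta>)" "rv \<delta>" "t < hi \<delta>" | "side \<delta>" "\<not> (\<delta> \<in> act \<and> t < lo \<delta>)" "\<not> rv \<delta>"
        by linarith
      then show ?thesis
      proof cases
        case 1 then show ?thesis by (intro exI[of _ 1]) (simp add: u_def a_def)
      next
        case 2 then show ?thesis by (intro exI[of _ "lo \<delta> - t"]) (simp add: u_def a_def algebra_simps)
      next
        case 3
        note lh = lo_hi[OF \<delta> 3(3)]
        have ut: "u \<delta> t = - (of_int (s (rev \<delta>)) * (len \<delta> - t))"
          using 3 lh by (cases "t = hi \<delta>") (auto simp: u_def)
        have "u \<delta> (t + r) = - (of_int (s (rev \<delta>)) * (len \<delta> - (t + r)))" if "0 < r" for r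
          using 3 that by (auto simp: u_def)
        moreover have "a \<delta> t = s (rev \<delta>)" using 3 by (auto simp: a_def)
        ultimately show ?thesis unfolding ut by (intro exI[of _ 1]) (simp add: algebra_simps)
      next
        case 4
        then have "u \<delta> (t + r) = - c" if "0 < r" "r < hi \<delta> - t" for r
          using that by (auto simp: u_def)
        moreover have "u \<delta> t = - c" "a \<delta> t = 0" using 4 by (auto simp: u_def a_def)
        ultimately show ?thesis using 4(4) by (intro exI[of _ "hi \<delta> - t"]) simp
      next
        case 5
        then have "u \<delta> (t + r) = - c" if "0 < r" for r
          using that by (auto simp: u_def)
        moreover have "u \<delta> t = - c" "a \<delta> t = 0" using 5 by (auto simp: u_def a_def)
        ultimately show ?thesis by (intro exI[of _ 1]) simp
      qed
    qed
    have left: "\<exists>e>0. \<forall>r. 0 < r \<longrightarrow> r < e \<longrightarrow> u \<delta> (t - r) = u \<delta> t + of_int (b \<delta> t) * r"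
    proof -
      consider "\<not> side \<delta>" | "side \<delta>" "\<delta> \<in> act" "t \<le> lo \<delta>" | "side \<delta>" "\<not> (\<delta> \<in> act \<and> t \<le> lo \<delta>)" "rv \<delta>" "hi \<delta> < t"
        | "side \<delta>" "\<not> (\<delta> \<in> act \<and> t \<le> lo \<delta>)" "\<not> (rv \<delta> \<and> hi \<delta> < t)"
        by linarith
      then show ?thesis
      proof cases
        case 1 then show ?thesis by (intro exI[of _ 1]) (simp add: u_def b_def)
      next
        case 2
        have "\<not> (rv \<delta> \<and> hi \<delta> < t)" using lo_hi[OF \<delta>] 2(3) by auto
        then have ut: "u \<delta> t = - (of_int (s \<delta>) * t)"
          using 2 lo_act(3)[OF 2(2)] by (cases "t = lo \<delta>") (auto simp: u_def)
        have "u \<delta> (t - r) = - (of_int (s \<delta>) * (t - r))" if "0 < r" for r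
          using 2 that by (auto simp: u_def)
        moreover have "b \<delta> t = s \<delta>" using 2 by (auto simp: b_def)
        ultimately show ?thesis unfolding ut by (intro exI[of _ 1]) (simp add: algebra_simps)
      next
        case 3
        note lh = lo_hi[OF \<delta> 3(3)]
        have ut: "u \<delta> t = - (of_int (s (rev \<delta>)) * (len \<delta> - t))" using 3 lh by (auto simp: u_def)
        have "u \<delta> (t - r) = - (of_int (s (rev \<delta>)) * (len \<delta> - (t - r)))" if "0 < r" "r < t - hi \<delta>" for r
          using 3 that lh by (auto simp: u_def)
        moreover have "b \<delta> t = - s (rev \<delta>)" using 3 by (auto simp: b_def)
        ultimately show ?thesis unfolding ut using 3(4)
          by (intro exI[of _ "t - hi \<delta>"]) (simp add: algebra_simps)
      next
        case 4
        define e where "e = (if \<delta> \<in> act then t - lo \<delta> else 1)"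
        have e: "0 < e" using 4 by (auto simp: e_def)
        have "u \<delta> (t - r) = - c" if "0 < r" "r < e" for r
          using 4 that by (auto simp: u_def e_def)
        moreover have "u \<delta> t = - c" "b \<delta> t = 0" using 4 by (auto simp: u_def b_def)
        ultimately show ?thesis using e by (intro exI[of _ e]) simp
      qed
    qed
    obtain e1 where e1: "0 < e1" "\<forall>r. 0 < r \<longrightarrow> r < e1 \<longrightarrow> u \<delta> (t + r) = u \<delta> t + of_int (a \<delta> t) * r"
      using right by (elim exE conjE)
    obtain e2 where e2: "0 < e2" "\<forall>r. 0 < r \<longrightarrow> r < e2 \<longrightarrow> u \<delta> (t - r) = u \<delta> t + of_int (b \<delta> t) * r"
      using left by (elim exE conjE)
    show "\<exists>e>0. \<forall>r. 0 < r \<longrightarrow> r < e \<longrightarrow>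
        u \<delta> (t + r) = u \<delta> t + of_int (a \<delta> t) * r \<and> u \<delta> (t - r) = u \<delta> t + of_int (b \<delta> t) * r"
      using e1 e2 by (intro exI[of _ "min e1 e2"]) simp
  next
    fix \<delta> assume \<delta>: "\<delta> \<in> darts" "unbounded \<delta>"
    have "\<delta> \<notin> act" using bd \<delta>(2) by blast
    moreover have "\<not> rv \<delta>" using \<delta>(2) by (simp add: rv_def)
    ultimately have "u \<delta> w = (if side \<delta> then - c else 0)" for w by (simp add: u_def)
    moreover have "vert (tip \<delta>) = endval (if side \<delta> then - c else 0) 0"
      using side_tip[OF \<delta>] by (simp add: vert_def endval_def zero_ereal_def)
    ultimately show "\<exists>T k. (\<forall>w>T. u \<delta> w = k - of_int 0 * w) \<and> vert (tip \<delta>) = endval k 0"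
      by (intro exI[of _ 0] exI[of _ "if side \<delta> then - c else 0"]) simp
  qed (rule that)

  have ab: "0 \<le> a \<delta> t + b \<delta> t"
    "a \<delta> t + b \<delta> t \<noteq> 0 \<Longrightarrow> \<delta> \<in> act \<and> t = reach \<delta> \<or> rv \<delta> \<and> t = hi \<delta>" if \<delta>: "\<delta> \<in> darts" for \<delta> t
  proof -
    have *: "0 \<le> a \<delta> t + b \<delta> t \<and> (a \<delta> t + b \<delta> t \<noteq> 0 \<longrightarrow> \<delta> \<in> act \<and> t = reach \<delta> \<or> rv \<delta> \<and> t = hi \<delta>)"
    proof -
      consider "\<not> side \<delta>" | "side \<delta>" "\<delta> \<in> act" "t < lo \<delta>" | "side \<delta>" "\<delta> \<in> act" "t = lo \<delta>"
        | "side \<delta>" "\<not> (\<delta> \<in> act \<and> t \<le> lo \<delta>)" by linarith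
      then show ?thesis
      proof cases
        case 3
        have "0 \<le> (if rv \<delta> \<and> hi \<delta> \<le> t then s (rev \<delta>) else 0)"
          using act_D(4)[of "rev \<delta>"] by (auto simp: rv_def)
        then show ?thesis using 3 act_D(4)[OF 3(2)] lo_act(1)[OF 3(2)] by (auto simp: a_def b_def)
      next
        case 4
        then show ?thesis using act_D(4)[of "rev \<delta>"] by (auto simp: a_def b_def rv_def)
      qed (auto simp: a_def b_def)
    qed
    show "0 \<le> a \<delta> t + b \<delta> t" "a \<delta> t + b \<delta> t \<noteq> 0 \<Longrightarrow> \<delta> \<in> act \<and> t = reach \<delta> \<or> rv \<delta> \<and> t = hi \<delta>"
      using * by blast+
  qed
  \<comment> \<open>Exactly one of the two darts at \<open>x\<close> is active, so all
    \<open>E x\<close> chips leave.\<close>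
  have ordA: "E x + ord_at d I x h = 0" if x: "x \<in> A" for x
  proof -
    have xB: "x \<in> B" "x \<notin> I" "val x = 2" using x A_B A_D by auto
    have dr: "(x, 0) \<in> darts" "(x, 1) \<in> darts" using xB by (auto simp: darts_def)
    have "\<sigma> (x, i) = (if side (x, i) then - E x else 0)" if "(x, i) \<in> darts" for i
      using src[OF that] AU[OF x] by (auto simp: \<sigma>_def s_def)
    then have "\<sigma> (x, 0) + \<sigma> (x, 1) = - E x" using dr A_one[OF x] by auto
    then show ?thesis using h(4) xB by (simp add: numeral_2_eq_2)
  qed
  have ordB: "0 \<le> ord_at d I x h" if x: "x \<in> B" "x \<notin> I" "x \<notin> A" for x
  proof -
    have "0 \<le> \<sigma> (x, i)" for i
    proof -
      have "(x, i) \<notin> act" using x(3) act_D(2)[of "(x, i)"] by auto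
      then show ?thesis using act_D(4)[of "rev (x, i)"] by (auto simp: \<sigma>_def rv_def)
    qed
    then have "0 \<le> (\<Sum>i<val x. \<sigma> (x, i))" by (intro sum_nonneg) auto
    then show ?thesis using h(4) x by simp
  qed
  have rep: "\<exists>\<delta>\<in>darts. \<exists>t\<in>dom \<delta>. x = path \<delta> t" if x: "x \<notin> B" for x
  proof -
    obtain \<delta> where \<delta>: "\<delta> \<in> darts" "x \<in> path \<delta> ` dom \<delta>" using cover(1)[OF x] by (elim bexE)
    obtain t where t: "t \<in> dom \<delta>" "x = path \<delta> t" using \<delta>(2) by (elim imageE)
    show ?thesis using \<delta>(1) t by (intro bexI)
  qed
  have nn: "0 \<le> E x + ord_at d I x h" for x
  proof -
    consider "x \<in> I" | "x \<in> A" | "x \<in> B" "x \<notin> I" "x \<notin> A" | "x \<notin> B" by blast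
    then show ?thesis
    proof cases
      case 1
      then obtain \<delta> where "\<delta> \<in> darts" "unbounded \<delta>" "tip \<delta> = x" by (rule tip_surj)
      then have "ord_at d I x h = 0" using h(6) by auto
      then show ?thesis using E_nonneg[of x] by simp
    next
      case 2 then show ?thesis using ordA by simp
    next
      case 3 then show ?thesis using ordB[OF 3] E_nonneg[of x] by simp
    next
      case 4
      obtain \<delta> t where t: "\<delta> \<in> darts" "t \<in> dom \<delta>" "x = path \<delta> t" using rep[OF 4] by (elim bexE)
      have "ord_at d I (path \<delta> t) h = a \<delta> t + b \<delta> t" using h(5) t(1,2) by simp
      then show ?thesis using ab(1)[OF t(1), of t] E_nonneg[of x] t(3) by simp
    qed
  qed
  have val_h: "fv h x \<le> 0 \<and> (x \<notin> U2 \<longrightarrow> fv h x = 0)" if x: "x \<notin> I" for x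
  proof (cases "x \<in> B")
    case True
    then show ?thesis using h(2) c_pos by (simp add: vert_def)
  next
    case False
    obtain \<delta> t where t: "\<delta> \<in> darts" "t \<in> dom \<delta>" "x = path \<delta> t" using rep[OF False] by (elim bexE)
    have hx: "h x = ereal (u \<delta> t)" using h(3) t by simp
    have t0: "0 < t" by (rule dom_pos[OF t(2)])
    have 1: "- (real_of_int (s \<delta>) * t) \<le> 0" if "\<delta> \<in> act" using sp[OF that] t0 by simp
    have 2: "- (real_of_int (s (rev \<delta>)) * (len \<delta> - t)) \<le> 0" if "rv \<delta>"
    proof -
      have nu: "\<not> unbounded \<delta>" "rev \<delta> \<in> act" using that by (auto simp: rv_def)
      have "t < len \<delta>" using bounded(2)[OF t(1) nu(1)] t(2) by simp
      then have "0 \<le> real_of_int (s (rev \<delta>)) * (len \<delta> - t)"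
        using sp[OF nu(2)]  by (intro mult_nonneg_nonneg) auto
      then show ?thesis by simp
    qed
    have "u \<delta> t \<le> 0" using 1 2 c_pos by (auto simp: u_def)
    moreover have "u \<delta> t = 0" if "x \<notin> U2" using side_point[OF t(2)] that t(3) by (simp add: u_def)
    ultimately show ?thesis using hx by simp
  qed
  \<comment> \<open>New support points can only be final positions of clusters. The dart
    \<open>\<delta>0\<close> is left out so that there are fewer of them than points of
    \<open>A\<close>.\<close>
  define P where "P = (\<lambda>\<delta>. path \<delta> (reach \<delta>)) ` (act - {\<delta>0})"
  have finP: "finite P" using finite_act by (simp add: P_def)
  have cardP: "card P < card A"
  proof -
    have "card P \<le> card (act - {\<delta>0})" unfolding P_def using finite_act by (intro card_image_le) auto
    also have "\<dots> < card act" using finite_act \<delta>0(1) by (rule card_Diff1_less)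
    finally show ?thesis by (simp add: card_act)
  qed
  \<comment> \<open>The position of the cluster on \<open>\<delta>0\<close> is interior to the edge
    only after a collision, and then it is also the position of the cluster on
    \<open>rev \<delta>0\<close>.\<close>
  have in_P: "path \<delta> (reach \<delta>) \<in> P" if \<delta>: "\<delta> \<in> act" "reach \<delta> \<in> dom \<delta>" for \<delta>
  proof (cases "\<delta> = \<delta>0")
    case True
    have nu: "\<not> unbounded \<delta>" by (rule bd[OF \<delta>(1)])
    note bb = bounded[OF act_D(1)[OF \<delta>(1)] nu]
    have ll: "0 < reach \<delta>" "reach \<delta> < len \<delta>" using \<delta>(2) bb(2) by auto
    have rvd: "rv \<delta>" using l_eq ll True by (cases "rv \<delta>0") auto
    then have e: "reach (rev \<delta>) = len \<delta> - reach \<delta>" using l_eq True by simp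
    have "path \<delta> (reach \<delta>) = path (rev \<delta>) (reach (rev \<delta>))" using bb(6)[OF ll] e by simp
    moreover have "rev \<delta> \<in> act - {\<delta>0}" using rvd True bb(4) by (simp add: rv_def)
    ultimately show ?thesis unfolding P_def by (rule image_eqI[of _ _ "rev \<delta>"])
  next
    case False then show ?thesis unfolding P_def using \<delta>(1) by (intro imageI) simp
  qed
  have sub: "smooth_support (\<lambda>x. E x + ord_at d I x h) \<subseteq> (smooth_support E - A) \<union> P"
  proof
    fix x assume "x \<in> smooth_support (\<lambda>x. E x + ord_at d I x h)"
    then have x: "x \<notin> I" "val x = 2" "E x + ord_at d I x h \<noteq> 0" by (auto simp: smooth_support_def)
    have nA: "x \<notin> A" using x(3) ordA by blast
    show "x \<in> (smooth_support E - A) \<union> P"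
    proof (cases "E x = 0")
      case False then show ?thesis using x nA by (simp add: smooth_support_def)
    next
      case True
      then have nB: "x \<notin> B" using E_B x by blast
      obtain \<delta> t where t: "\<delta> \<in> darts" "t \<in> dom \<delta>" "x = path \<delta> t" using rep[OF nB] by (elim bexE)
      have "ord_at d I (path \<delta> t) h = a \<delta> t + b \<delta> t" using h(5) t(1,2) by simp
      then have "a \<delta> t + b \<delta> t \<noteq> 0" using x(3) True t(3) by simp
      from ab(2)[OF t(1) this] have "x \<in> P"
      proof (elim disjE conjE)
        assume "\<delta> \<in> act" "t = reach \<delta>"
        then show ?thesis using in_P t by simp
      next
        assume rvd: "rv \<delta>" and th: "t = hi \<delta>"
        then have nu: "\<not> unbounded \<delta>" "rev \<delta> \<in> act" by (auto simp: rv_def)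
        note bb = bounded[OF t(1) nu(1)]
        have tl: "0 < t" "t < len \<delta>" using t(2) bb(2) by auto
        have l: "len \<delta> - t = reach (rev \<delta>)" using th by (simp add: hi_def)
        have "len \<delta> - t \<in> dom (rev \<delta>)" unfolding bb(5) using tl by simp
        then have "path (rev \<delta>) (reach (rev \<delta>)) \<in> P" using in_P[OF nu(2)] l by simp
        then show ?thesis using bb(6)[OF tl] t(3) l by simp
      qed
      then show ?thesis by simp
    qed
  qed
  have "card (smooth_support (\<lambda>x. E x + ord_at d I x h)) \<le> card ((smooth_support E - A) \<union> P)"
    using finite_smooth_support finP by (intro card_mono sub) auto
  also have "\<dots> \<le> card (smooth_support E - A) + card P" by (rule card_Un_le)
  also have "\<dots> < card (smooth_support E - A) + card A" using cardP by simp
  also have "\<dots> = card (smooth_support E)"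
    using A_smooth finite_smooth_support finite_subset[OF A_smooth finite_smooth_support] card_mono[OF finite_smooth_support A_smooth]
    by (simp add: card_Diff_subset)
  finally show ?thesis using h(1) nn val_h unfolding fired_def by blast
qed

lemma fire: "\<exists>h. fired h"
  using fire_to_infinity fire_until_collision by blast

end

section \<open>Splitting and generation\<close>

context trop_curve
begin

text \<open>Branch points and all points carrying chips become vertices; a finite vertex of valence
  2 then lies in the support of \<open>E\<close>, as \<open>firing\<close> demands.\<close>

lemma fire_exists:
  assumes E: "\<And>x. 0 \<le> E x" "finite (supp E)" and A: "A \<subseteq> smooth_support E" "A \<noteq> {}"
    and U: "open U1" "open U2" "U1 \<inter> U2 = {}" "U1 \<union> U2 = - A" "U1 \<noteq> {}" "U2 \<noteq> {}"
    and min: "\<And>a. a \<in> A \<Longrightarrow> \<not> cut_set (A - {a})"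
  obtains h where "germs h" "\<forall>x. x \<notin> I \<longrightarrow> fv h x \<le> 0" "\<forall>x. x \<notin> I \<longrightarrow> x \<notin> U2 \<longrightarrow> fv h x = 0"
    "\<forall>x. 0 \<le> E x + ord_at d I x h"
    "card (smooth_support (\<lambda>x. E x + ord_at d I x h)) < card (smooth_support E)"
proof -
  obtain a where a: "a \<in> A" using A(2) by blast
  have aE: "a \<notin> I" "E a \<noteq> 0" using a A(1) by (auto simp: smooth_support_def)
  interpret m: model d I "I \<union> {y. y \<notin> I \<and> val y \<noteq> 2} \<union> insert a (supp E)"
    by (rule model_exists[OF E(2) aE(1)])
  interpret F: firing d I "I \<union> {y. y \<notin> I \<and> val y \<noteq> 2} \<union> insert a (supp E)" E A U1 U2
  proof
    show "E x \<noteq> 0" if "x \<in> I \<union> {y. y \<notin> I \<and> val y \<noteq> 2} \<union> insert a (supp E)" "x \<notin> I" "val x = 2" for x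
      using that aE by (auto simp: supp_def)
    show "A \<subseteq> I \<union> {y. y \<notin> I \<and> val y \<noteq> 2} \<union> insert a (supp E)"
      using A(1) by (auto simp: smooth_support_def supp_def)
  qed (use assms in auto)
  obtain h where "F.fired h" using F.fire by blast
  then show ?thesis unfolding F.fired_def by (elim conjE) (rule that)
qed

abbreviation chips :: "('a \<Rightarrow> int) \<Rightarrow> ('a \<Rightarrow> ereal) \<Rightarrow> 'a \<Rightarrow> int" where
  "chips D f \<equiv> div_add D (princ_div d I f)"

lemma Rset_iff: "f \<in> Rset d I D \<longleftrightarrow> germs f \<and> (\<forall>x. 0 \<le> chips D f x)"
  by (simp add: Rset_def rational_iff_germs effective_def)

text \<open>Firing towards either side gives corrections \<open>h1\<close> and \<open>h2\<close>
  that are at most 0 and live on the disjoint sides \<open>U2\<close> and \<open>U1\<close>. At each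
  finite point one of them vanishes, so \<open>f\<close> is the maximum of \<open>f + h1\<close> and
  \<open>f + h2\<close>.\<close>

lemma smooth_cut_reduce:
  assumes f: "f \<in> Rset d I D" and D: "divisor D" and nf: "f \<notin> smooth_cut_free d I D"
  obtains g1 g2 where "g1 \<in> Rset d I D" "g2 \<in> Rset d I D" "f = trop_add g1 g2"
    "card (smooth_support (chips D g1)) < card (smooth_support (chips D f))"
    "card (smooth_support (chips D g2)) < card (smooth_support (chips D f))"
proof -
  define E where "E = chips D f"
  have fg: "germs f" and E0: "0 \<le> E x" for x using f by (auto simp: Rset_iff E_def)
  have "supp E \<subseteq> supp D \<union> {x. ord_at d I x f \<noteq> 0}"
    by (auto simp: E_def supp_def div_add_def princ_div_def)
  then have Efin: "finite (supp E)"
    using D finite_ord[OF fg] by (auto simp: divisor_def intro: finite_subset)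
  define P where "P A \<longleftrightarrow> smooth_cut_set d I A \<and> A \<subseteq> supp E" for A
  have "\<exists>A. P A" using f nf by (auto simp: smooth_cut_free_def P_def E_def)
  \<comment> \<open>A cut set with the fewest points: removing a point from it cannot leave a cut
    set.\<close>
  then obtain A where A: "P A" "\<forall>A'. P A' \<longrightarrow> card A \<le> card A'"
    using ex_has_least_nat[of P _ card] by blast
  have cutA: "cut_set A" and valA: "\<forall>x\<in>A. valence d I x = 2" and subA: "A \<subseteq> supp E"
    using A(1) by (auto simp: P_def smooth_cut_set_def)
  have finA: "finite A" using subA Efin by (rule finite_subset)
  have AE: "A \<subseteq> smooth_support E"
    using valA subA by (auto simp: smooth_support_def supp_def valence_val split: if_splits)
  have A_ne: "A \<noteq> {}" using cutA connected_UNIV by (auto simp: cut_set_def)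
  have A_min: "\<not> cut_set (A - {a})" if a: "a \<in> A" for a
  proof
    assume "cut_set (A - {a})"
    then have "P (A - {a})" using valA subA by (auto simp: P_def smooth_cut_set_def)
    then have "card A \<le> card (A - {a})" using A(2) by blast
    then show False using card_Diff1_less[OF finA a] by simp
  qed
  obtain V1 V2 where V: "open V1" "open V2" "UNIV - A \<subseteq> V1 \<union> V2" "V1 \<inter> V2 \<inter> (UNIV - A) = {}"
    "V1 \<inter> (UNIV - A) \<noteq> {}" "V2 \<inter> (UNIV - A) \<noteq> {}"
    using cutA unfolding cut_set_def connected_def by blast
  \<comment> \<open>The separating sets are disjoint only off \<open>A\<close>. Removing the finite,
    hence closed, set \<open>A\<close> keeps them open and makes them disjoint.\<close>
  define U1 U2 where "U1 = V1 - A" and "U2 = V2 - A"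
  have U: "open U1" "open U2" "U1 \<inter> U2 = {}" "U1 \<union> U2 = - A" "U1 \<noteq> {}" "U2 \<noteq> {}"
    using V finite_imp_closed[OF finA] by (auto simp: U1_def U2_def)
  have U': "U2 \<inter> U1 = {}" "U2 \<union> U1 = - A" using U(3,4) by auto
  obtain h1 where h1: "germs h1" "\<forall>x. x \<notin> I \<longrightarrow> fv h1 x \<le> 0" "\<forall>x. x \<notin> I \<longrightarrow> x \<notin> U2 \<longrightarrow> fv h1 x = 0"
    "\<forall>x. 0 \<le> E x + ord_at d I x h1"
    "card (smooth_support (\<lambda>x. E x + ord_at d I x h1)) < card (smooth_support E)"
    by (rule fire_exists[OF E0 Efin AE A_ne U A_min])
  obtain h2 where h2: "germs h2" "\<forall>x. x \<notin> I \<longrightarrow> fv h2 x \<le> 0" "\<forall>x. x \<notin> I \<longrightarrow> x \<notin> U1 \<longrightarrow> fv h2 x = 0"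
    "\<forall>x. 0 \<le> E x + ord_at d I x h2"
    "card (smooth_support (\<lambda>x. E x + ord_at d I x h2)) < card (smooth_support E)"
    by (rule fire_exists[OF E0 Efin AE A_ne U(2,1) U' U(6,5) A_min])
  obtain g1 where g1: "germs g1" "\<forall>x. x \<notin> I \<longrightarrow> g1 x = f x + h1 x"
    "\<forall>x. ord_at d I x g1 = ord_at d I x f + ord_at d I x h1" by (rule germs_add[OF fg h1(1)])
  obtain g2 where g2: "germs g2" "\<forall>x. x \<notin> I \<longrightarrow> g2 x = f x + h2 x"
    "\<forall>x. ord_at d I x g2 = ord_at d I x f + ord_at d I x h2" by (rule germs_add[OF fg h2(1)])
  have c1: "chips D g1 = (\<lambda>x. E x + ord_at d I x h1)" and c2: "chips D g2 = (\<lambda>x. E x + ord_at d I x h2)"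
    using g1(3) g2(3) by (auto simp: E_def div_add_def princ_div_def)
  have off_I: "f x = max (g1 x) (g2 x)" if x: "x \<notin> I" for x
  proof -
    have v: "f x = ereal (fv f x)" "h1 x = ereal (fv h1 x)" "h2 x = ereal (fv h2 x)"
      using germs_finite x fg h1(1) h2(1) by blast+
    then have "g1 x = ereal (fv f x + fv h1 x)" "g2 x = ereal (fv f x + fv h2 x)"
      using g1(2) g2(2) x by (metis plus_ereal.simps(1))+
    moreover have "x \<notin> U2 \<or> x \<notin> U1" using U(3) by blast
    then have "fv h1 x = 0 \<or> fv h2 x = 0" using h1(3) h2(3) x by blast
    moreover have "fv h1 x \<le> 0" "fv h2 x \<le> 0" using h1(2) h2(2) x by auto
    moreover have "max (ereal (z + a)) (ereal (z + b)) = ereal z" if "a \<le> 0" "b \<le> 0" "a = 0 \<or> b = 0" for z a b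
      using that by (auto simp: max_def)
    ultimately show ?thesis using v(1) by simp
  qed
  have "f x = max (g1 x) (g2 x)" for x
  proof (cases "x \<in> I")
    case True
    \<comment> \<open>\<open>germs_add\<close> relates the values only off \<open>I\<close>, so the
      identity is passed to the limit along the tail.\<close>
    note lim = germs_tendsto[OF _ tailD(4)[OF True]]
    have "((\<lambda>t. max (g1 (tail x t)) (g2 (tail x t))) \<longlongrightarrow> max (g1 x) (g2 x)) at_top"
      by (intro tendsto_max lim g1(1) g2(1))
    moreover have "\<forall>\<^sub>F t in at_top. max (g1 (tail x t)) (g2 (tail x t)) = f (tail x t)"
      by (rule eventually_mono[OF eventually_ge_at_top[of 0]]) (rule off_I[symmetric, OF tailD(5)[OF True]])
    ultimately have "((\<lambda>t. f (tail x t)) \<longlongrightarrow> max (g1 x) (g2 x)) at_top" by (rule Lim_transform_eventually)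
    then show ?thesis using lim[OF fg] tendsto_unique[OF trivial_limit_at_top_linorder] by blast
  qed (rule off_I)
  then have "f = trop_add g1 g2" by (auto simp: trop_add_def)
  moreover have "g1 \<in> Rset d I D" "g2 \<in> Rset d I D"
    using g1(1) g2(1) h1(4) h2(4) by (simp_all add: Rset_iff c1 c2)
  ultimately show ?thesis using h1(5) h2(5) by (intro that[of g1 g2]) (simp_all add: c1 c2 E_def)
qed

text \<open>Both parts of the splitting have strictly smaller smooth support than \<open>f\<close>,
  so neither can be equal to \<open>f\<close>.\<close>

lemma extremal_smooth_cut_free:
  assumes f: "extremal d I D f" and D: "divisor D"
  shows "f \<in> smooth_cut_free d I D"
proof (rule ccontr)
  assume nf: "f \<notin> smooth_cut_free d I D"
  have fR: "f \<in> Rset d I D" using f by (simp add: extremal_def)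
  obtain g1 g2 where g: "g1 \<in> Rset d I D" "g2 \<in> Rset d I D" "f = trop_add g1 g2"
    "card (smooth_support (chips D g1)) < card (smooth_support (chips D f))"
    "card (smooth_support (chips D g2)) < card (smooth_support (chips D f))"
    by (rule smooth_cut_reduce[OF fR D nf])
  have "f = g1 \<or> f = g2" using f g(1-3) unfolding extremal_def by blast
  then show False using g(4,5) by auto
qed

text \<open>The number of smooth support points drops for both parts of a splitting, and the two
  families obtained for them are concatenated.\<close>

lemma smooth_cut_free_generates:
  assumes "f \<in> Rset d I D" and D: "divisor D"
  shows "\<exists>n g. 1 \<le> n \<and> (\<forall>i\<in>{1..n}. g i \<in> smooth_cut_free d I D) \<and> f = trop_sum n g"
  using assms(1)
proof (induction "card (smooth_support (chips D f))" arbitrary: f rule: less_induct)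
  case less
  show ?case
  proof (cases "f \<in> smooth_cut_free d I D")
    case True
    then show ?thesis by (intro exI[of _ 1] exI[of _ "\<lambda>_. f"]) (auto simp: trop_sum_def)
  next
    case False
    obtain g1 g2 where g: "g1 \<in> Rset d I D" "g2 \<in> Rset d I D" "f = trop_add g1 g2"
      "card (smooth_support (chips D g1)) < card (smooth_support (chips D f))"
      "card (smooth_support (chips D g2)) < card (smooth_support (chips D f))"
      by (rule smooth_cut_reduce[OF less.prems D False])
    obtain n1 p1 where 1: "1 \<le> n1" "\<forall>i\<in>{1..n1}. p1 i \<in> smooth_cut_free d I D" "g1 = trop_sum n1 p1"
      using less.hyps[OF g(4,1)] by (elim exE conjE)
    obtain n2 p2 where 2: "1 \<le> n2" "\<forall>i\<in>{1..n2}. p2 i \<in> smooth_cut_free d I D" "g2 = trop_sum n2 p2"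
      using less.hyps[OF g(5,2)] by (elim exE conjE)
    define p where "p i = (if i \<le> n1 then p1 i else p2 (i - n1))" for i
    have "f x = trop_sum (n1 + n2) p x" for x
    proof -
      have split: "{1..n1 + n2} = {1..n1} \<union> (\<lambda>i. i + n1) ` {1..n2}"
        by (auto simp: image_add_atLeastAtMost[symmetric] add.commute)
      have "(\<lambda>i. p i x) ` {1..n1 + n2} = (\<lambda>i. p1 i x) ` {1..n1} \<union> (\<lambda>i. p2 i x) ` {1..n2}"
        unfolding split image_Un image_image by (intro arg_cong2[where f = "(\<union>)"] image_cong) (auto simp: p_def)
      then show ?thesis using 1(1) 2(1) unfolding g(3) 1(3) 2(3) trop_add_def trop_sum_def
        by (simp add: Max_Un)
    qed
    moreover have "\<forall>i\<in>{1..n1 + n2}. p i \<in> smooth_cut_free d I D"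
    proof
      fix i assume i: "i \<in> {1..n1 + n2}"
      show "p i \<in> smooth_cut_free d I D"
      proof (cases "i \<le> n1")
        case True then show ?thesis using 1(2) i by (simp add: p_def)
      next
        case False
        then have "i - n1 \<in> {1..n2}" using i by auto
        then show ?thesis using 2(2) False by (simp add: p_def)
      qed
    qed
    ultimately show ?thesis using 1(1) by (intro exI[of _ "n1 + n2"] exI[of _ p]) auto
  qed
qed

end

theorem theorem6:
  fixes d :: "'a::t2_space \<Rightarrow> 'a \<Rightarrow> real" and I :: "'a set" and D :: "'a \<Rightarrow> int"
    and S :: "('a \<Rightarrow> ereal) set"
  assumes curve: "tropical_curve d I"
    and div: "divisor D"
    and S_def: "S = smooth_cut_free d I D"
  shows "(\<forall>f. extremal d I D f \<longrightarrow> f \<in> S) \<and>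
         finite (S // scaling_rel S) \<and>
         (\<forall>f\<in>Rset d I D. \<exists>n (a :: nat \<Rightarrow> real) g.
            n \<ge> 1 \<and> (\<forall>i\<in>{1..n}. g i \<in> S) \<and> f = trop_sum n (\<lambda>i. trop_scale (a i) (g i)))"
proof -
  interpret trop_curve d I using curve by unfold_locales
  have scale0: "trop_scale 0 f = f" for f :: "'a \<Rightarrow> ereal"
    by (simp add: trop_scale_def zero_ereal_def[symmetric])
  show ?thesis
  proof (intro conjI allI impI ballI)
    show "f \<in> S" if "extremal d I D f" for f
      using extremal_smooth_cut_free[OF that div] by (simp add: S_def)
    show "finite (S // scaling_rel S)" by (rule smooth_cut_free_finite[OF div S_def])
    fix f assume "f \<in> Rset d I D"
    then obtain n g where "1 \<le> n" "\<forall>i\<in>{1..n}. g i \<in> S" "f = trop_sum n g"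
      using smooth_cut_free_generates[OF _ div] unfolding S_def by blast
    \<comment> \<open>The splitting yields members of \<open>S\<close> whose maximum is already
      \<open>f\<close>, so all scalars are 0.\<close>
    then show "\<exists>n (a :: nat \<Rightarrow> real) g. n \<ge> 1 \<and> (\<forall>i\<in>{1..n}. g i \<in> S) \<and>
        f = trop_sum n (\<lambda>i. trop_scale (a i) (g i))"
      by (intro exI[of _ n] exI[of _ "\<lambda>_. 0"] exI[of _ g]) (simp add: scale0)
  qed
qed

end
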